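(* Let $n$ be a power of $2$, let $A\in\mathbb{R}^{n\times n}$, let $W\in\{0,1\}^{n\times n}$, let $k\ge1$ be an integer and let $\epsilon>0$. Let $f:\{0,1\}^{\log n}\times\{0,1\}^{\log n}\to\{0,1\}$ be the function computed by $W$ and set $k'=k\cdot 2^{R_\epsilon(f)}$. Then there is a matrix $L\in\mathbb{R}^{n\times n}$ of rank at most $k'$ with $$\|W\circ(A-L)\|_F^2\le OPT+2\epsilon\|A\circ W\|_F^2+\epsilon\|L_{opt}\circ(1-W)\|_F^2,$$ where $OPT=\min_{\text{rank-}k\ \hat L}\|W\circ(A-\hat L)\|_F^2$ and $L_{opt}$ is any rank-$k$ matrix achieving $OPT$. Moreover such an $L$ is computable in $O(\mathrm{nnz}(A))+n\cdot\mathrm{poly}(k'/\epsilon)$ time.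
   Context: $\circ$ denotes the entrywise product, $1-W$ the matrix with entries $1-W_{i,j}$, and $\mathrm{nnz}(A)$ the number of nonzero entries of $A$. Rows and columns of $W$ are indexed by $x,y\in\{0,1\}^{\log n}$ and $f(x,y)=W_{x,y}$. Communication complexity: Alice holds $x$, Bob holds $y$, they share a public random string $r$ and then run a deterministic protocol $\Pi_r$; the cost of the randomized protocol is the maximum number of bits exchanged over all inputs and all $r$. A protocol is a $(\delta_1,\delta_2)$-error protocol for $g$ if it outputs $g(x,y)$ with probability at least $1-\delta_1$ on every input with $g(x,y)=1$ and with probability at least $1-\delta_2$ on every input with $g(x,y)=0$; $R_{\delta_1,\delta_2}(g)$ is the minimum cost of such a protocol, and $R_\delta(g)=R_{\delta,\delta}(g)$. *)

theory Defs
  imports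
    "HOL-Probability.Probability_Mass_Function"
    "HOL-Library.Extended_Nat"
    "HOL-Computational_Algebra.Polynomial"
    "Jordan_Normal_Form.DL_Rank"
begin

section \<open>Matrices\<close>

definition entrywise_prod :: "real mat \<Rightarrow> real mat \<Rightarrow> real mat" (infixl "\<circ>\<^sub>H" 70) where
  "M \<circ>\<^sub>H N = mat (dim_row M) (dim_col M) (\<lambda>(i, j). M $$ (i, j) * N $$ (i, j))"

text \<open>The matrix written \<open>1 - W\<close>, where \<open>1\<close> is the all-ones matrix, not the identity.\<close>
definition one_minus_mat :: "real mat \<Rightarrow> real mat" where
  "one_minus_mat W = mat (dim_row W) (dim_col W) (\<lambda>(i, j). 1 - W $$ (i, j))"

definition frob_norm :: "real mat \<Rightarrow> real" where
  "frob_norm M = sqrt (\<Sum>i<dim_row M. \<Sum>j<dim_col M. (M $$ (i, j))\<^sup>2)"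

definition nz_positions :: "real mat \<Rightarrow> (nat \<times> nat) set" where
  "nz_positions M = {(i, j). i < dim_row M \<and> j < dim_col M \<and> M $$ (i, j) \<noteq> 0}"

definition nnz :: "real mat \<Rightarrow> nat" where
  "nnz M = card (nz_positions M)"

definition binary_mat :: "nat \<Rightarrow> real mat \<Rightarrow> bool" where
  "binary_mat n W \<longleftrightarrow> W \<in> carrier_mat n n \<and> (\<forall>i<n. \<forall>j<n. W $$ (i, j) \<in> {0, 1})"

text \<open>``Rank \<open>k\<close>'' is read as rank at most \<open>k\<close>, as usual in low-rank approximation.\<close>
definition low_rank_mats :: "nat \<Rightarrow> nat \<Rightarrow> real mat set" where
  "low_rank_mats n k = {L \<in> carrier_mat n n. vec_space.rank n L \<le> k}"

definition OPT :: "nat \<Rightarrow> nat \<Rightarrow> real mat \<Rightarrow> real mat \<Rightarrow> real" where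
  "OPT n k A W = (INF L \<in> low_rank_mats n k. (frob_norm (W \<circ>\<^sub>H (A - L)))\<^sup>2)"

text \<open>The infimum need not be attained; \<open>optimal_mats\<close> may then be empty.\<close>
definition optimal_mats :: "nat \<Rightarrow> nat \<Rightarrow> real mat \<Rightarrow> real mat \<Rightarrow> real mat set" where
  "optimal_mats n k A W =
     {L \<in> low_rank_mats n k. (frob_norm (W \<circ>\<^sub>H (A - L)))\<^sup>2 = OPT n k A W}"

text \<open>The guarantee does not depend on which optimal matrix is chosen, so a single \<open>L\<close> has to
  satisfy the bound for all of them.\<close>
definition masked_solution ::
  "nat \<Rightarrow> nat \<Rightarrow> nat \<Rightarrow> real \<Rightarrow> real mat \<Rightarrow> real mat \<Rightarrow> real mat \<Rightarrow> bool" where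
  "masked_solution n k k' \<epsilon> A W L \<longleftrightarrow>
     L \<in> carrier_mat n n \<and> vec_space.rank n L \<le> k' \<and>
     (\<forall>Lopt \<in> optimal_mats n k A W.
        (frob_norm (W \<circ>\<^sub>H (A - L)))\<^sup>2
          \<le> OPT n k A W + 2 * \<epsilon> * (frob_norm (A \<circ>\<^sub>H W))\<^sup>2
             + \<epsilon> * (frob_norm (Lopt \<circ>\<^sub>H one_minus_mat W))\<^sup>2)"


section \<open>Public-coin communication complexity\<close>

text \<open>At a node \<open>Alice p P0 P1\<close> Alice sends the bit \<open>p x\<close>, and the protocol continues with
  \<open>P1\<close> if that bit is 1 and with \<open>P0\<close> otherwise.\<close>
datatype ('a, 'b) protocol =
    Output bool
  | Alice "'a \<Rightarrow> bool" "('a, 'b) protocol" "('a, 'b) protocol"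
  | Bob "'b \<Rightarrow> bool" "('a, 'b) protocol" "('a, 'b) protocol"

primrec protocol_output :: "('a, 'b) protocol \<Rightarrow> 'a \<Rightarrow> 'b \<Rightarrow> bool" where
  "protocol_output (Output c) x y = c"
| "protocol_output (Alice p P0 P1) x y =
     (if p x then protocol_output P1 x y else protocol_output P0 x y)"
| "protocol_output (Bob q P0 P1) x y =
     (if q y then protocol_output P1 x y else protocol_output P0 x y)"

primrec bits_exchanged :: "('a, 'b) protocol \<Rightarrow> 'a \<Rightarrow> 'b \<Rightarrow> nat" where
  "bits_exchanged (Output c) x y = 0"
| "bits_exchanged (Alice p P0 P1) x y =
     Suc (if p x then bits_exchanged P1 x y else bits_exchanged P0 x y)"
| "bits_exchanged (Bob q P0 P1) x y =
     Suc (if q y then bits_exchanged P1 x y else bits_exchanged P0 x y)"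

text \<open>A randomized protocol consists of the distribution \<open>D\<close> of the public random string \<open>r\<close>
  and the deterministic protocols \<open>P r\<close>. Any discrete distribution on bit strings is allowed.\<close>
type_synonym ('a, 'b) rand_protocol =
  "bool list pmf \<times> (bool list \<Rightarrow> ('a, 'b) protocol)"

definition bitstrings :: "nat \<Rightarrow> bool list set" where
  "bitstrings m = {x. length x = m}"

fun rand_cost :: "nat \<Rightarrow> (bool list, bool list) rand_protocol \<Rightarrow> enat" where
  "rand_cost m (D, P) =
     (SUP r \<in> set_pmf D. SUP x \<in> bitstrings m. SUP y \<in> bitstrings m.
        enat (bits_exchanged (P r) x y))"

fun error_protocol :: "nat \<Rightarrow> real \<Rightarrow> real \<Rightarrow> (bool list \<Rightarrow> bool list \<Rightarrow> bool) \<Rightarrow>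
    (bool list, bool list) rand_protocol \<Rightarrow> bool" where
  "error_protocol m \<delta>1 \<delta>2 g (D, P) \<longleftrightarrow>
     (\<forall>x \<in> bitstrings m. \<forall>y \<in> bitstrings m.
        (g x y \<longrightarrow> measure_pmf.prob D {r. protocol_output (P r) x y = g x y} \<ge> 1 - \<delta>1) \<and>
        (\<not> g x y \<longrightarrow> measure_pmf.prob D {r. protocol_output (P r) x y = g x y} \<ge> 1 - \<delta>2))"

definition rand_cc2 :: "nat \<Rightarrow> real \<Rightarrow> real \<Rightarrow> (bool list \<Rightarrow> bool list \<Rightarrow> bool) \<Rightarrow> nat" where
  "rand_cc2 m \<delta>1 \<delta>2 g =
     (LEAST c. \<exists>Q. error_protocol m \<delta>1 \<delta>2 g Q \<and> rand_cost m Q = enat c)"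

definition rand_cc :: "nat \<Rightarrow> real \<Rightarrow> (bool list \<Rightarrow> bool list \<Rightarrow> bool) \<Rightarrow> nat" where
  "rand_cc m \<delta> g = rand_cc2 m \<delta> \<delta> g"

text \<open>A string in \<open>bitstrings m\<close> is the row or column index it represents in binary.\<close>
definition index_of :: "bool list \<Rightarrow> nat" where
  "index_of x = horner_sum of_bool 2 x"

definition mat_fun :: "real mat \<Rightarrow> bool list \<Rightarrow> bool list \<Rightarrow> bool" where
  "mat_fun W x y \<longleftrightarrow> W $$ (index_of x, index_of y) = 1"


section \<open>A randomized real RAM\<close>

text \<open>
  Running time is measured on a real RAM with exact real arithmetic, square roots and
  comparisons, presented as a small imperative language. A program has finitely many named
  arrays, indexed by pairs of naturals (a scalar is the cell \<open>(0, 0)\<close>); cells hold either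
  naturals or reals, separately. Reals cannot be rounded to naturals and naturals cannot be
  multiplied in one step, which excludes the unrealistic power that these operations give to
  unit-cost machines. Memory that is not part of the input is 0 initially.
\<close>

record ram_state =
  nats :: "string \<Rightarrow> nat \<Rightarrow> nat \<Rightarrow> nat"
  reals :: "string \<Rightarrow> nat \<Rightarrow> nat \<Rightarrow> real"

datatype nexp =
    NConst nat
  | NCell string nexp nexp
  | NAdd nexp nexp
  | NSub nexp nexp

datatype rexp =
    RCell string nexp nexp
  | ROfNat nexp
  | RAdd rexp rexp
  | RSub rexp rexp
  | RMul rexp rexp
  | RDiv rexp rexp
  | RSqrt rexp

datatype bexp =
    NLess nexp nexp
  | RLess rexp rexp
  | BNot bexp
  | BAnd bexp bexp

datatype com =
    NAssign string nexp nexp nexp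
  | RAssign string nexp nexp rexp
  | Draw string nexp nexp nexp
  | Seq com com
  | If bexp com com
  | While bexp com

primrec nval :: "nexp \<Rightarrow> ram_state \<Rightarrow> nat" where
  "nval (NConst c) s = c"
| "nval (NCell a e1 e2) s = nats s a (nval e1 s) (nval e2 s)"
| "nval (NAdd e1 e2) s = nval e1 s + nval e2 s"
| "nval (NSub e1 e2) s = nval e1 s - nval e2 s"

primrec rval :: "rexp \<Rightarrow> ram_state \<Rightarrow> real" where
  "rval (RCell a e1 e2) s = reals s a (nval e1 s) (nval e2 s)"
| "rval (ROfNat e) s = real (nval e s)"
| "rval (RAdd e1 e2) s = rval e1 s + rval e2 s"
| "rval (RSub e1 e2) s = rval e1 s - rval e2 s"
| "rval (RMul e1 e2) s = rval e1 s * rval e2 s"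
| "rval (RDiv e1 e2) s = rval e1 s / rval e2 s"
| "rval (RSqrt e) s = sqrt (rval e s)"

primrec bval :: "bexp \<Rightarrow> ram_state \<Rightarrow> bool" where
  "bval (NLess e1 e2) s \<longleftrightarrow> nval e1 s < nval e2 s"
| "bval (RLess e1 e2) s \<longleftrightarrow> rval e1 s < rval e2 s"
| "bval (BNot b) s \<longleftrightarrow> \<not> bval b s"
| "bval (BAnd b1 b2) s \<longleftrightarrow> bval b1 s \<and> bval b2 s"

definition write_nat :: "string \<Rightarrow> nat \<Rightarrow> nat \<Rightarrow> nat \<Rightarrow> ram_state \<Rightarrow> ram_state" where
  "write_nat a i j v s = s\<lparr>nats := (nats s)(a := (nats s a)(i := (nats s a i)(j := v)))\<rparr>"

definition write_real :: "string \<Rightarrow> nat \<Rightarrow> nat \<Rightarrow> real \<Rightarrow> ram_state \<Rightarrow> ram_state" where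
  "write_real a i j v s = s\<lparr>reals := (reals s)(a := (reals s a)(i := (reals s a i)(j := v)))\<rparr>"

text \<open>A configuration is the stack of commands still to be executed and the memory; the empty
  stack means that the program has halted. \<open>Draw a i j e\<close> stores a uniformly random element of
  \<open>{0..e}\<close> in cell \<open>(i, j)\<close> of \<open>a\<close>.\<close>
type_synonym config = "com list \<times> ram_state"

fun ram_step :: "config \<Rightarrow> config pmf" where
  "ram_step ([], s) = return_pmf ([], s)"
| "ram_step (NAssign a e1 e2 e # K, s) =
     return_pmf (K, write_nat a (nval e1 s) (nval e2 s) (nval e s) s)"
| "ram_step (RAssign a e1 e2 e # K, s) =
     return_pmf (K, write_real a (nval e1 s) (nval e2 s) (rval e s) s)"
| "ram_step (Draw a e1 e2 e # K, s) =
     map_pmf (\<lambda>v. (K, write_nat a (nval e1 s) (nval e2 s) v s)) (pmf_of_set {0..nval e s})"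
| "ram_step (Seq c1 c2 # K, s) = return_pmf (c1 # c2 # K, s)"
| "ram_step (If b c1 c2 # K, s) = return_pmf ((if bval b s then c1 else c2) # K, s)"
| "ram_step (While b c # K, s) = return_pmf (if bval b s then c # While b c # K else K, s)"

text \<open>Time is the number of steps. A fixed program contains finitely many expressions, so
  charging their individual operations would change time by a constant factor only.\<close>
primrec ram_run :: "nat \<Rightarrow> config \<Rightarrow> config pmf" where
  "ram_run 0 c = return_pmf c"
| "ram_run (Suc t) c = bind_pmf (ram_step c) (ram_run t)"

text \<open>The nonzero entries of \<open>A\<close> are given as a list of triples (row, column, value), in any
  order; \<open>es\<close> is the list of their positions. Entries of \<open>W\<close> can be read directly.\<close>
definition lists_nonzeros :: "real mat \<Rightarrow> (nat \<times> nat) list \<Rightarrow> bool" where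
  "lists_nonzeros A es \<longleftrightarrow> distinct es \<and> set es = nz_positions A"

definition ram_input ::
  "nat \<Rightarrow> nat \<Rightarrow> real \<Rightarrow> real mat \<Rightarrow> (nat \<times> nat) list \<Rightarrow> real mat \<Rightarrow> ram_state" where
  "ram_input n k' \<epsilon> A es W =
     \<lparr>nats = (\<lambda>a i j.
        if a = ''n'' \<and> i = 0 \<and> j = 0 then n
        else if a = ''rank'' \<and> i = 0 \<and> j = 0 then k'
        else if a = ''nnz'' \<and> i = 0 \<and> j = 0 then length es
        else if a = ''row'' \<and> i < length es \<and> j = 0 then fst (es ! i)
        else if a = ''col'' \<and> i < length es \<and> j = 0 then snd (es ! i)
        else if a = ''W'' \<and> i < n \<and> j < n then of_bool (W $$ (i, j) = 1)
        else 0),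
      reals = (\<lambda>a i j.
        if a = ''eps'' \<and> i = 0 \<and> j = 0 then \<epsilon>
        else if a = ''val'' \<and> i < length es \<and> j = 0 then A $$ (es ! i)
        else 0)\<rparr>"

text \<open>The output matrix is returned in factored form \<open>U V\<^sup>T\<close>, the number of columns
  of \<open>U\<close> and \<open>V\<close> being part of the output: writing all its entries would take \<open>n\<^sup>2\<close> time.\<close>
definition ram_output :: "nat \<Rightarrow> ram_state \<Rightarrow> real mat" where
  "ram_output n s = mat n n (\<lambda>(i, j).
     \<Sum>l < nats s ''r'' 0 0. reals s ''U'' i l * reals s ''V'' j l)"

end

theory Submission
  imports Defs "HOL-Analysis.Convex"

begin

text \<open>Let \<open>B = A \<circ> W\<close> and let \<open>\<Pi>\<^sub>r\<close> be an optimal protocol. Keeping the entries of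
  \<open>L\<^sub>o\<^sub>p\<^sub>t\<close> on which \<open>\<Pi>\<^sub>r\<close> outputs 1 gives a matrix of rank at most \<open>k'\<close>, because these entries
  form \<open>2\<^sup>c\<close> rectangles, and on average over \<open>r\<close> its distance to \<open>B\<close> is at most the claimed bound
  without one of the two terms \<open>\<epsilon> \<parallel>B\<parallel>\<^sup>2\<close>. So it suffices to find a rank-\<open>k'\<close> approximation of \<open>B\<close>
  with additive error \<open>\<epsilon> \<parallel>B\<parallel>\<^sup>2\<close>, and the existence of \<open>L\<close> follows from the success of the algorithm.

  The algorithm compresses the rows of \<open>B\<close> to a matrix \<open>M\<close> with \<open>S = poly(k'/\<epsilon>)\<close> rows by a count sketch,
  for which the Gram matrices of \<open>B\<close> and \<open>M\<close> differ by a small multiple of \<open>\<parallel>B\<parallel>\<^sup>2\<close>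
  in Frobenius norm. It finds an orthonormal basis \<open>F\<close> of the row space of \<open>M\<close> by Gram-Schmidt and rotates it
  by Jacobi rotations until \<open>F M\<^sup>T M F\<^sup>T\<close> is nearly diagonal and nearly sorted. The first \<open>k'\<close>
  vectors of \<open>F\<close> form \<open>V\<close>. As \<open>U = B V\<close> is too expensive, the product is approximated by a second,
  independent count sketch; by Pythagoras its error enters additively.\<close>

text \<open>The bound has to hold for all optimal matrices at once, yet the algorithm sees neither
  such a matrix nor a protocol. It receives only \<open>k'\<close> and competes with every product
  of width \<open>k'\<close>; the protocol serves solely to show that one of these products is good.
  Arithmetic and square roots do not give exact eigenvectors, so the singular vectors are replaced
  by a frame that is settled up to a tolerance theta. Choosing theta proportional to beta, the
  squared norm of \<open>B\<close>, makes the number of sweeps depend on the sketch size S and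
  \<epsilon> alone: an unsettled sweep raises by at least theta a potential that never exceeds 2 S^2
  beta. Of the available error \<epsilon> beta, a quarter is allowed for the sketched coefficients
  in \<open>U\<close>, an eighth each for replacing the Gram matrix of \<open>B\<close> by that of
  its sketch at the competitor and at the frame, and an eighth each for imperfect sorting and
  imperfect diagonality. The remaining quarter is slack.\<close>

definition dot :: "nat \<Rightarrow> (nat \<Rightarrow> real) \<Rightarrow> (nat \<Rightarrow> real) \<Rightarrow> real" where
  "dot n x y = (\<Sum>c<n. x c * y c)"

lemma dot_commute: "dot n x y = dot n y x"
  by (simp add: dot_def mult.commute)

lemma dot_cong: "(\<And>c. c < n \<Longrightarrow> x c = x' c) \<Longrightarrow> (\<And>c. c < n \<Longrightarrow> y c = y' c) \<Longrightarrow> dot n x y = dot n x' y'"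
  by (simp add: dot_def)

lemma dot_linear:
  "dot n (\<lambda>c. x c + y c) z = dot n x z + dot n y z"
  "dot n (\<lambda>c. x c - y c) z = dot n x z - dot n y z"
  "dot n (\<lambda>c. r * x c) z = r * dot n x z"
  "dot n (\<lambda>c. x c / r) z = dot n x z / r"
  by (simp_all add: dot_def algebra_simps sum.distrib sum_subtractf sum_distrib_left sum_divide_distrib)

lemma dot_linear_right:
  "dot n z (\<lambda>c. x c + y c) = dot n z x + dot n z y"
  "dot n z (\<lambda>c. x c - y c) = dot n z x - dot n z y"
  "dot n z (\<lambda>c. r * x c) = r * dot n z x"
  "dot n z (\<lambda>c. x c / r) = dot n z x / r"
  by (simp_all add: dot_def algebra_simps sum.distrib sum_subtractf sum_distrib_left sum_divide_distrib)

lemma dot_sum: "dot n (\<lambda>c. \<Sum>i\<in>I. f i c) z = (\<Sum>i\<in>I. dot n (f i) z)"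
  unfolding dot_def by (subst sum.swap) (simp add: sum_distrib_right)

lemma dot_sum_right: "dot n z (\<lambda>c. \<Sum>i\<in>I. f i c) = (\<Sum>i\<in>I. dot n z (f i))"
  using dot_sum[of n f I z] by (simp add: dot_commute[of n z])

lemma dot_self_nonneg: "dot n x x \<ge> 0"
  by (simp add: dot_def sum_nonneg)

lemma dot_self_eq_0: "dot n x x = 0 \<longleftrightarrow> (\<forall>c<n. x c = 0)"
  by (auto simp: dot_def sum_nonneg_eq_0_iff)

lemma dot_Cauchy_Schwarz: "(dot n x y)\<^sup>2 \<le> dot n x x * dot n y y"
  using Cauchy_Schwarz_ineq_sum[of x y "{..<n}"] by (simp add: dot_def power2_eq_square)

text \<open>Every orthonormal family is contractive (Bessel's inequality), and so is an orthonormal family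
  padded with zero vectors. Plane rotations preserve the property without any case distinction.\<close>
definition contractive :: "nat \<Rightarrow> nat \<Rightarrow> (nat \<Rightarrow> nat \<Rightarrow> real) \<Rightarrow> bool" where
  "contractive n N f \<longleftrightarrow> (\<forall>x. (\<Sum>i<N. (dot n (f i) x)\<^sup>2) \<le> dot n x x)"

definition reproduces :: "nat \<Rightarrow> nat \<Rightarrow> (nat \<Rightarrow> nat \<Rightarrow> real) \<Rightarrow> (nat \<Rightarrow> real) \<Rightarrow> bool" where
  "reproduces n N f x \<longleftrightarrow> (\<forall>c<n. x c = (\<Sum>i<N. dot n x (f i) * f i c))"

lemma contractive_mono:
  assumes "contractive n N f" "N' \<le> N" shows "contractive n N' f"
proof -
  have "(\<Sum>i<N'. (dot n (f i) x)\<^sup>2) \<le> (\<Sum>i<N. (dot n (f i) x)\<^sup>2)" for x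
    by (rule sum_mono2) (use assms in auto)
  then show ?thesis using assms unfolding contractive_def by (meson order_trans)
qed

text \<open>Testing contractivity on the vector \<open>f i\<close> itself gives d^2 <= d for its
  squared norm d.\<close>

lemma contractive_norm_le_1:
  assumes "contractive n N f" "i < N" shows "dot n (f i) (f i) \<le> 1"
proof -
  let ?d = "dot n (f i) (f i)"
  have "?d\<^sup>2 \<le> (\<Sum>j<N. (dot n (f j) (f i))\<^sup>2)"
    using assms(2) by (intro member_le_sum[where f="\<lambda>j. (dot n (f j) (f i))\<^sup>2"]) auto
  also have "\<dots> \<le> ?d" using assms(1) by (simp add: contractive_def)
  finally have *: "?d * ?d \<le> ?d" by (simp add: power2_eq_square)
  show ?thesis
  proof (rule ccontr)
    assume "\<not> ?d \<le> 1"
    then have "?d * 1 < ?d * ?d" by (intro mult_strict_left_mono) auto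
    with * show False by simp
  qed
qed

text \<open>The adjoint form of Bessel's inequality. By 2ab <= a^2 + b^2, twice the squared norm of
  y is at most the sum of the squares of \<open>U\<close> plus the sum of the squared coefficients
  of y, and the latter is again at most the squared norm of y.\<close>

lemma contractive_combination:
  fixes U :: "nat \<Rightarrow> real"
  assumes "contractive n N f"
  defines "y \<equiv> \<lambda>c. \<Sum>i<N. U i * f i c"
  shows "dot n y y \<le> (\<Sum>i<N. (U i)\<^sup>2)"
proof -
  have "2 * dot n y y = (\<Sum>i<N. 2 * U i * dot n (f i) y)"
    unfolding y_def by (subst dot_sum) (simp add: dot_linear sum_distrib_left mult.assoc)
  also have "\<dots> \<le> (\<Sum>i<N. (U i)\<^sup>2 + (dot n (f i) y)\<^sup>2)"
    by (rule sum_mono) (use sum_squares_bound in blast)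
  also have "\<dots> \<le> (\<Sum>i<N. (U i)\<^sup>2) + dot n y y"
    using assms(1) by (simp add: sum.distrib contractive_def)
  finally show ?thesis by simp
qed

lemma dot_diff_self: "dot n (\<lambda>c. b c - y c) (\<lambda>c. b c - y c) = dot n b b - 2 * dot n b y + dot n y y"
  by (simp add: dot_linear dot_linear_right dot_commute[of n y b])

text \<open>Completing the square after expanding the residual; for an orthonormal family this is
  Pythagoras with equality. Inexact coefficients \<open>U\<close> cost exactly their squared error,
  which is what allows them to be estimated by a sketch.\<close>

lemma contractive_residual_le:
  fixes U :: "nat \<Rightarrow> real"
  assumes "contractive n N f"
  defines "y \<equiv> \<lambda>c. \<Sum>i<N. U i * f i c"
  shows "dot n (\<lambda>c. b c - y c) (\<lambda>c. b c - y c)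
    \<le> dot n b b - (\<Sum>i<N. (dot n b (f i))\<^sup>2) + (\<Sum>i<N. (U i - dot n b (f i))\<^sup>2)"
proof -
  have "dot n b y = (\<Sum>i<N. U i * dot n b (f i))"
    unfolding y_def by (subst dot_sum_right) (simp add: dot_linear_right)
  moreover have "dot n y y \<le> (\<Sum>i<N. (U i)\<^sup>2)"
    unfolding y_def by (rule contractive_combination[OF assms(1)])
  ultimately show ?thesis unfolding dot_diff_self
    by (simp add: power2_diff sum.distrib sum_subtractf sum_distrib_left algebra_simps)
qed

text \<open>The matching lower bound for a competitor y. Reproduction expands both inner products
  with y in the coefficients of y, and the difference of the two sides becomes a sum of
  squares.\<close>

lemma reproduces_residual_ge:
  assumes "reproduces n N w y"
  shows "dot n b b - (\<Sum>i<N. (dot n b (w i))\<^sup>2) \<le> dot n (\<lambda>c. b c - y c) (\<lambda>c. b c - y c)"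
proof -
  have exp: "dot n z y = (\<Sum>i<N. dot n y (w i) * dot n z (w i))" for z
  proof -
    have "dot n z y = dot n z (\<lambda>c. \<Sum>i<N. dot n y (w i) * w i c)"
      by (rule dot_cong) (use assms in \<open>auto simp: reproduces_def\<close>)
    then show ?thesis by (simp add: dot_sum_right dot_linear_right)
  qed
  have "0 \<le> (\<Sum>i<N. (dot n y (w i) - dot n b (w i))\<^sup>2)" by (simp add: sum_nonneg)
  then show ?thesis unfolding dot_diff_self exp[of b] exp[of y]
    by (simp add: power2_eq_square sum.distrib sum_subtractf sum_distrib_left algebra_simps)
qed

lemma reproduces_dot:
  assumes "reproduces n N f x"
  shows "dot n x w = (\<Sum>i<N. dot n x (f i) * dot n (f i) w)"
proof -
  have "dot n x w = dot n (\<lambda>c. \<Sum>i<N. dot n x (f i) * f i c) w"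
    by (rule dot_cong) (use assms in \<open>auto simp: reproduces_def\<close>)
  then show ?thesis by (simp add: dot_sum dot_linear)
qed

lemma reproduces_sum:
  assumes "\<And>l. l < k \<Longrightarrow> reproduces n N w (v l)"
  shows "reproduces n N w (\<lambda>c. \<Sum>l<k. u l * v l c)"
  unfolding reproduces_def
proof (intro allI impI)
  fix c assume c: "c < n"
  have "(\<Sum>l<k. u l * v l c) = (\<Sum>l<k. u l * (\<Sum>i<N. dot n (v l) (w i) * w i c))"
    by (intro sum.cong refl) (use assms c in \<open>auto simp: reproduces_def\<close>)
  also have "\<dots> = (\<Sum>i<N. (\<Sum>l<k. u l * dot n (v l) (w i)) * w i c)"
    by (simp add: sum_distrib_left sum_distrib_right mult.assoc) (rule sum.swap)
  also have "\<dots> = (\<Sum>i<N. dot n (\<lambda>c. \<Sum>l<k. u l * v l c) (w i) * w i c)"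
    by (simp add: dot_sum dot_linear)
  finally show "(\<Sum>l<k. u l * v l c) = \<dots>" .
qed

section \<open>Gram-Schmidt\<close>

text \<open>The classical variant: every coefficient is taken against the original \<open>v\<close>,
  not against the partly reduced vector. Arithmetic is exact, so stability is not a concern.\<close>

definition gs_residual :: "nat \<Rightarrow> nat \<Rightarrow> (nat \<Rightarrow> nat \<Rightarrow> real) \<Rightarrow> (nat \<Rightarrow> real) \<Rightarrow> nat \<Rightarrow> real" where
  "gs_residual n i f v c = v c - (\<Sum>j<i. dot n v (f j) * f j c)"

text \<open>Division by zero yields zero vectors for the dependent rows.\<close>
definition gs_inv :: "nat \<Rightarrow> nat \<Rightarrow> (nat \<Rightarrow> nat \<Rightarrow> real) \<Rightarrow> (nat \<Rightarrow> nat \<Rightarrow> real) \<Rightarrow> bool" where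
  "gs_inv n i v f \<longleftrightarrow> (\<forall>j<i. \<forall>j'<i. j \<noteq> j' \<longrightarrow> dot n (f j) (f j') = 0) \<and>
     (\<forall>j<i. dot n (f j) (f j) = 1 \<or> dot n (f j) (f j) = 0) \<and> (\<forall>a<i. reproduces n i f (v a))"

lemma dot_zero_right: "dot n f f = 0 \<Longrightarrow> dot n x f = 0"
  by (simp only: dot_self_eq_0) (simp add: dot_def)

text \<open>The program writes only columns below n, so its rows equal those of
  \<open>gs_inv_step\<close> only there.\<close>

lemma gs_inv_cong:
  assumes "gs_inv n i v f" "\<And>j c. j < i \<Longrightarrow> c < n \<Longrightarrow> f j c = f' j c"
    "\<And>j c. j < i \<Longrightarrow> c < n \<Longrightarrow> v j c = v' j c"
  shows "gs_inv n i v' f'"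
proof -
  have d: "dot n (f j) (f j') = dot n (f' j) (f' j')" if "j < i" "j' < i" for j j'
    by (rule dot_cong) (use that assms in auto)
  have e: "dot n (v j) (f j') = dot n (v' j) (f' j')" if "j < i" "j' < i" for j j'
    by (rule dot_cong) (use that assms in auto)
  have "reproduces n i f' (v' a)" if "a < i" for a
  proof -
    have "reproduces n i f (v a)" using assms(1) that by (auto simp: gs_inv_def)
    then show ?thesis using that assms(2,3) e[OF that] by (simp add: reproduces_def)
  qed
  then show ?thesis using assms(1) d by (simp add: gs_inv_def)
qed

lemma gs_inv_orth:
  assumes "gs_inv n i v f" "j < i"
  shows "(\<Sum>l<i. g l * dot n (f l) (f j)) = g j * dot n (f j) (f j)"
proof -
  have "(\<Sum>l<i. g l * dot n (f l) (f j)) = (\<Sum>l<i. if l = j then g j * dot n (f j) (f j) else 0)"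
    by (rule sum.cong) (use assms in \<open>auto simp: gs_inv_def\<close>)
  then show ?thesis using assms(2) by simp
qed

text \<open>Bessel's inequality: for the projection y of x both <y, y> and <x, y> equal the sum of
  the squared coefficients, and x - y has nonnegative squared norm. Zero vectors are harmless since
  their coefficients vanish.\<close>

lemma gs_inv_contractive:
  assumes "gs_inv n i v f" shows "contractive n i f"
  unfolding contractive_def
proof
  fix x
  have *: "(dot n x (f j))\<^sup>2 * dot n (f j) (f j) = (dot n x (f j))\<^sup>2" if "j < i" for j
  proof -
    have "dot n (f j) (f j) = 1 \<or> dot n (f j) (f j) = 0" using assms that by (auto simp: gs_inv_def)
    then show ?thesis using dot_zero_right[of n "f j" x] by auto
  qed
  let ?y = "\<lambda>c. \<Sum>j<i. dot n x (f j) * f j c"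
  have "dot n ?y ?y = (\<Sum>j<i. dot n x (f j) * (\<Sum>l<i. dot n x (f l) * dot n (f l) (f j)))"
    by (subst dot_sum_right) (simp add: dot_linear_right dot_sum dot_linear)
  also have "\<dots> = (\<Sum>j<i. (dot n x (f j))\<^sup>2)"
    by (rule sum.cong) (use gs_inv_orth[OF assms, of _ "\<lambda>l. dot n x (f l)"] * in \<open>auto simp: power2_eq_square algebra_simps\<close>)
  finally have yy: "dot n ?y ?y = (\<Sum>j<i. (dot n x (f j))\<^sup>2)" .
  have xy: "dot n x ?y = (\<Sum>j<i. (dot n x (f j))\<^sup>2)"
    by (simp add: dot_sum_right dot_linear_right power2_eq_square)
  have "0 \<le> dot n (\<lambda>c. x c - ?y c) (\<lambda>c. x c - ?y c)" by (rule dot_self_nonneg)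
  then have "(\<Sum>j<i. (dot n x (f j))\<^sup>2) \<le> dot n x x" unfolding dot_diff_self xy yy by simp
  then show "(\<Sum>j<i. (dot n (f j) x)\<^sup>2) \<le> dot n x x"
    by (simp only: dot_commute[of n "f j" x for j])
qed

lemma gs_inv_step:
  assumes inv: "gs_inv n i v f"
  defines "r \<equiv> gs_residual n i f (v i)"
  shows "gs_inv n (Suc i) v (f(i := \<lambda>c. r c / sqrt (dot n r r)))"
proof -
  define q where "q = sqrt (dot n r r)"
  define g where "g = (\<lambda>c. r c / q)"
  have q2: "q * q = dot n r r" by (simp add: q_def dot_self_nonneg)
  have r: "r = (\<lambda>c. v i c - (\<Sum>j<i. dot n (v i) (f j) * f j c))"
    by (simp add: r_def gs_residual_def fun_eq_iff)
  have cases: "dot n (f j) (f j) = 1 \<or> dot n (f j) (f j) = 0" if "j < i" for j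
    using inv that by (auto simp: gs_inv_def)
  have rf: "dot n r (f j) = 0" if "j < i" for j
  proof -
    have "dot n r (f j) = dot n (v i) (f j) - dot n (v i) (f j) * dot n (f j) (f j)"
      unfolding r using gs_inv_orth[OF inv that, of "\<lambda>l. dot n (v i) (f l)"]
      by (simp add: dot_linear dot_sum)
    also have "\<dots> = 0" using cases[OF that] dot_zero_right[of n "f j" "v i"] by auto
    finally show ?thesis .
  qed
  have gf: "dot n g (f j) = 0" "dot n (f j) g = 0" if "j < i" for j
    using rf[OF that] by (simp_all add: g_def dot_linear dot_commute[of n "f j"])
  have gg: "dot n g g = 1 \<or> dot n g g = 0"
  proof (cases "q = 0")
    case True
    then show ?thesis by (simp add: g_def dot_def)
  next
    case False
    then show ?thesis by (simp add: g_def dot_linear dot_linear_right flip: q2)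
  qed
  \<comment> \<open>This also covers \<open>q = 0\<close>, where the residual vanishes on all
    columns below n, so that \<open>v i\<close> is reproduced by the earlier vectors alone.\<close>
  have rg: "r c = q * g c" if "c < n" for c
  proof (cases "q = 0")
    case True
    then have "dot n r r = 0" using q2 by simp
    then show ?thesis using that True by (simp add: dot_self_eq_0)
  qed (simp add: g_def)
  \<comment> \<open>Earlier rows already lie in the span of the earlier vectors, so their
    coefficient at the new vector is 0.\<close>
  have repr_prev: "reproduces n (Suc i) (f(i := g)) (v a)" if a: "a < i" for a
  proof -
    have ra: "reproduces n i f (v a)" using inv a by (auto simp: gs_inv_def)
    have "dot n (v a) g = (\<Sum>j<i. dot n (v a) (f j) * dot n (f j) g)" by (rule reproduces_dot[OF ra])
    also have "\<dots> = 0" using gf by simp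
    finally show ?thesis using ra by (simp add: reproduces_def)
  qed
  have "reproduces n (Suc i) (f(i := g)) (v i)"
    unfolding reproduces_def
  proof (intro allI impI)
    fix c assume c: "c < n"
    have vi: "v i = (\<lambda>c. r c + (\<Sum>j<i. dot n (v i) (f j) * f j c))" by (simp add: r)
    have "dot n (v i) g = dot n r g"
      by (subst vi) (simp add: dot_linear dot_sum gf)
    also have "\<dots> = q"
    proof -
      have "dot n r g = dot n r r / q" by (simp add: g_def dot_linear_right)
      also have "\<dots> = q" using q2 by (cases "q = 0") (auto simp: field_simps)
      finally show ?thesis .
    qed
    finally have "dot n (v i) g * g c = r c" using rg[OF c] by simp
    then show "v i c = (\<Sum>j<Suc i. dot n (v i) ((f(i := g)) j) * (f(i := g)) j c)"
      by (simp add: r)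
  qed
  then have "\<forall>a<Suc i. reproduces n (Suc i) (f(i := g)) (v a)"
    using repr_prev less_Suc_eq by auto
  moreover have "\<forall>j<Suc i. \<forall>j'<Suc i. j \<noteq> j' \<longrightarrow> dot n ((f(i := g)) j) ((f(i := g)) j') = 0"
    using inv gf by (auto simp: gs_inv_def less_Suc_eq)
  moreover have "\<forall>j<Suc i. dot n ((f(i := g)) j) ((f(i := g)) j) = 1 \<or> dot n ((f(i := g)) j) ((f(i := g)) j) = 0"
    using inv gg by (auto simp: gs_inv_def less_Suc_eq)
  ultimately show ?thesis by (simp add: gs_inv_def g_def q_def)
qed

text \<open>Serves the analysis: it orthonormalizes the row factor of an arbitrary competitor, which
  the program never computes.\<close>

lemma gs_exists: "\<exists>f. gs_inv n i v f"
proof (induction i)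
  case 0 then show ?case by (simp add: gs_inv_def)
next
  case (Suc i) then show ?case using gs_inv_step by blast
qed

section \<open>Jacobi rotations\<close>

text \<open>The bilinear form of the Gram matrix of the rows of \<open>M\<close>. On frame vectors
  its values are the entries of the matrix that the rotations diagonalize.\<close>

definition quad :: "nat \<Rightarrow> nat \<Rightarrow> (nat \<Rightarrow> nat \<Rightarrow> real) \<Rightarrow> (nat \<Rightarrow> real) \<Rightarrow> (nat \<Rightarrow> real) \<Rightarrow> real" where
  "quad n s M x y = (\<Sum>a<s. dot n (M a) x * dot n (M a) y)"

text \<open>By how much the larger eigenvalue of the symmetric matrix with rows \<open>(a, b)\<close> and \<open>(b, d)\<close> exceeds \<open>a\<close>.
  An eigenvector for it is \<open>(b, gain a b d)\<close>.\<close>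
definition gain :: "real \<Rightarrow> real \<Rightarrow> real \<Rightarrow> real" where
  "gain a b d = (d - a + sqrt ((a - d)\<^sup>2 + 4 * b\<^sup>2)) / 2"

text \<open>For the eigenvalue a + e the characteristic equation says that the product of e and a +
  e - d is b^2. The square root in \<open>gain\<close> is at least |a - d|, which yields both lower
  bounds.\<close>

lemma gain_props:
  shows gain_quadratic: "(gain a b d)\<^sup>2 + (a - d) * gain a b d = b\<^sup>2"
    and gain_nonneg: "gain a b d \<ge> 0" and gain_ge: "d - a \<le> gain a b d"
proof -
  let ?R = "sqrt ((a - d)\<^sup>2 + 4 * b\<^sup>2)"
  have R2: "?R * ?R = (a - d)\<^sup>2 + 4 * b\<^sup>2" by simp
  have "\<bar>a - d\<bar> \<le> ?R" by (rule real_le_rsqrt) simp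
  then show "gain a b d \<ge> 0" "d - a \<le> gain a b d" by (auto simp: gain_def)
  show "(gain a b d)\<^sup>2 + (a - d) * gain a b d = b\<^sup>2"
    unfolding gain_def using R2 by (simp add: power2_eq_square field_simps)
qed

text \<open>The plane rotation with cosine b / sqrt (b^2 + e^2) and sine e / sqrt (b^2 + e^2); for e
  the gain, it turns \<open>f i\<close> into the top eigenvector of the 2x2 block. Columns from n on
  stay untouched, so a smaller n describes a rotation loop that is only partly done.\<close>

definition rot :: "nat \<Rightarrow> nat \<Rightarrow> nat \<Rightarrow> real \<Rightarrow> real \<Rightarrow> (nat \<Rightarrow> nat \<Rightarrow> real) \<Rightarrow> nat \<Rightarrow> nat \<Rightarrow> real" where
  "rot n i j b e f = f(
     i := \<lambda>c. if c < n then (b * f i c + e * f j c) / sqrt (b\<^sup>2 + e\<^sup>2) else f i c,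
     j := \<lambda>c. if c < n then (b * f j c - e * f i c) / sqrt (b\<^sup>2 + e\<^sup>2) else f j c)"

lemma dot_rot:
  assumes "i \<noteq> j"
  shows "dot n x (rot n i j b e f l) =
    (if l = i then (b * dot n x (f i) + e * dot n x (f j)) / sqrt (b\<^sup>2 + e\<^sup>2)
     else if l = j then (b * dot n x (f j) - e * dot n x (f i)) / sqrt (b\<^sup>2 + e\<^sup>2)
     else dot n x (f l))"
proof -
  have 1: "dot n x (rot n i j b e f i) = dot n x (\<lambda>c. (b * f i c + e * f j c) / sqrt (b\<^sup>2 + e\<^sup>2))"
    by (rule dot_cong) (use assms in \<open>auto simp: rot_def\<close>)
  have 2: "dot n x (rot n i j b e f j) = dot n x (\<lambda>c. (b * f j c - e * f i c) / sqrt (b\<^sup>2 + e\<^sup>2))"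
    by (rule dot_cong) (use assms in \<open>auto simp: rot_def\<close>)
  show ?thesis
    using 1 2 assms by (auto simp: dot_linear_right) (simp add: rot_def)
qed

lemma sum_split_pair:
  fixes i j N :: nat and h :: "nat \<Rightarrow> real"
  assumes "i < N" "j < N" "i \<noteq> j"
  shows "(\<Sum>l<N. h l) = h i + h j + (\<Sum>l\<in>{..<N} - {i, j}. h l)"
proof -
  have "(\<Sum>l<N. h l) = (\<Sum>l\<in>{i, j}. h l) + (\<Sum>l\<in>{..<N} - {i, j}. h l)"
    by (subst sum.subset_diff[of "{i, j}"]) (use assms in auto)
  then show ?thesis using assms by simp
qed

text \<open>Rotations preserve inner products in the plane. The bilinear form serves three purposes:
  sums of squared coefficients, products of a coefficient with a vector entry, and the trace of the
  2x2 block.\<close>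

lemma rotated_squares:
  fixes b e x y :: real
  assumes "b\<^sup>2 + e\<^sup>2 > 0"
  shows "((b * x + e * y) / sqrt (b\<^sup>2 + e\<^sup>2)) * ((b * x' + e * y') / sqrt (b\<^sup>2 + e\<^sup>2))
    + ((b * y - e * x) / sqrt (b\<^sup>2 + e\<^sup>2)) * ((b * y' - e * x') / sqrt (b\<^sup>2 + e\<^sup>2)) = x * x' + y * y'"
proof -
  let ?q = "sqrt (b\<^sup>2 + e\<^sup>2)"
  have q: "?q * ?q = b\<^sup>2 + e\<^sup>2" using assms by simp
  have "((b * x + e * y) / ?q) * ((b * x' + e * y') / ?q) + ((b * y - e * x) / ?q) * ((b * y' - e * x') / ?q)
    = ((b * x + e * y) * (b * x' + e * y') + (b * y - e * x) * (b * y' - e * x')) / (?q * ?q)"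
    by (simp only: times_divide_times_eq add_divide_distrib[symmetric])
  also have "\<dots> = ((b\<^sup>2 + e\<^sup>2) * (x * x' + y * y')) / (b\<^sup>2 + e\<^sup>2)"
    unfolding q by (simp add: power2_eq_square algebra_simps)
  also have "\<dots> = x * x' + y * y'"
    by (rule nonzero_mult_div_cancel_left) (use assms in linarith)
  finally show ?thesis .
qed

lemma rot_contractive:
  assumes "contractive n N f" "i < N" "j < N" "i \<noteq> j" "b\<^sup>2 + e\<^sup>2 > 0"
  shows "contractive n N (rot n i j b e f)"
  unfolding contractive_def
proof
  fix x
  have "(\<Sum>l<N. (dot n (rot n i j b e f l) x)\<^sup>2) = (\<Sum>l<N. (dot n (f l) x)\<^sup>2)"
    unfolding sum_split_pair[OF assms(2-4)] dot_commute[of n _ x] dot_rot[OF assms(4)]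
    using assms(4) rotated_squares[OF assms(5), of "dot n x (f i)" "dot n x (f j)" "dot n x (f i)" "dot n x (f j)"]
    by (simp add: power2_eq_square)
  then show "(\<Sum>l<N. (dot n (rot n i j b e f l) x)\<^sup>2) \<le> dot n x x"
    using assms(1) by (simp add: contractive_def)
qed

lemma rot_reproduces:
  assumes "reproduces n N f x" "i < N" "j < N" "i \<noteq> j" "b\<^sup>2 + e\<^sup>2 > 0"
  shows "reproduces n N (rot n i j b e f) x"
  unfolding reproduces_def
proof (intro allI impI)
  fix c assume c: "c < n"
  have "(\<Sum>l<N. dot n x (rot n i j b e f l) * rot n i j b e f l c) = (\<Sum>l<N. dot n x (f l) * f l c)"
    unfolding sum_split_pair[OF assms(2-4)] dot_rot[OF assms(4)]
    using assms(4) c rotated_squares[OF assms(5), of "dot n x (f i)" "dot n x (f j)" "f i c" "f j c"]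
    by (simp add: rot_def)
  then show "x c = (\<Sum>l<N. dot n x (rot n i j b e f l) * rot n i j b e f l c)"
    using assms(1) c by (simp add: reproduces_def)
qed

text \<open>The weights decrease, so a rotation that moves energy to the smaller index increases the potential;
  in this way the diagonal also gets sorted.\<close>
definition jacobi_potential :: "nat \<Rightarrow> nat \<Rightarrow> (nat \<Rightarrow> nat \<Rightarrow> real) \<Rightarrow> (nat \<Rightarrow> nat \<Rightarrow> real) \<Rightarrow> real" where
  "jacobi_potential n s M f = (\<Sum>l<s. real (s - l) * quad n s M (f l) (f l))"

lemma quad_rot:
  fixes f M :: "nat \<Rightarrow> nat \<Rightarrow> real" and n :: nat
  assumes "i \<noteq> j" "b\<^sup>2 + e\<^sup>2 > 0"
  defines "f' \<equiv> rot n i j b e f"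
  shows "quad n s M (f' i) (f' i) = (b\<^sup>2 * quad n s M (f i) (f i) + 2 * b * e * quad n s M (f i) (f j)
      + e\<^sup>2 * quad n s M (f j) (f j)) / (b\<^sup>2 + e\<^sup>2)"
    and "quad n s M (f' i) (f' i) + quad n s M (f' j) (f' j) = quad n s M (f i) (f i) + quad n s M (f j) (f j)"
    and "l \<noteq> i \<Longrightarrow> l \<noteq> j \<Longrightarrow> quad n s M (f' l) (f' l) = quad n s M (f l) (f l)"
proof -
  have q: "sqrt (b\<^sup>2 + e\<^sup>2) * sqrt (b\<^sup>2 + e\<^sup>2) = b\<^sup>2 + e\<^sup>2" using assms by simp
  have doti: "dot n x (rot n i j b e f i) = (b * dot n x (f i) + e * dot n x (f j)) / sqrt (b\<^sup>2 + e\<^sup>2)" for x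
    by (simp add: dot_rot[OF assms(1)])
  have dotj: "dot n x (rot n i j b e f j) = (b * dot n x (f j) - e * dot n x (f i)) / sqrt (b\<^sup>2 + e\<^sup>2)" for x
    using assms(1) by (simp add: dot_rot[OF assms(1)])
  show "quad n s M (f' i) (f' i) = (b\<^sup>2 * quad n s M (f i) (f i) + 2 * b * e * quad n s M (f i) (f j)
      + e\<^sup>2 * quad n s M (f j) (f j)) / (b\<^sup>2 + e\<^sup>2)"
    unfolding quad_def f'_def doti sum_distrib_left sum.distrib[symmetric] sum_divide_distrib
  proof (rule sum.cong[OF refl])
    fix a
    let ?x = "dot n (M a) (f i)" and ?y = "dot n (M a) (f j)"
    have "(b * ?x + e * ?y) * (b * ?x + e * ?y)
      = b\<^sup>2 * (?x * ?x) + 2 * b * e * (?x * ?y) + e\<^sup>2 * (?y * ?y)"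
      by (simp add: power2_eq_square algebra_simps)
    then show "(b * ?x + e * ?y) / sqrt (b\<^sup>2 + e\<^sup>2) * ((b * ?x + e * ?y) / sqrt (b\<^sup>2 + e\<^sup>2))
      = (b\<^sup>2 * (?x * ?x) + 2 * b * e * (?x * ?y) + e\<^sup>2 * (?y * ?y)) / (b\<^sup>2 + e\<^sup>2)"
      by (simp only: times_divide_times_eq q)
  qed
  show "quad n s M (f' i) (f' i) + quad n s M (f' j) (f' j) = quad n s M (f i) (f i) + quad n s M (f j) (f j)"
    unfolding quad_def f'_def doti dotj sum.distrib[symmetric]
    by (simp only: rotated_squares[OF assms(2)])
  show "l \<noteq> i \<Longrightarrow> l \<noteq> j \<Longrightarrow> quad n s M (f' l) (f' l) = quad n s M (f l) (f l)"
    by (simp add: f'_def rot_def)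
qed

lemma quad_self_nonneg: "quad n s M x x \<ge> 0"
  by (simp add: quad_def sum_nonneg)

text \<open>The rotation changes the two diagonal entries to a + e and d - e and leaves the others
  alone. The weight of i exceeds that of j by j - i, which is at least 1.\<close>

lemma rot_potential:
  fixes f M :: "nat \<Rightarrow> nat \<Rightarrow> real" and n :: nat
  assumes ij: "i < j" "j < s"
  defines "b \<equiv> quad n s M (f i) (f j)"
  defines "e \<equiv> gain (quad n s M (f i) (f i)) b (quad n s M (f j) (f j))"
  assumes "e > 0"
  shows "jacobi_potential n s M (rot n i j b e f) \<ge> jacobi_potential n s M f + e"
proof -
  let ?f = "rot n i j b e f"
  define a where "a = quad n s M (f i) (f i)"
  define d where "d = quad n s M (f j) (f j)"
  have ne: "i \<noteq> j" and pos: "b\<^sup>2 + e\<^sup>2 > 0" using assms(1,5) by (auto simp: add_nonneg_pos)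
  have quadr: "b\<^sup>2 = e\<^sup>2 + (a - d) * e"
    using gain_quadratic[of a b d] by (simp add: e_def a_def d_def)
  \<comment> \<open>This is the Rayleigh quotient of the eigenvector (b, e) for the eigenvalue a +
    e, with denominators cleared.\<close>
  have num: "b\<^sup>2 * a + 2 * b * e * b + e\<^sup>2 * d = (a + e) * (b\<^sup>2 + e\<^sup>2)"
  proof -
    have "b\<^sup>2 * a + 2 * b * e * b + e\<^sup>2 * d - (a + e) * (b\<^sup>2 + e\<^sup>2) = e * (b\<^sup>2 - (e\<^sup>2 + (a - d) * e))"
      by (simp add: power2_eq_square algebra_simps)
    then show ?thesis using quadr by simp
  qed
  have nz: "b\<^sup>2 + e\<^sup>2 \<noteq> 0" using pos by linarith
  have "quad n s M (?f i) (?f i) = (b\<^sup>2 * a + 2 * b * e * b + e\<^sup>2 * d) / (b\<^sup>2 + e\<^sup>2)"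
    using quad_rot(1)[OF ne pos, of n s M f] by (simp only: a_def d_def b_def)
  then have qi: "quad n s M (?f i) (?f i) = a + e"
    by (simp only: num nonzero_mult_div_cancel_right[OF nz])
  then have qj: "quad n s M (?f j) (?f j) = d - e"
    using quad_rot(2)[OF ne pos, of n s M f] by (simp add: a_def d_def)
  have "i < s" using ij by simp
  have "jacobi_potential n s M ?f = jacobi_potential n s M f + (real (s - i) - real (s - j)) * e"
    unfolding jacobi_potential_def sum_split_pair[OF \<open>i < s\<close> ij(2) ne]
    by (simp add: qi qj quad_rot(3)[OF ne pos] algebra_simps flip: a_def d_def)
  moreover have "real (s - i) - real (s - j) \<ge> 1" using ij by linarith
  then have "(real (s - i) - real (s - j)) * e \<ge> 1 * e"
    using assms(5) by (intro mult_right_mono) auto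
  ultimately show ?thesis by linarith
qed

text \<open>A small gain bounds two things at once: the off-diagonal entry and the amount by which
  the pair is out of order. See \<open>gain_le_imp\<close>.\<close>

definition jacobi_settled :: "nat \<Rightarrow> nat \<Rightarrow> (nat \<Rightarrow> nat \<Rightarrow> real) \<Rightarrow> real \<Rightarrow> (nat \<Rightarrow> nat \<Rightarrow> real) \<Rightarrow> bool" where
  "jacobi_settled n s M \<theta> f \<longleftrightarrow> (\<forall>i j. i < j \<longrightarrow> j < s \<longrightarrow>
     gain (quad n s M (f i) (f i)) (quad n s M (f i) (f j)) (quad n s M (f j) (f j)) \<le> \<theta>)"

lemma quad_commute: "quad n s M x y = quad n s M y x"
  by (simp add: quad_def mult.commute)

text \<open>The second bound uses b^2 = e (e + a - d), where e <= \<theta> and d >= 0.\<close>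

lemma gain_le_imp:
  assumes "gain a b d \<le> \<theta>" "a \<ge> 0" "d \<ge> 0"
  shows "d \<le> a + \<theta>" "b\<^sup>2 \<le> \<theta> * (a + \<theta>)"
proof -
  show "d \<le> a + \<theta>" using gain_ge[of d a b] assms by linarith
  have g: "gain a b d \<ge> 0" "d - a \<le> gain a b d" using gain_nonneg gain_ge by blast+
  have "b\<^sup>2 = gain a b d * (gain a b d + a - d)"
    using gain_quadratic[of a b d] by (simp add: power2_eq_square algebra_simps)
  also have "\<dots> \<le> \<theta> * (a + \<theta>)"
    by (rule mult_mono) (use g assms in linarith)+
  finally show "b\<^sup>2 \<le> \<theta> * (a + \<theta>)" .
qed

text \<open>A fractional knapsack: if the values are nearly decreasing, weights in [0, 1] of total
  at most k cannot do much better than weight 1 on the first k indices.\<close>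

lemma top_weights:
  fixes h p :: "nat \<Rightarrow> real"
  assumes k: "1 \<le> k" "k \<le> N" and p: "\<And>i. i < N \<Longrightarrow> 0 \<le> p i" "\<And>i. i < N \<Longrightarrow> p i \<le> 1"
    and sum_p: "(\<Sum>i<N. p i) \<le> real k" and h0: "\<And>i. i < N \<Longrightarrow> h i \<ge> 0"
    and h: "\<And>i j. i < j \<Longrightarrow> j < N \<Longrightarrow> h j \<le> h i + \<theta>" and \<theta>: "\<theta> \<ge> 0"
  shows "(\<Sum>i<N. h i * p i) \<le> (\<Sum>i<k. h i) + 2 * real k * \<theta>"
proof -
  \<comment> \<open>The value at index k - 1 is a threshold between the first k indices and the
    rest. In the sum over i its multiple has factor (sum of p) - k <= 0, and only the terms with
    \<theta> survive.\<close>
  define \<mu> where "\<mu> = h (k - 1)"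
  have *: "h i * p i - (if i < k then h i else 0)
      \<le> \<mu> * (p i - (if i < k then 1 else 0)) + \<theta> * (p i + (if i < k then 1 else 0))" if "i < N" for i
  proof (cases "i < k")
    case True
    have "\<mu> \<le> h i + \<theta>"
    proof (cases "i = k - 1")
      case False
      then show ?thesis unfolding \<mu>_def using True k by (intro h) auto
    qed (use \<theta> in \<open>simp add: \<mu>_def\<close>)
    then have "(\<mu> - \<theta>) * (1 - p i) \<le> h i * (1 - p i)"
      using p(2)[OF that] by (intro mult_right_mono) auto
    moreover have "0 \<le> 2 * \<theta> * p i" using \<theta> p(1)[OF that] by simp
    ultimately show ?thesis using True by (simp add: algebra_simps)
  next
    case False
    then have "h i \<le> \<mu> + \<theta>" unfolding \<mu>_def using that k by (intro h) auto
    then have "h i * p i \<le> (\<mu> + \<theta>) * p i" using p(1)[OF that] by (intro mult_right_mono) auto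
    then show ?thesis using False by (simp add: algebra_simps)
  qed
  have cnt: "(\<Sum>i<N. if i < k then g i else 0) = (\<Sum>i<k. g i)" for g :: "nat \<Rightarrow> real"
  proof -
    have "(\<Sum>i<N. if i < k then g i else 0) = sum g ({..<N} \<inter> {i. i < k})" by (simp add: sum.inter_restrict)
    also have "{..<N} \<inter> {i. i < k} = {..<k}" using k by auto
    finally show ?thesis .
  qed
  have "(\<Sum>i<N. h i * p i) - (\<Sum>i<k. h i) = (\<Sum>i<N. h i * p i - (if i < k then h i else 0))"
    by (simp add: sum_subtractf cnt)
  also have "\<dots> \<le> (\<Sum>i<N. \<mu> * (p i - (if i < k then 1 else 0)) + \<theta> * (p i + (if i < k then 1 else 0)))"
    by (rule sum_mono) (use * in auto)
  also have "\<dots> = \<mu> * ((\<Sum>i<N. p i) - real k) + \<theta> * ((\<Sum>i<N. p i) + real k)"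
    by (simp add: sum.distrib sum_subtractf cnt flip: sum_distrib_left)
  also have "\<dots> \<le> 0 + \<theta> * (real k + real k)"
  proof (rule add_mono)
    have "\<mu> \<ge> 0" unfolding \<mu>_def using k by (intro h0) auto
    then show "\<mu> * ((\<Sum>i<N. p i) - real k) \<le> 0" using sum_p by (simp add: mult_nonneg_nonpos)
  qed (use \<theta> sum_p in \<open>simp add: mult_left_mono\<close>)
  finally show ?thesis by (simp add: algebra_simps)
qed

lemma abs_mult_le_half: "\<bar>x * y\<bar> \<le> (x * x + y * y) / 2" for x y :: real
  using sum_squares_bound[of "\<bar>x\<bar>" "\<bar>y\<bar>"] by (simp add: abs_mult power2_eq_square)

lemma sum_swap3:
  "(\<Sum>a\<in>A. \<Sum>i\<in>I. \<Sum>j\<in>J. h a i j) = (\<Sum>i\<in>I. \<Sum>j\<in>J. \<Sum>a\<in>A. h a i j)"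
  by (subst sum.swap) (rule sum.cong[OF refl], rule sum.swap)

text \<open>An approximate Ky Fan principle. Expanded in the frame, the energy of \<open>w\<close>
  is the sum of \<open>H i j * p i j\<close>; \<open>top_weights\<close> handles the diagonal, and
  each of the at most s^2 off-diagonal terms is at most \<gamma>.\<close>

lemma settled_near_optimal:
  assumes settled: "jacobi_settled n s M \<theta> f" and f: "contractive n s f"
    and repr: "\<And>a. a < s \<Longrightarrow> reproduces n s f (M a)" and w: "contractive n k w"
    and k: "1 \<le> k" "k \<le> s" and \<theta>: "\<theta> \<ge> 0" and \<gamma>: "\<gamma> \<ge> 0"
    and bound: "\<And>i. i < s \<Longrightarrow> \<theta> * (quad n s M (f i) (f i) + \<theta>) \<le> \<gamma>\<^sup>2"
  shows "(\<Sum>l<k. quad n s M (w l) (w l))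
    \<le> (\<Sum>i<k. quad n s M (f i) (f i)) + 2 * real k * \<theta> + (real s)\<^sup>2 * \<gamma>"
proof -
  define H where "H = (\<lambda>i j. quad n s M (f i) (f j))"
  \<comment> \<open>The matrix, in frame coordinates, of the sum of the rank-one forms of the
    vectors \<open>w l\<close>. Contractivity of \<open>w\<close> bounds its diagonal by 1,
    contractivity of \<open>f\<close> bounds its trace by k.\<close>
  define p where "p = (\<lambda>i j. \<Sum>l<k. dot n (f i) (w l) * dot n (f j) (w l))"
  have Hsym: "H i j = H j i" for i j by (simp add: H_def quad_commute)
  have H0: "H i i \<ge> 0" for i by (simp add: H_def quad_self_nonneg)
  have ord: "H j j \<le> H i i + \<theta>" and off: "\<bar>H i j\<bar> \<le> \<gamma>" if "i < j" "j < s" for i j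
  proof -
    have g: "gain (H i i) (H i j) (H j j) \<le> \<theta>"
      using settled that by (simp add: jacobi_settled_def H_def)
    show "H j j \<le> H i i + \<theta>" using gain_le_imp(1)[OF g H0 H0] .
    have "(H i j)\<^sup>2 \<le> \<gamma>\<^sup>2"
      using gain_le_imp(2)[OF g H0 H0] bound[of i] that by (simp add: H_def)
    then show "\<bar>H i j\<bar> \<le> \<gamma>" using \<gamma> abs_le_square_iff[of "H i j" \<gamma>] by simp
  qed
  have off': "\<bar>H i j\<bar> \<le> \<gamma>" if "i \<noteq> j" "i < s" "j < s" for i j
    using off[of i j] off[of j i] that Hsym[of i j] by (cases i j rule: linorder_cases) auto
  have pii: "p i i \<le> 1" if "i < s" for i
  proof -
    have "p i i = (\<Sum>l<k. (dot n (w l) (f i))\<^sup>2)"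
      by (simp add: p_def power2_eq_square dot_commute)
    also have "\<dots> \<le> dot n (f i) (f i)" using w by (simp add: contractive_def)
    also have "\<dots> \<le> 1" by (rule contractive_norm_le_1[OF f that])
    finally show ?thesis .
  qed
  have pij: "\<bar>p i j\<bar> \<le> 1" if "i < s" "j < s" for i j
  proof -
    have "\<bar>p i j\<bar> \<le> (\<Sum>l<k. \<bar>dot n (f i) (w l) * dot n (f j) (w l)\<bar>)"
      unfolding p_def by (rule sum_abs)
    also have "\<dots> \<le> (\<Sum>l<k. (dot n (f i) (w l) * dot n (f i) (w l) + dot n (f j) (w l) * dot n (f j) (w l)) / 2)"
    proof (rule sum_mono)
      fix l
      show "\<bar>dot n (f i) (w l) * dot n (f j) (w l)\<bar>
        \<le> (dot n (f i) (w l) * dot n (f i) (w l) + dot n (f j) (w l) * dot n (f j) (w l)) / 2"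
        by (rule abs_mult_le_half)
    qed
    also have "\<dots> = (p i i + p j j) / 2"
      unfolding p_def sum.distrib[symmetric] sum_divide_distrib by (rule refl)
    also have "\<dots> \<le> 1" using pii[OF that(1)] pii[OF that(2)] by simp
    finally show ?thesis .
  qed
  have sum_p: "(\<Sum>i<s. p i i) \<le> real k"
  proof -
    have "(\<Sum>i<s. p i i) = (\<Sum>l<k. \<Sum>i<s. (dot n (f i) (w l))\<^sup>2)"
      unfolding p_def by (subst sum.swap) (simp add: power2_eq_square)
    also have "\<dots> \<le> (\<Sum>l<k. 1)"
    proof (rule sum_mono)
      fix l assume "l \<in> {..<k}"
      have "(\<Sum>i<s. (dot n (f i) (w l))\<^sup>2) \<le> dot n (w l) (w l)" using f by (simp add: contractive_def)
      also have "\<dots> \<le> 1" using contractive_norm_le_1[OF w] \<open>l \<in> {..<k}\<close> by simp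
      finally show "(\<Sum>i<s. (dot n (f i) (w l))\<^sup>2) \<le> 1" .
    qed
    finally show ?thesis by simp
  qed
  have diag: "(\<Sum>i<s. H i i * p i i) \<le> (\<Sum>i<k. H i i) + 2 * real k * \<theta>"
  proof (rule top_weights[OF k])
    show "0 \<le> p i i" for i by (simp add: p_def sum_nonneg)
  qed (use pii sum_p H0 ord \<theta> in auto)
  have "(\<Sum>l<k. quad n s M (w l) (w l))
    = (\<Sum>l<k. \<Sum>a<s. (\<Sum>i<s. dot n (M a) (f i) * dot n (f i) (w l)) * (\<Sum>j<s. dot n (M a) (f j) * dot n (f j) (w l)))"
    unfolding quad_def
    by (intro sum.cong refl arg_cong2[where f=times] reproduces_dot repr) auto
  also have "\<dots> = (\<Sum>l<k. \<Sum>a<s. \<Sum>i<s. \<Sum>j<s. (dot n (M a) (f i) * dot n (M a) (f j)) * (dot n (f i) (w l) * dot n (f j) (w l)))"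
    by (simp add: sum_product mult_ac)
  also have "\<dots> = (\<Sum>l<k. \<Sum>i<s. \<Sum>j<s. H i j * (dot n (f i) (w l) * dot n (f j) (w l)))"
    unfolding H_def quad_def sum_distrib_right
    by (rule sum.cong[OF refl], rule sum_swap3)
  also have "\<dots> = (\<Sum>i<s. \<Sum>j<s. H i j * p i j)"
    unfolding p_def sum_distrib_left
    by (rule sum_swap3)
  also have "\<dots> \<le> (\<Sum>i<s. \<Sum>j<s. (if i = j then H i i * p i i else 0) + \<gamma>)"
  proof (intro sum_mono)
    fix i j assume ij: "i \<in> {..<s}" "j \<in> {..<s}"
    show "H i j * p i j \<le> (if i = j then H i i * p i i else 0) + \<gamma>"
    proof (cases "i = j")
      case False
      have "H i j * p i j \<le> \<bar>H i j\<bar> * \<bar>p i j\<bar>" by (simp flip: abs_mult)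
      also have "\<dots> \<le> \<gamma> * 1" by (rule mult_mono) (use off' pij False ij \<gamma> in auto)
      finally show ?thesis using False by simp
    qed (use \<gamma> in simp)
  qed
  also have "\<dots> = (\<Sum>i<s. H i i * p i i) + (real s)\<^sup>2 * \<gamma>"
    by (simp add: sum.distrib power2_eq_square)
  finally show ?thesis using diag by (simp add: H_def)
qed

section \<open>Averages over random hash functions\<close>

text \<open>Coordinates are drawn in the order of the loop in \<open>draw_com\<close>, and those
  from n on are 0. There are N + 1 equally likely values, so S signed buckets correspond to
  \<open>N = 2 * S - 1\<close>.\<close>

primrec hashes :: "nat \<Rightarrow> nat \<Rightarrow> (nat \<Rightarrow> nat) pmf" where
  "hashes N 0 = return_pmf (\<lambda>_. 0)"
| "hashes N (Suc n) = bind_pmf (hashes N n) (\<lambda>g. map_pmf (\<lambda>v. g(n := v)) (pmf_of_set {0..N}))"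

text \<open>The expectation under \<open>hashes\<close> as an iterated finite average, so that
  moments can be computed by induction on n; \<open>measure_bind_hashes\<close> links the
  two.\<close>

primrec avg :: "nat \<Rightarrow> nat \<Rightarrow> ((nat \<Rightarrow> nat) \<Rightarrow> real) \<Rightarrow> real" where
  "avg N 0 X = X (\<lambda>_. 0)"
| "avg N (Suc n) X = avg N n (\<lambda>g. (\<Sum>v\<le>N. X (g(n := v))) / real (Suc N))"

lemma measure_bind_pmf_of_set:
  assumes "finite S" "S \<noteq> {}"
  shows "measure_pmf.prob (bind_pmf (pmf_of_set S) f) A = (\<Sum>v\<in>S. measure_pmf.prob (f v) A) / real (card S)"
proof -
  have c: "card S > 0" using assms by (simp add: card_gt_0_iff)
  have "emeasure (measure_pmf (bind_pmf (pmf_of_set S) f)) A = (\<Sum>v\<in>S. emeasure (measure_pmf (f v)) A) / of_nat (card S)"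
    using assms by (simp add: nn_integral_pmf_of_set)
  also have "\<dots> = ennreal (\<Sum>v\<in>S. measure_pmf.prob (f v) A) / ennreal (real (card S))"
    by (simp add: measure_pmf.emeasure_eq_measure sum_ennreal ennreal_of_nat_eq_real_of_nat)
  also have "\<dots> = ennreal ((\<Sum>v\<in>S. measure_pmf.prob (f v) A) / real (card S))"
    by (rule divide_ennreal) (use c in \<open>auto intro: sum_nonneg\<close>)
  finally show ?thesis
    by (simp add: measure_pmf.emeasure_eq_measure sum_nonneg)
qed

lemma measure_bind_hashes:
  "measure_pmf.prob (bind_pmf (hashes N n) f) A = avg N n (\<lambda>g. measure_pmf.prob (f g) A)"
proof (induction n arbitrary: f)
  case 0 then show ?case by (simp add: bind_return_pmf)
next
  case (Suc n)
  have "measure_pmf.prob (bind_pmf (hashes N (Suc n)) f) A =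
    avg N n (\<lambda>g. measure_pmf.prob (bind_pmf (pmf_of_set {0..N}) (\<lambda>v. f (g(n := v)))) A)"
    by (simp add: bind_assoc_pmf bind_map_pmf Suc.IH)
  then show ?case by (simp add: measure_bind_pmf_of_set atLeast0AtMost)
qed

lemma avg_add: "avg N n (\<lambda>g. X g + Y g) = avg N n X + avg N n Y"
  by (induction n arbitrary: X Y) (simp_all add: sum.distrib add_divide_distrib)

lemma avg_cmult: "avg N n (\<lambda>g. r * X g) = r * avg N n X"
  by (induction n arbitrary: X) (simp_all flip: sum_distrib_left times_divide_eq_right)

lemma avg_const: "avg N n (\<lambda>_. r) = r"
  by (induction n) (simp_all del: of_nat_Suc)

lemma avg_sum: "avg N n (\<lambda>g. \<Sum>i\<in>I. X i g) = (\<Sum>i\<in>I. avg N n (X i))"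
  by (induction I rule: infinite_finite_induct) (simp_all add: avg_const avg_add)

lemma avg_mono:
  "(\<And>g. (\<And>i. i < n \<Longrightarrow> g i \<le> N) \<Longrightarrow> X g \<le> Y g) \<Longrightarrow> avg N n X \<le> avg N n Y"
proof (induction n arbitrary: X Y)
  case (Suc n)
  show ?case unfolding avg.simps
  proof (rule Suc.IH, intro divide_right_mono sum_mono)
    fix g :: "nat \<Rightarrow> nat" and v assume "\<And>i. i < n \<Longrightarrow> g i \<le> N" "v \<in> {..N}"
    then show "X (g(n := v)) \<le> Y (g(n := v))" by (intro Suc.prems) (auto simp: less_Suc_eq)
  qed simp
qed simp

lemma avg_cong:
  assumes "\<And>g. (\<And>i. i < n \<Longrightarrow> g i \<le> N) \<Longrightarrow> X g = Y g" shows "avg N n X = avg N n Y"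
  by (rule antisym; rule avg_mono) (simp_all add: assms)

lemma avg_Markov:
  assumes X: "\<And>g. X g \<ge> 0" and avg: "avg N n X \<le> q * c" and c: "c \<ge> 0" and q: "q \<ge> 0"
  shows "avg N n (\<lambda>g. of_bool (X g \<le> c)) \<ge> 1 - q"
proof (cases "c = 0")
  case False
  then have "c > 0" using c by simp
  \<comment> \<open>The linear function 1 - X / c lies below the indicator of X <= c.\<close>
  have "avg N n (\<lambda>g. 1 + (- 1 / c) * X g) \<le> avg N n (\<lambda>g. of_bool (X g \<le> c))"
    by (rule avg_mono) (use X \<open>c > 0\<close> in \<open>auto simp: field_simps\<close>)
  moreover have "avg N n X / c \<le> q" using avg \<open>c > 0\<close> by (simp add: field_simps)
  moreover have "avg N n (\<lambda>g. 1 + (- 1 / c) * X g) = 1 + (- 1 / c) * avg N n X"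
    by (simp only: avg_add avg_const avg_cmult)
  ultimately show ?thesis by simp
next
  case True
  \<comment> \<open>A nonnegative quantity with average 0 vanishes on every outcome. The case c = 0
    does arise: both error thresholds are 0 when the masked matrix is 0.\<close>
  have "avg N n X \<le> 0 \<Longrightarrow> avg N n (\<lambda>g. of_bool (X g \<le> 0)) \<ge> 1"
    using X
  proof (induction n arbitrary: X)
    case (Suc n)
    have "avg N n (\<lambda>g. of_bool ((\<Sum>v\<le>N. X (g(n := v))) / real (Suc N) \<le> 0)) \<ge> 1"
    proof (rule Suc.IH)
      show "avg N n (\<lambda>g. (\<Sum>v\<le>N. X (g(n := v))) / real (Suc N)) \<le> 0"
        using Suc.prems(1) by (simp only: avg.simps)
    qed (intro divide_nonneg_nonneg sum_nonneg Suc.prems(2), simp)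
    moreover have "avg N n (\<lambda>g. of_bool ((\<Sum>v\<le>N. X (g(n := v))) / real (Suc N) \<le> 0))
      \<le> avg N (Suc n) (\<lambda>g. of_bool (X g \<le> 0))"
      unfolding avg.simps
    proof (rule avg_mono)
      fix g
      show "of_bool ((\<Sum>v\<le>N. X (g(n := v))) / real (Suc N) \<le> 0)
        \<le> (\<Sum>v\<le>N. of_bool (X (g(n := v)) \<le> 0)) / real (Suc N)"
      proof (cases "(\<Sum>v\<le>N. X (g(n := v))) / real (Suc N) \<le> 0")
        case True
        then have "(\<Sum>v\<le>N. X (g(n := v))) \<le> 0" by (simp add: divide_le_0_iff)
        then have "(\<Sum>v\<le>N. X (g(n := v))) = 0" using Suc.prems(2) by (intro antisym sum_nonneg) auto
        then have "X (g(n := v)) = 0" if "v \<le> N" for v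
          using that Suc.prems(2) by (simp add: sum_nonneg_eq_0_iff)
        then have "(\<Sum>v\<le>N. of_bool (X (g(n := v)) \<le> 0)) = real (Suc N)" by simp
        then show ?thesis by (simp del: of_nat_Suc)
      qed (auto intro!: divide_nonneg_nonneg sum_nonneg)
    qed
    ultimately show ?case by linarith
  qed auto
  then show ?thesis using True avg q by simp
qed

section \<open>The count sketch\<close>

text \<open>A hash value \<open>v < 2 * s\<close> encodes both a bucket and a sign: \<open>v < s\<close> is bucket \<open>v\<close> with sign 1, and
  \<open>s + a\<close> is bucket \<open>a\<close> with sign -1.\<close>
definition bucket :: "nat \<Rightarrow> nat \<Rightarrow> nat \<Rightarrow> real" where
  "bucket s v a = of_bool (v = a) - of_bool (v = s + a)"

text \<open>The inner product of the signed unit vectors encoded by two hash values below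
  \<open>2 * s\<close>: 1 for equal values, -1 for the same bucket with opposite signs, 0 for
  different buckets.\<close>

definition collide :: "nat \<Rightarrow> nat \<Rightarrow> nat \<Rightarrow> real" where
  "collide s u v = (\<Sum>a<s. bucket s u a * bucket s v a)"

lemma sum_bucket: "a < s \<Longrightarrow> (\<Sum>v<2 * s. bucket s v a) = 0"
  by (simp add: bucket_def sum_subtractf of_bool_def)

lemma sum_bucket_square: "a < s \<Longrightarrow> (\<Sum>v<2 * s. (bucket s v a)\<^sup>2) = 2"
proof -
  assume a: "a < s"
  have "(bucket s v a)\<^sup>2 = of_bool (v = a) + of_bool (v = s + a)" for v
    using a by (auto simp: bucket_def)
  then show ?thesis using a by (simp add: sum.distrib of_bool_def)
qed

lemma collide_eq:
  assumes "u < 2 * s"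
  shows "collide s u v = (if u < s then bucket s v u else - bucket s v (u - s))"
proof (cases "u < s")
  case True
  have "collide s u v = (\<Sum>a<s. if a = u then bucket s v u else 0)"
    unfolding collide_def by (rule sum.cong) (use True in \<open>auto simp: bucket_def\<close>)
  then show ?thesis using True by simp
next
  case False
  have "collide s u v = (\<Sum>a<s. if a = u - s then - bucket s v (u - s) else 0)"
    unfolding collide_def by (rule sum.cong) (use False in \<open>auto simp: bucket_def\<close>)
  then show ?thesis using False assms by simp
qed

lemma collide_commute: "collide s u v = collide s v u"
  by (simp add: collide_def mult.commute)

lemma collide_self: "u < 2 * s \<Longrightarrow> collide s u u = 1"
  by (auto simp: collide_eq bucket_def)

lemma sum_collide: "u < 2 * s \<Longrightarrow> (\<Sum>v<2 * s. collide s u v) = 0"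
  by (cases "u < s") (auto simp: collide_eq sum_bucket sum_negf)

lemma sum_collide_square: "u < 2 * s \<Longrightarrow> (\<Sum>v<2 * s. (collide s u v)\<^sup>2) = 2"
  by (cases "u < s") (auto simp: collide_eq sum_bucket_square)

text \<open>Against a fixed \<open>v\<close> a fresh hash value collides with mean 0 and second
  moment 2 / (2 s). So the cross term of the square drops out and each index contributes (z i)^2 /
  s.\<close>

lemma avg_linear_collide:
  assumes s: "s > 0" and v: "v < 2 * s"
  shows "avg (2 * s - 1) n (\<lambda>g. (\<Sum>i<n. z i * collide s v (g i))\<^sup>2) = (\<Sum>i<n. (z i)\<^sup>2) / s"
proof (induction n)
  case (Suc n)
  let ?N = "2 * s - 1"
  have atMost: "{..?N} = {..<2 * s}" and card: "real (Suc ?N) = 2 * s" using s by auto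
  have "(\<Sum>w<2 * s. ((\<Sum>i<n. z i * collide s v (g i)) + z n * collide s v w)\<^sup>2) / (2 * s)
    = (\<Sum>i<n. z i * collide s v (g i))\<^sup>2 + (z n)\<^sup>2 / s" for g
  proof -
    let ?t = "\<Sum>i<n. z i * collide s v (g i)"
    have "(\<Sum>w<2 * s. (?t + z n * collide s v w)\<^sup>2)
      = (\<Sum>w<2 * s. ?t\<^sup>2 + 2 * ?t * z n * collide s v w + (z n)\<^sup>2 * (collide s v w)\<^sup>2)"
      by (rule sum.cong) (auto simp: power2_eq_square algebra_simps)
    also have "\<dots> = 2 * s * ?t\<^sup>2 + 2 * (z n)\<^sup>2"
      by (simp add: sum.distrib sum_collide[OF v] sum_collide_square[OF v] flip: sum_distrib_left)
    finally show ?thesis using s by (simp add: field_simps)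
  qed
  moreover have "(\<Sum>i<n. z i * collide s v ((g(n := w)) i)) = (\<Sum>i<n. z i * collide s v (g i))" for g w
    by (rule sum.cong) auto
  ultimately show ?case
    unfolding avg.simps atMost card sum.lessThan_Suc fun_upd_same
    by (simp only: avg_add avg_const Suc.IH add_divide_distrib)
qed simp

text \<open>The summands of the last index have mean zero given the earlier ones, so that the
  second moments add up.\<close>
lemma avg_bilinear_collide:
  assumes s: "s > 0"
  shows "avg (2 * s - 1) n (\<lambda>g. (\<Sum>j<n. \<Sum>i<j. z i j * collide s (g j) (g i))\<^sup>2) = (\<Sum>j<n. \<Sum>i<j. (z i j)\<^sup>2) / s"
proof (induction n)
  case (Suc n)
  let ?N = "2 * s - 1"
  have atMost: "{..?N} = {..<2 * s}" and card: "real (Suc ?N) = 2 * s" using s by auto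
  let ?T = "\<lambda>g. \<Sum>j<n. \<Sum>i<j. z i j * collide s (g j) (g i)"
  let ?L = "\<lambda>v g. \<Sum>i<n. z i n * collide s v (g i)"
  have zero: "(\<Sum>v<2 * s. ?L v g) = 0" if g: "\<And>i. i < n \<Longrightarrow> g i \<le> ?N" for g
  proof -
    have "(\<Sum>v<2 * s. ?L v g) = (\<Sum>i<n. z i n * (\<Sum>v<2 * s. collide s (g i) v))"
      by (subst sum.swap) (simp add: collide_commute[of s _ "g _"] sum_distrib_left)
    also have "\<dots> = 0"
    proof (rule sum.neutral, safe)
      fix i assume "i < n"
      then have "g i < 2 * s" using g[of i] s by linarith
      then show "z i n * (\<Sum>v<2 * s. collide s (g i) v) = 0" by (simp add: sum_collide)
    qed
    finally show ?thesis .
  qed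
  have "avg ?N (Suc n) (\<lambda>g. (\<Sum>j<Suc n. \<Sum>i<j. z i j * collide s (g j) (g i))\<^sup>2)
    = avg ?N n (\<lambda>g. (\<Sum>v<2 * s. (?T g + ?L v g)\<^sup>2) / (2 * s))"
    unfolding avg.simps atMost card by simp
  also have "\<dots> = avg ?N n (\<lambda>g. (?T g)\<^sup>2 + (1 / (2 * s)) * (\<Sum>v<2 * s. (?L v g)\<^sup>2))"
  proof (rule avg_cong)
    fix g assume g: "\<And>i. i < n \<Longrightarrow> g i \<le> ?N"
    have z0: "(\<Sum>v<2 * s. ?L v g) = 0" by (rule zero) (rule g)
    have "(\<Sum>v<2 * s. (?T g + ?L v g)\<^sup>2) = (\<Sum>v<2 * s. (?T g)\<^sup>2 + 2 * ?T g * ?L v g + (?L v g)\<^sup>2)"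
      by (rule sum.cong) (simp_all add: power2_sum)
    also have "\<dots> = 2 * s * (?T g)\<^sup>2 + 2 * ?T g * (\<Sum>v<2 * s. ?L v g) + (\<Sum>v<2 * s. (?L v g)\<^sup>2)"
      by (simp only: sum.distrib sum_distrib_left) simp
    finally have *: "(\<Sum>v<2 * s. (?T g + ?L v g)\<^sup>2) = 2 * s * (?T g)\<^sup>2 + (\<Sum>v<2 * s. (?L v g)\<^sup>2)"
      using z0 by simp
    show "(\<Sum>v<2 * s. (?T g + ?L v g)\<^sup>2) / (2 * s) = (?T g)\<^sup>2 + (1 / (2 * s)) * (\<Sum>v<2 * s. (?L v g)\<^sup>2)"
      unfolding * using s by (simp add: add_divide_distrib)
  qed
  also have "\<dots> = (\<Sum>j<n. \<Sum>i<j. (z i j)\<^sup>2) / s + (1 / (2 * s)) * (\<Sum>v<2 * s. (\<Sum>i<n. (z i n)\<^sup>2) / s)"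
    unfolding avg_add avg_cmult avg_sum Suc.IH using avg_linear_collide[OF s] by simp
  also have "\<dots> = (\<Sum>j<Suc n. \<Sum>i<j. (z i j)\<^sup>2) / s"
    using s by (simp add: add_divide_distrib)
  finally show ?case .
qed simp

definition sketch :: "nat \<Rightarrow> nat \<Rightarrow> (nat \<Rightarrow> nat) \<Rightarrow> (nat \<Rightarrow> real) \<Rightarrow> nat \<Rightarrow> real" where
  "sketch s n g x a = (\<Sum>i<n. bucket s (g i) a * x i)"

definition sketch_err :: "nat \<Rightarrow> nat \<Rightarrow> (nat \<Rightarrow> nat) \<Rightarrow> (nat \<Rightarrow> real) \<Rightarrow> (nat \<Rightarrow> real) \<Rightarrow> real" where
  "sketch_err s n g x y = (\<Sum>a<s. sketch s n g x a * sketch s n g y a) - dot n x y"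

lemma sum_triangle:
  fixes t :: "nat \<Rightarrow> nat \<Rightarrow> real"
  shows "(\<Sum>i<n. \<Sum>j<n. t i j) = (\<Sum>i<n. t i i) + (\<Sum>j<n. \<Sum>i<j. t i j + t j i)"
  by (induction n) (simp_all add: sum.distrib)

text \<open>An index always collides with itself with value 1, so the diagonal pairs give the exact
  inner product. The error consists of the pairs i < j alone.\<close>

lemma sketch_err_eq:
  assumes "\<And>i. i < n \<Longrightarrow> g i < 2 * s"
  shows "sketch_err s n g x y = (\<Sum>j<n. \<Sum>i<j. (x i * y j + x j * y i) * collide s (g j) (g i))"
proof -
  have "(\<Sum>a<s. sketch s n g x a * sketch s n g y a) = (\<Sum>a<s. \<Sum>i<n. \<Sum>j<n. (bucket s (g i) a * bucket s (g j) a) * (x i * y j))"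
    by (simp add: sketch_def sum_product mult_ac)
  also have "\<dots> = (\<Sum>i<n. \<Sum>j<n. \<Sum>a<s. (bucket s (g i) a * bucket s (g j) a) * (x i * y j))"
    by (subst sum.swap) (rule sum.cong[OF refl], rule sum.swap)
  also have "\<dots> = (\<Sum>i<n. \<Sum>j<n. collide s (g i) (g j) * (x i * y j))"
    by (simp add: collide_def sum_distrib_right)
  also have "\<dots> = (\<Sum>i<n. collide s (g i) (g i) * (x i * y i))
    + (\<Sum>j<n. \<Sum>i<j. collide s (g i) (g j) * (x i * y j) + collide s (g j) (g i) * (x j * y i))"
    by (rule sum_triangle)
  also have "(\<Sum>i<n. collide s (g i) (g i) * (x i * y i)) = dot n x y"
    unfolding dot_def by (rule sum.cong) (use assms in \<open>auto simp: collide_self\<close>)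
  finally show ?thesis
    by (simp add: sketch_err_def collide_commute[of s "g _" "g _"] algebra_simps)
qed

text \<open>The factor 2 comes from (a + b)^2 <= 2 a^2 + 2 b^2, after which the pairs i < j in both
  orders are part of the full double sum.\<close>

lemma avg_sketch_err:
  assumes s: "s > 0"
  shows "avg (2 * s - 1) n (\<lambda>g. (sketch_err s n g x y)\<^sup>2) \<le> 2 / s * (dot n x x * dot n y y)"
proof -
  have "avg (2 * s - 1) n (\<lambda>g. (sketch_err s n g x y)\<^sup>2)
    = avg (2 * s - 1) n (\<lambda>g. (\<Sum>j<n. \<Sum>i<j. (x i * y j + x j * y i) * collide s (g j) (g i))\<^sup>2)"
  proof (rule avg_cong)
    fix g assume "\<And>i. i < n \<Longrightarrow> g i \<le> 2 * s - 1"
    then have "g i < 2 * s" if "i < n" for i using that s by fastforce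
    then show "(sketch_err s n g x y)\<^sup>2 = (\<Sum>j<n. \<Sum>i<j. (x i * y j + x j * y i) * collide s (g j) (g i))\<^sup>2"
      by (simp add: sketch_err_eq)
  qed
  also have "\<dots> = (\<Sum>j<n. \<Sum>i<j. (x i * y j + x j * y i)\<^sup>2) / s"
    by (rule avg_bilinear_collide[OF s])
  also have "\<dots> \<le> (2 * (dot n x x * dot n y y)) / s"
  proof (rule divide_right_mono)
    have "(\<Sum>j<n. \<Sum>i<j. (x i * y j + x j * y i)\<^sup>2)
      \<le> (\<Sum>j<n. \<Sum>i<j. 2 * (x i * y j)\<^sup>2 + 2 * (x j * y i)\<^sup>2)"
    proof (intro sum_mono)
      fix i j
      have "0 \<le> (x i * y j - x j * y i)\<^sup>2" by simp
      then show "(x i * y j + x j * y i)\<^sup>2 \<le> 2 * (x i * y j)\<^sup>2 + 2 * (x j * y i)\<^sup>2"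
        by (simp add: power2_sum power2_diff)
    qed
    also have "\<dots> \<le> (\<Sum>i<n. \<Sum>j<n. 2 * (x i * y j)\<^sup>2)"
      unfolding sum_triangle by (simp add: sum_nonneg)
    also have "\<dots> = (\<Sum>i<n. \<Sum>j<n. 2 * ((x i * x i) * (y j * y j)))"
      by (simp add: power2_eq_square mult_ac)
    also have "\<dots> = 2 * (dot n x x * dot n y y)"
      unfolding dot_def sum_product by (simp only: sum_distrib_left)
    finally show "(\<Sum>j<n. \<Sum>i<j. (x i * y j + x j * y i)\<^sup>2) \<le> 2 * (dot n x x * dot n y y)" .
  qed simp
  finally show ?thesis by (simp add: field_simps)
qed

section \<open>Rank factorizations\<close>

text \<open>A maximal independent set of columns has at most k elements and spans every column; the
  coefficients form the second factor.\<close>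

lemma rank_le_imp_factors:
  fixes L :: "real mat"
  assumes L: "L \<in> carrier_mat n n" and rank: "vec_space.rank n L \<le> k"
  shows "\<exists>u v :: nat \<Rightarrow> nat \<Rightarrow> real. \<forall>i<n. \<forall>j<n. L $$ (i, j) = (\<Sum>l<k. u l i * v l j)"
proof -
  interpret vec_space "TYPE(real)" n .
  obtain S where S: "maximal S (\<lambda>T. T \<subseteq> set (cols L) \<and> lin_indpt T)" and fin: "finite S"
    using maximal_exists_superset[of "set (cols L)" "\<lambda>T. T \<subseteq> set (cols L) \<and> lin_indpt T" "{}"]
    by (auto simp: lin_dep_def)
  have card: "card S \<le> k" using rank_card_indpt[OF L S] rank by simp
  have cols: "set (cols L) \<subseteq> carrier_vec n" using cols_dim L by blast
  have SC: "S \<subseteq> set (cols L)" and li: "lin_indpt S" using S by (auto simp: maximal_def)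
  then have Sn: "S \<subseteq> carrier_vec n" using cols by blast
  have "\<exists>a. \<forall>i<n. L $$ (i, j) = (\<Sum>x\<in>S. a x * x $ i)" if j: "j < n" for j
  proof -
    have cj: "col L j \<in> set (cols L)" using j L by (metis carrier_matD(2) cols_length cols_nth nth_mem)
    have "col L j \<in> span S"
    proof (rule ccontr)
      assume out: "col L j \<notin> span S"
      then have "lin_indpt (S \<union> {col L j})"
        using lin_dep_iff_in_span[OF Sn li] cj cols span_mem[OF Sn] by auto
      then have "S \<union> {col L j} = S" using S cj SC by (auto simp: maximal_def)
      then show False using out span_mem[OF Sn, of "col L j"] by blast
    qed
    then obtain a where "lincomb a S = col L j" using finite_in_span[OF fin Sn] by metis
    then have "L $$ (i, j) = (\<Sum>x\<in>S. a x * x $ i)" if "i < n" for i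
      using lincomb_index[OF that Sn, of a] that j L by simp
    then show ?thesis by blast
  qed
  then obtain a where a: "\<And>i j. i < n \<Longrightarrow> j < n \<Longrightarrow> L $$ (i, j) = (\<Sum>x\<in>S. a j x * x $ i)" by metis
  obtain e where e: "bij_betw e {..<card S} S"
    using ex_bij_betw_nat_finite[OF fin] by (auto simp: atLeast0LessThan)
  \<comment> \<open>Zero columns pad the factorization from the rank to exactly k terms.\<close>
  define u where "u = (\<lambda>l i. if l < card S then e l $ i else 0)"
  define v where "v = (\<lambda>l j. a j (e l))"
  have "L $$ (i, j) = (\<Sum>l<k. u l i * v l j)" if "i < n" "j < n" for i j
  proof -
    have "L $$ (i, j) = (\<Sum>l<card S. a j (e l) * e l $ i)"
      using a[OF that] sum.reindex_bij_betw[OF e, of "\<lambda>x. a j x * x $ i"] by simp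
    also have "\<dots> = (\<Sum>l<card S. u l i * v l j)" by (simp add: u_def v_def mult.commute)
    also have "\<dots> = (\<Sum>l<k. u l i * v l j)"
      by (rule sum.mono_neutral_left) (use card in \<open>auto simp: u_def\<close>)
    finally show ?thesis .
  qed
  then show ?thesis by blast
qed

lemma rank_factors_le:
  fixes u v :: "nat \<Rightarrow> nat \<Rightarrow> real"
  shows "vec_space.rank n (mat n n (\<lambda>(i, j). \<Sum>l<r. u i l * v j l)) \<le> r"
proof (induction r)
  case 0
  have *: "mat n n (\<lambda>(i, j). \<Sum>l<0. u i l * v j l) = 0\<^sub>m n n" by auto
  show ?case unfolding * using vec_space.rank_0I[of n n, where 'a=real] by simp
next
  case (Suc r)
  let ?A = "mat n n (\<lambda>(i, j). \<Sum>l<r. u i l * v j l)" and ?B = "mat n n (\<lambda>(i, j). u i r * v j r)"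
  have "mat n n (\<lambda>(i, j). \<Sum>l<Suc r. u i l * v j l) = ?A + ?B" by auto
  moreover have "vec_space.rank n (?A + ?B) \<le> vec_space.rank n ?A + vec_space.rank n ?B"
    by (rule vec_space.rank_subadditive) auto
  moreover have "vec_space.rank n ?B \<le> 1"
    by (rule vec_space.rank_le_1_product_entries[where f="\<lambda>i. u i r" and g="\<lambda>j. v j r"]) auto
  ultimately show ?case using Suc by simp
qed

section \<open>Averaging over a randomized protocol\<close>

lemma sum_lessThan_add: "(\<Sum>t<a + b. h t) = (\<Sum>t<a. h t) + (\<Sum>t<b. h (a + t))"
  for h :: "nat \<Rightarrow> 'a :: comm_monoid_add" and a b :: nat
  by (induction b) (simp_all add: add.assoc)

lemma sum_div_mod:
  "(\<Sum>l<k * N. h (l div k) (l mod k)) = (\<Sum>t<N. \<Sum>l<k. h t l)"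
  for h :: "nat \<Rightarrow> nat \<Rightarrow> 'a :: comm_monoid_add" and k N :: nat
proof (induction N)
  case (Suc N)
  have "(\<Sum>l<k * Suc N. h (l div k) (l mod k)) = (\<Sum>l<k * N + k. h (l div k) (l mod k))" by (simp add: add.commute)
  then show ?case using Suc by (simp add: sum_lessThan_add)
qed simp

text \<open>Alice tests her input against the elements of \<open>X\<close> one by one; at the first
  hit Bob, who then knows her input, announces the value. Only finiteness of the cost
  matters.\<close>

lemma protocol_exists:
  assumes "finite X"
  shows "\<exists>(P :: ('a, 'b) protocol) c. \<forall>x\<in>X. \<forall>y. protocol_output P x y = g x y \<and> bits_exchanged P x y \<le> c"
  using assms
proof induction
  case (insert x X)
  then obtain P :: "('a, 'b) protocol" and c
    where P: "\<forall>x\<in>X. \<forall>y. protocol_output P x y = g x y \<and> bits_exchanged P x y \<le> c" by blast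
  show ?case
    by (rule exI[of _ "Alice (\<lambda>z. z = x) P (Bob (g x) (Output False) (Output True))"], rule exI[of _ "Suc (max c 1)"])
      (use P in \<open>auto simp: le_max_iff_disj\<close>)
qed auto

lemma finite_bitstrings: "finite (bitstrings m)"
proof -
  have "bitstrings m = {x. set x \<subseteq> UNIV \<and> length x = m}" by (auto simp: bitstrings_def)
  then show ?thesis by (simp only: finite_lists_length_eq[OF finite])
qed

text \<open>The \<open>LEAST\<close> in \<open>rand_cc2\<close> means something only if some
  protocol has finite cost; the trivial protocol on a one-point random string provides it. The cost
  bound is available just for strings in the support of \<open>D\<close>.\<close>

lemma rand_cc_attained:
  assumes "\<epsilon> \<ge> 0"
  obtains D P where "error_protocol m \<epsilon> \<epsilon> g (D, P)"
    "\<And>r x y. r \<in> set_pmf D \<Longrightarrow> x \<in> bitstrings m \<Longrightarrow> y \<in> bitstrings m \<Longrightarrow> bits_exchanged (P r) x y \<le> rand_cc m \<epsilon> g"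
proof -
  obtain P0 :: "(bool list, bool list) protocol" and c
    where P0: "\<forall>x\<in>bitstrings m. \<forall>y. protocol_output P0 x y = g x y \<and> bits_exchanged P0 x y \<le> c"
    using protocol_exists[OF finite_bitstrings, where g=g] by blast
  let ?Q = "(return_pmf [], \<lambda>_. P0) :: (bool list, bool list) rand_protocol"
  have err: "error_protocol m \<epsilon> \<epsilon> g ?Q" using P0 assms by simp
  have "rand_cost m ?Q \<le> enat c" using P0 by (auto intro!: SUP_least)
  then obtain c' where "rand_cost m ?Q = enat c'" by (cases "rand_cost m ?Q") auto
  with err have "\<exists>c Q. error_protocol m \<epsilon> \<epsilon> g Q \<and> rand_cost m Q = enat c" by blast
  then have "\<exists>Q. error_protocol m \<epsilon> \<epsilon> g Q \<and> rand_cost m Q = enat (rand_cc m \<epsilon> g)"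
    unfolding rand_cc_def rand_cc2_def by (rule LeastI_ex)
  then obtain D P where Q: "error_protocol m \<epsilon> \<epsilon> g (D, P)" "rand_cost m (D, P) = enat (rand_cc m \<epsilon> g)"
    by (metis surj_pair)
  show ?thesis
  proof (rule that[OF Q(1)])
    fix r x y assume "r \<in> set_pmf D" "x \<in> bitstrings m" "y \<in> bitstrings m"
    then have "enat (bits_exchanged (P r) x y) \<le> rand_cost m (D, P)"
      by (simp only: rand_cost.simps) (intro SUP_upper2[of r] SUP_upper2[of x] SUP_upper2[of y] order_refl)
    then show "bits_exchanged (P r) x y \<le> rand_cc m \<epsilon> g" using Q(2) by simp
  qed
qed

text \<open>The inputs on which a protocol outputs 1 form at most \<open>2\<^sup>c\<close> disjoint rectangles.\<close>
lemma protocol_rectangles: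
  fixes P :: "('a, 'b) protocol"
  assumes "\<And>x y. x \<in> X \<Longrightarrow> y \<in> Y \<Longrightarrow> bits_exchanged P x y \<le> c"
  shows "\<exists>\<alpha> \<beta>. \<forall>x\<in>X. \<forall>y\<in>Y. (of_bool (protocol_output P x y) :: real) = (\<Sum>t<(2::nat)^c. \<alpha> t x * \<beta> t y)"
  using assms
proof (induction P arbitrary: X Y c)
  case (Output b)
  \<comment> \<open>The bound c may exceed the bits actually sent, so the single rectangle sits at
    index 0 and the remaining terms are 0.\<close>
  have "(\<Sum>t<(2::nat)^c. of_bool (b \<and> t = (0::nat)) * 1) = (of_bool b :: real)"
    by (cases b) (simp_all add: of_bool_def sum.delta)
  then show ?case by (intro exI[of _ "\<lambda>t _. of_bool (b \<and> t = (0::nat))"] exI[of _ "\<lambda>_ _. 1"]) simp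
next
  case (Alice p P0 P1)
  show ?case
  proof (cases "X = {} \<or> Y = {}")
    case False
    \<comment> \<open>On a nonempty rectangle the bit sent at the root forces c > 0. On an empty one
      c may be 0, but there nothing has to be shown.\<close>
    then obtain x y where "x \<in> X" "y \<in> Y" by blast
    then have "0 < c" using Alice.prems[of x y] by simp
    then obtain c' where c: "c = Suc c'" by (cases c) auto
    have "\<exists>\<alpha> \<beta>. \<forall>x\<in>X \<inter> {x. \<not> p x}. \<forall>y\<in>Y. (of_bool (protocol_output P0 x y) :: real) = (\<Sum>t<(2::nat)^c'. \<alpha> t x * \<beta> t y)"
      using Alice.prems c by (intro Alice.IH(1)) fastforce
    then obtain \<alpha>0 \<beta>0 where 0: "\<And>x y. x \<in> X \<Longrightarrow> \<not> p x \<Longrightarrow> y \<in> Y \<Longrightarrow>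
      (of_bool (protocol_output P0 x y) :: real) = (\<Sum>t<(2::nat)^c'. \<alpha>0 t x * \<beta>0 t y)" by auto
    have "\<exists>\<alpha> \<beta>. \<forall>x\<in>X \<inter> {x. p x}. \<forall>y\<in>Y. (of_bool (protocol_output P1 x y) :: real) = (\<Sum>t<(2::nat)^c'. \<alpha> t x * \<beta> t y)"
      using Alice.prems c by (intro Alice.IH(2)) fastforce
    then obtain \<alpha>1 \<beta>1 where 1: "\<And>x y. x \<in> X \<Longrightarrow> p x \<Longrightarrow> y \<in> Y \<Longrightarrow>
      (of_bool (protocol_output P1 x y) :: real) = (\<Sum>t<(2::nat)^c'. \<alpha>1 t x * \<beta>1 t y)" by auto
    \<comment> \<open>The first half of the indices carries the rectangles of \<open>P0\<close>, the
      second half those of \<open>P1\<close>. The indicator of the bit goes into the factor of the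
      player who sends it.\<close>
    define \<alpha> where "\<alpha> t x = (if t < 2^c' then of_bool (\<not> p x) * \<alpha>0 t x else of_bool (p x) * \<alpha>1 (t - 2^c') x)" for t x
    define \<beta> where "\<beta> t y = (if t < 2^c' then \<beta>0 t y else \<beta>1 (t - 2^c') y)" for t y
    have "(of_bool (protocol_output (Alice p P0 P1) x y) :: real) = (\<Sum>t<(2::nat)^c. \<alpha> t x * \<beta> t y)" if "x \<in> X" "y \<in> Y" for x y
    proof -
      have "(\<Sum>t<(2::nat)^c. \<alpha> t x * \<beta> t y) = (\<Sum>t<(2::nat)^c'. \<alpha> t x * \<beta> t y) + (\<Sum>t<(2::nat)^c'. \<alpha> (2^c' + t) x * \<beta> (2^c' + t) y)"
        unfolding c by (simp add: mult_2 sum_lessThan_add)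
      then show ?thesis using that 0 1 by (simp add: \<alpha>_def \<beta>_def)
    qed
    then show ?thesis by blast
  qed auto
next
  case (Bob q P0 P1)
  show ?case
  proof (cases "X = {} \<or> Y = {}")
    case False
    then obtain x y where "x \<in> X" "y \<in> Y" by blast
    then have "0 < c" using Bob.prems[of x y] by simp
    then obtain c' where c: "c = Suc c'" by (cases c) auto
    have "\<exists>\<alpha> \<beta>. \<forall>x\<in>X. \<forall>y\<in>Y \<inter> {y. \<not> q y}. (of_bool (protocol_output P0 x y) :: real) = (\<Sum>t<(2::nat)^c'. \<alpha> t x * \<beta> t y)"
      using Bob.prems c by (intro Bob.IH(1)) fastforce
    then obtain \<alpha>0 \<beta>0 where 0: "\<And>x y. x \<in> X \<Longrightarrow> y \<in> Y \<Longrightarrow> \<not> q y \<Longrightarrow>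
      (of_bool (protocol_output P0 x y) :: real) = (\<Sum>t<(2::nat)^c'. \<alpha>0 t x * \<beta>0 t y)" by auto
    have "\<exists>\<alpha> \<beta>. \<forall>x\<in>X. \<forall>y\<in>Y \<inter> {y. q y}. (of_bool (protocol_output P1 x y) :: real) = (\<Sum>t<(2::nat)^c'. \<alpha> t x * \<beta> t y)"
      using Bob.prems c by (intro Bob.IH(2)) fastforce
    then obtain \<alpha>1 \<beta>1 where 1: "\<And>x y. x \<in> X \<Longrightarrow> y \<in> Y \<Longrightarrow> q y \<Longrightarrow>
      (of_bool (protocol_output P1 x y) :: real) = (\<Sum>t<(2::nat)^c'. \<alpha>1 t x * \<beta>1 t y)" by auto
    define \<alpha> where "\<alpha> t x = (if t < 2^c' then \<alpha>0 t x else \<alpha>1 (t - 2^c') x)" for t x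
    define \<beta> where "\<beta> t y = (if t < 2^c' then of_bool (\<not> q y) * \<beta>0 t y else of_bool (q y) * \<beta>1 (t - 2^c') y)" for t y
    have "(of_bool (protocol_output (Bob q P0 P1) x y) :: real) = (\<Sum>t<(2::nat)^c. \<alpha> t x * \<beta> t y)" if "x \<in> X" "y \<in> Y" for x y
    proof -
      have "(\<Sum>t<(2::nat)^c. \<alpha> t x * \<beta> t y) = (\<Sum>t<(2::nat)^c'. \<alpha> t x * \<beta> t y) + (\<Sum>t<(2::nat)^c'. \<alpha> (2^c' + t) x * \<beta> (2^c' + t) y)"
        unfolding c by (simp add: mult_2 sum_lessThan_add)
      then show ?thesis using that 0 1 by (simp add: \<alpha>_def \<beta>_def)
    qed
    then show ?thesis by blast
  qed auto
qed

lemma index_of_bits: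
  assumes "i < 2 ^ m"
  shows "map (bit i) [0..<m] \<in> bitstrings m" "index_of (map (bit i) [0..<m]) = i"
  using assms by (simp_all add: bitstrings_def index_of_def horner_sum_bit_eq_take_bit take_bit_nat_eq_self)

text \<open>On an entry in the mask the protocol errs, and then pays the square of the entry of \<open>A\<close>, with
  probability at most \<open>\<epsilon>\<close>; off the mask it wrongly keeps the entry of \<open>L\<close> with probability at
  most \<open>\<epsilon>\<close>. Some outcome of the random string does at least as well as the average.\<close>
lemma protocol_approximation:
  fixes A L W :: "nat \<Rightarrow> nat \<Rightarrow> real"
  assumes eps: "\<epsilon> > 0" and W: "\<And>i j. i < n \<Longrightarrow> j < n \<Longrightarrow> W i j = of_bool (w i j)"
    and n: "n = 2 ^ m" and L: "\<And>i j. i < n \<Longrightarrow> j < n \<Longrightarrow> L i j = (\<Sum>l<k. u l i * v l j)"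
    and g: "\<And>x y. x \<in> bitstrings m \<Longrightarrow> y \<in> bitstrings m \<Longrightarrow> g x y = w (index_of x) (index_of y)"
  shows "\<exists>u' v' :: nat \<Rightarrow> nat \<Rightarrow> real. (\<Sum>i<n. \<Sum>j<n. (W i j * A i j - (\<Sum>l<k * 2 ^ rand_cc m \<epsilon> g. u' l i * v' l j))\<^sup>2)
    \<le> (\<Sum>i<n. \<Sum>j<n. (W i j * (A i j - L i j))\<^sup>2) + \<epsilon> * (\<Sum>i<n. \<Sum>j<n. (A i j * W i j)\<^sup>2)
      + \<epsilon> * (\<Sum>i<n. \<Sum>j<n. (L i j * (1 - W i j))\<^sup>2)"
proof -
  let ?c = "rand_cc m \<epsilon> g"
  obtain D P where err: "error_protocol m \<epsilon> \<epsilon> g (D, P)"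
    and cost: "\<And>r x y. r \<in> set_pmf D \<Longrightarrow> x \<in> bitstrings m \<Longrightarrow> y \<in> bitstrings m \<Longrightarrow> bits_exchanged (P r) x y \<le> ?c"
    by (rule rand_cc_attained[of \<epsilon> m g]) (use eps in auto)
  define b where "b = (\<lambda>i::nat. map (bit i) [0..<m] :: bool list)"
  have b: "b i \<in> bitstrings m" "index_of (b i) = i" if "i < n" for i
    using index_of_bits[of i m] that by (simp_all add: b_def n)
  define z where "z = (\<lambda>r i j. protocol_output (P r) (b i) (b j))"
  define X where "X = (\<lambda>r i j. (W i j * A i j - of_bool (z r i j) * L i j)\<^sup>2)"
  define Y where "Y = (\<lambda>i j. (W i j * (A i j - L i j))\<^sup>2 + \<epsilon> * (A i j * W i j)\<^sup>2 + \<epsilon> * (L i j * (1 - W i j))\<^sup>2)"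
  have Xint: "integrable (measure_pmf D) (\<lambda>r. X r i j)" for i j
  proof (rule measure_pmf.integrable_const_bound[where B="(W i j * A i j)\<^sup>2 + (W i j * A i j - L i j)\<^sup>2"])
    show "AE r in measure_pmf D. norm (X r i j) \<le> (W i j * A i j)\<^sup>2 + (W i j * A i j - L i j)\<^sup>2"
      by (rule AE_I2) (auto simp: X_def)
  qed simp
  have entry: "measure_pmf.expectation D (\<lambda>r. X r i j) \<le> Y i j" if i: "i < n" and j: "j < n" for i j
  proof -
    have gw: "g (b i) (b j) = w i j" using g b i j by simp
    let ?p = "measure_pmf.prob D {r. z r i j = w i j}"
    have p: "?p \<ge> 1 - \<epsilon>"
      using err b i j gw by (cases "w i j") (auto simp: z_def)
    define S where "S = {r. z r i j = w i j}"
    have compl: "measure_pmf.prob D (- S) = 1 - ?p"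
      using measure_pmf.prob_compl[of S D] by (simp add: Compl_eq_Diff_UNIV S_def)
    have ind: "integrable (measure_pmf D) (indicat_real T)" for T
      by (rule integrable_real_indicator) (auto simp: measure_pmf.emeasure_eq_measure)
    \<comment> \<open>The squared errors when the protocol is right and when it is wrong. On the
      mask these are (A - L)^2 and A^2, off the mask 0 and L^2.\<close>
    define yes no where "yes = (if w i j then (A i j - L i j)\<^sup>2 else 0)" and "no = (if w i j then (A i j)\<^sup>2 else (L i j)\<^sup>2)"
    have "X r i j = indicat_real S r * yes + indicat_real (- S) r * no" for r
      using W[OF i j] by (auto simp: X_def yes_def no_def indicator_def S_def)
    then have "measure_pmf.expectation D (\<lambda>r. X r i j)
      = measure_pmf.expectation D (\<lambda>r. indicat_real S r * yes + indicat_real (- S) r * no)"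
      by simp
    also have "\<dots> = measure_pmf.prob D S * yes + measure_pmf.prob D (- S) * no"
      by (subst Bochner_Integration.integral_add) (simp_all add: ind)
    also have "\<dots> = ?p * yes + (1 - ?p) * no" by (simp only: compl) (simp only: S_def)
    also have "\<dots> \<le> yes + \<epsilon> * no"
    proof (rule add_mono)
      show "?p * yes \<le> yes" by (rule mult_left_le_one_le) (auto simp: yes_def)
      show "(1 - ?p) * no \<le> \<epsilon> * no" by (rule mult_right_mono) (use p in \<open>auto simp: no_def\<close>)
    qed
    also have "\<dots> = Y i j" using W[OF i j] by (auto simp: Y_def yes_def no_def)
    finally show ?thesis .
  qed
  have "\<exists>r\<in>set_pmf D. (\<Sum>i<n. \<Sum>j<n. X r i j) \<le> (\<Sum>i<n. \<Sum>j<n. Y i j)"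
  proof (rule ccontr)
    assume "\<not> ?thesis"
    then have gt: "\<And>r. r \<in> set_pmf D \<Longrightarrow> (\<Sum>i<n. \<Sum>j<n. Y i j) < (\<Sum>i<n. \<Sum>j<n. X r i j)" by force
    have "(\<Sum>i<n. \<Sum>j<n. Y i j) < measure_pmf.expectation D (\<lambda>r. \<Sum>i<n. \<Sum>j<n. X r i j)"
      by (rule measure_pmf.expectation_greater)
        (use gt in \<open>auto simp: AE_measure_pmf_iff intro!: Bochner_Integration.integrable_sum Xint\<close>)
    also have "\<dots> = (\<Sum>i<n. \<Sum>j<n. measure_pmf.expectation D (\<lambda>r. X r i j))"
      by (simp add: Bochner_Integration.integral_sum Xint)
    also have "\<dots> \<le> (\<Sum>i<n. \<Sum>j<n. Y i j)" by (intro sum_mono entry) auto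
    finally show False by simp
  qed
  then obtain r where r: "r \<in> set_pmf D" "(\<Sum>i<n. \<Sum>j<n. X r i j) \<le> (\<Sum>i<n. \<Sum>j<n. Y i j)" by blast
  obtain \<alpha> \<beta> where rect: "\<And>x y. x \<in> bitstrings m \<Longrightarrow> y \<in> bitstrings m \<Longrightarrow>
      (of_bool (protocol_output (P r) x y) :: real) = (\<Sum>t<(2::nat)^?c. \<alpha> t x * \<beta> t y)"
    using protocol_rectangles[of "bitstrings m" "bitstrings m" "P r" ?c] cost[OF r(1)] by blast
  \<comment> \<open>Each of the \<open>2 ^ ?c\<close> rectangles cuts all k terms of
    \<open>L\<close>; index \<open>l\<close> stands for rectangle \<open>l div k\<close> and term
    \<open>l mod k\<close>.\<close>
  define u' where "u' = (\<lambda>l i. u (l mod k) i * \<alpha> (l div k) (b i))"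
  define v' where "v' = (\<lambda>l j. v (l mod k) j * \<beta> (l div k) (b j))"
  have "of_bool (z r i j) * L i j = (\<Sum>l<k * 2 ^ ?c. u' l i * v' l j)" if "i < n" "j < n" for i j
  proof -
    have "of_bool (z r i j) * L i j = (\<Sum>t<(2::nat)^?c. \<alpha> t (b i) * \<beta> t (b j)) * (\<Sum>l<k. u l i * v l j)"
      using rect[of "b i" "b j"] b that L by (simp add: z_def)
    also have "\<dots> = (\<Sum>t<(2::nat)^?c. \<Sum>l<k. (u l i * \<alpha> t (b i)) * (v l j * \<beta> t (b j)))"
      by (simp only: sum_product) (simp add: mult_ac)
    also have "\<dots> = (\<Sum>l<k * 2 ^ ?c. u' l i * v' l j)"
      unfolding u'_def v'_def by (rule sum_div_mod[symmetric])
    finally show ?thesis .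
  qed
  then have "(\<Sum>i<n. \<Sum>j<n. X r i j) = (\<Sum>i<n. \<Sum>j<n. (W i j * A i j - (\<Sum>l<k * 2 ^ ?c. u' l i * v' l j))\<^sup>2)"
    by (intro sum.cong refl) (auto simp: X_def)
  moreover have "(\<Sum>i<n. \<Sum>j<n. Y i j) = (\<Sum>i<n. \<Sum>j<n. (W i j * (A i j - L i j))\<^sup>2) + \<epsilon> * (\<Sum>i<n. \<Sum>j<n. (A i j * W i j)\<^sup>2)
      + \<epsilon> * (\<Sum>i<n. \<Sum>j<n. (L i j * (1 - W i j))\<^sup>2)"
    by (simp add: Y_def sum.distrib sum_distrib_left)
  ultimately show ?thesis using r(2) by (intro exI[of _ u'] exI[of _ v']) simp
qed

section \<open>Timed executions\<close>

text \<open>Quantifying over the rest \<open>K\<close> of the stack makes fragments composable. An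
  upper bound on the time suffices because a halted machine no longer changes.\<close>

definition runs :: "com \<Rightarrow> nat \<Rightarrow> ram_state \<Rightarrow> ram_state \<Rightarrow> bool" where
  "runs c t s s' \<longleftrightarrow> (\<forall>K. \<exists>t'\<le>t. ram_run t' (c # K, s) = return_pmf (K, s'))"

lemma ram_run_add: "ram_run (a + b) c = bind_pmf (ram_run a c) (ram_run b)"
proof (induction a arbitrary: c)
  case (Suc a)
  have "ram_run (a + b) = (\<lambda>c. bind_pmf (ram_run a c) (ram_run b))" by (rule ext) (rule Suc.IH)
  then show ?case by (simp add: bind_assoc_pmf)
qed (simp add: bind_return_pmf)

lemma ram_run_halted: "ram_run t ([], s) = return_pmf ([], s)"
  by (induction t) (simp_all add: bind_return_pmf)

lemma runs_mono: "runs c t s s' \<Longrightarrow> t \<le> t' \<Longrightarrow> runs c t' s s'"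
  unfolding runs_def by (meson order_trans)

lemma ex_runs_mono:
  "\<exists>s'. runs c t s s' \<and> P s' \<Longrightarrow> t \<le> t' \<Longrightarrow> (\<And>s'. P s' \<Longrightarrow> Q s') \<Longrightarrow> \<exists>s'. runs c t' s s' \<and> Q s'"
  using runs_mono by blast

lemma ram_run_1: "ram_run (Suc 0) c = ram_step c"
proof -
  have "ram_run 0 = return_pmf" by (rule ext) simp
  then show ?thesis by (simp add: bind_return_pmf')
qed

lemma runs_NAssign: "runs (NAssign a e1 e2 e) 1 s (write_nat a (nval e1 s) (nval e2 s) (nval e s) s)"
  unfolding runs_def by (intro allI exI[of _ "Suc 0"]) (simp only: ram_run_1 ram_step.simps, simp)

lemma runs_RAssign: "runs (RAssign a e1 e2 e) 1 s (write_real a (nval e1 s) (nval e2 s) (rval e s) s)"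
  unfolding runs_def by (intro allI exI[of _ "Suc 0"]) (simp only: ram_run_1 ram_step.simps, simp)

lemma runs_step:
  assumes "\<And>K. ram_step (c # K, s) = return_pmf (c' # K' @ K, s)"
    and "\<And>K. \<exists>t'\<le>t. ram_run t' (c' # K' @ K, s) = return_pmf (K, s')"
  shows "runs c (t + 1) s s'"
  unfolding runs_def
proof
  fix K
  obtain t' where "t' \<le> t" "ram_run t' (c' # K' @ K, s) = return_pmf (K, s')" using assms(2) by blast
  then have "ram_run (Suc t') (c # K, s) = return_pmf (K, s')" by (simp add: assms(1) bind_return_pmf)
  then show "\<exists>t'\<le>t + 1. ram_run t' (c # K, s) = return_pmf (K, s')"
    using \<open>t' \<le> t\<close> by (metis Suc_eq_plus1 Suc_le_mono)
qed

lemma runs_append: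
  assumes "runs c1 t1 s s1" "runs c2 t2 s1 s2"
  shows "\<exists>t'\<le>t1 + t2. ram_run t' (c1 # c2 # K, s) = return_pmf (K, s2)"
proof -
  obtain a where a: "a \<le> t1" "ram_run a (c1 # c2 # K, s) = return_pmf (c2 # K, s1)"
    using assms(1) unfolding runs_def by blast
  obtain b where b: "b \<le> t2" "ram_run b (c2 # K, s1) = return_pmf (K, s2)"
    using assms(2) unfolding runs_def by blast
  have "ram_run (a + b) (c1 # c2 # K, s) = return_pmf (K, s2)"
    by (simp add: ram_run_add a b bind_return_pmf)
  then show ?thesis using a b by (metis add_mono)
qed

lemma runs_Seq:
  assumes "runs c1 t1 s s1" "runs c2 t2 s1 s2" shows "runs (Seq c1 c2) (t1 + t2 + 1) s s2"
  by (rule runs_step[where K'="[c2]"]) (simp, use runs_append[OF assms] in simp)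

lemma runs_If:
  assumes "runs (if bval b s then c1 else c2) t s s'" shows "runs (If b c1 c2) (t + 1) s s'"
  by (rule runs_step[where K'="[]"]) (simp, use assms in \<open>simp add: runs_def\<close>)

lemma runs_While_False:
  assumes "\<not> bval b s" shows "runs (While b c) 1 s s"
  unfolding runs_def by (intro allI exI[of _ "Suc 0"]) (simp only: ram_run_1 ram_step.simps, simp add: assms)

lemma runs_While_True:
  assumes "bval b s" "runs c t1 s s1" "runs (While b c) t2 s1 s2"
  shows "runs (While b c) (t1 + t2 + 1) s s2"
  by (rule runs_step[where K'="[While b c]"]) (simp add: assms(1), use runs_append[OF assms(2,3)] in simp)

text \<open>Whole arrays are updated at once, so that loops over array entries have closed-form effects.\<close>
definition set_nats :: "string \<Rightarrow> (nat \<Rightarrow> nat \<Rightarrow> nat) \<Rightarrow> ram_state \<Rightarrow> ram_state" where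
  "set_nats a f s = s\<lparr>nats := (nats s)(a := f)\<rparr>"

definition set_reals :: "string \<Rightarrow> (nat \<Rightarrow> nat \<Rightarrow> real) \<Rightarrow> ram_state \<Rightarrow> ram_state" where
  "set_reals a f s = s\<lparr>reals := (reals s)(a := f)\<rparr>"

definition set_nat :: "string \<Rightarrow> nat \<Rightarrow> ram_state \<Rightarrow> ram_state" where
  "set_nat x v s = write_nat x 0 0 v s"

definition set_real :: "string \<Rightarrow> real \<Rightarrow> ram_state \<Rightarrow> ram_state" where
  "set_real x v s = write_real x 0 0 v s"

lemma nats_simps [simp]:
  "nats (set_nats a f s) = (nats s)(a := f)"
  "nats (set_reals a g s) = nats s"
  "nats (set_nat x v s) = (nats s)(x := (nats s x)(0 := (nats s x 0)(0 := v)))"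
  "nats (set_real x r s) = nats s"
  "nats (write_nat x i j v s) = (nats s)(x := (nats s x)(i := (nats s x i)(j := v)))"
  "nats (write_real x i j r s) = nats s"
  by (simp_all add: set_nats_def set_reals_def set_nat_def set_real_def write_nat_def write_real_def)

lemma reals_simps [simp]:
  "reals (set_nats a f s) = reals s"
  "reals (set_reals a g s) = (reals s)(a := g)"
  "reals (set_nat x v s) = reals s"
  "reals (set_real x r s) = (reals s)(x := (reals s x)(0 := (reals s x 0)(0 := r)))"
  "reals (write_nat x i j v s) = reals s"
  "reals (write_real x i j r s) = (reals s)(x := (reals s x)(i := (reals s x i)(j := r)))"
  by (simp_all add: set_nats_def set_reals_def set_nat_def set_real_def write_nat_def write_real_def)

lemma ram_state_eqI: "nats s = nats s' \<Longrightarrow> reals s = reals s' \<Longrightarrow> s = (s' :: ram_state)"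
  by simp

abbreviation Nv :: "string \<Rightarrow> nexp" where "Nv x \<equiv> NCell x (NConst 0) (NConst 0)"
abbreviation Rv :: "string \<Rightarrow> rexp" where "Rv x \<equiv> RCell x (NConst 0) (NConst 0)"
abbreviation set_n :: "string \<Rightarrow> nexp \<Rightarrow> com" where "set_n x e \<equiv> NAssign x (NConst 0) (NConst 0) e"
abbreviation set_r :: "string \<Rightarrow> rexp \<Rightarrow> com" where "set_r x e \<equiv> RAssign x (NConst 0) (NConst 0) e"

lemma runs_set_n: "runs (set_n x e) 1 s (set_nat x (nval e s) s)"
  using runs_NAssign[of x "NConst 0" "NConst 0" e s] by (simp add: set_nat_def)

lemma runs_set_r: "runs (set_r x e) 1 s (set_real x (rval e s) s)"
  using runs_RAssign[of x "NConst 0" "NConst 0" e s] by (simp add: set_real_def)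

text \<open>A frame condition: only the arrays named in \<open>X\<close>, natural or real, may have
  changed.\<close>

definition agree :: "string set \<Rightarrow> ram_state \<Rightarrow> ram_state \<Rightarrow> bool" where
  "agree X s s' \<longleftrightarrow> (\<forall>a. a \<notin> X \<longrightarrow> nats s' a = nats s a \<and> reals s' a = reals s a)"

lemma agree_refl: "agree X s s"
  by (simp add: agree_def)

lemma agree_trans: "agree X s s' \<Longrightarrow> agree Y s' s'' \<Longrightarrow> X \<union> Y \<subseteq> Z \<Longrightarrow> agree Z s s''"
  unfolding agree_def by (metis UnI1 UnI2 subsetD)

lemma agree_D: "agree X s s' \<Longrightarrow> a \<notin> X \<Longrightarrow> nats s' a = nats s a" "agree X s s' \<Longrightarrow> a \<notin> X \<Longrightarrow> reals s' a = reals s a"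
  by (simp_all add: agree_def)

lemma agree_updates [simp]:
  "a \<in> X \<Longrightarrow> agree X s (set_nats a f s') = agree X s s'"
  "a \<in> X \<Longrightarrow> agree X s (set_reals a g s') = agree X s s'"
  "a \<in> X \<Longrightarrow> agree X s (set_nat a v s') = agree X s s'"
  "a \<in> X \<Longrightarrow> agree X s (set_real a r s') = agree X s s'"
  "a \<in> X \<Longrightarrow> agree X s (write_nat a i j v s') = agree X s s'"
  "a \<in> X \<Longrightarrow> agree X s (write_real a i j r s') = agree X s s'"
  by (auto simp: agree_def)

section \<open>Bounded loops\<close>

definition For :: "string \<Rightarrow> nexp \<Rightarrow> com \<Rightarrow> com" where
  "For x e c = Seq (set_n x (NConst 0)) (While (NLess (Nv x) e) (Seq c (set_n x (NAdd (Nv x) (NConst 1)))))"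

text \<open>Each round adds three steps to the body: the test, the sequencing and the increment. The
  bound \<open>e\<close> is evaluated anew in every round, so the invariant must fix its value; it
  has to survive the increment as well.\<close>

lemma runs_For:
  assumes I0: "Inv 0 (set_nat x 0 s)"
    and bound: "\<And>i s. i \<le> N \<Longrightarrow> Inv i s \<Longrightarrow> nats s x 0 0 = i \<Longrightarrow> nval e s = N"
    and body: "\<And>i s. i < N \<Longrightarrow> Inv i s \<Longrightarrow> nats s x 0 0 = i \<Longrightarrow>
      \<exists>s'. runs c t s s' \<and> nats s' x 0 0 = i \<and> Inv (Suc i) (set_nat x (Suc i) s')"
  shows "\<exists>s'. runs (For x e c) (N * (t + 3) + 3) s s' \<and> Inv N s' \<and> nats s' x 0 0 = N"
proof -
  let ?W = "While (NLess (Nv x) e) (Seq c (set_n x (NAdd (Nv x) (NConst 1))))"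
  have loop: "\<exists>s'. runs ?W (k * (t + 3) + 1) s s' \<and> Inv N s' \<and> nats s' x 0 0 = N"
    if "k + i = N" "Inv i s" "nats s x 0 0 = i" for k i s
    using that
  proof (induction k arbitrary: i s)
    case 0
    then have "runs ?W 1 s s" using bound[of i s] by (intro runs_While_False) simp
    then show ?case using 0 by auto
  next
    case (Suc k)
    then have i: "i < N" by simp
    obtain s' where s': "runs c t s s'" "nats s' x 0 0 = i" "Inv (Suc i) (set_nat x (Suc i) s')"
      using body[OF i Suc.prems(2,3)] by blast
    have "runs (set_n x (NAdd (Nv x) (NConst 1))) 1 s' (set_nat x (Suc i) s')"
      using runs_set_n[of x "NAdd (Nv x) (NConst 1)" s'] s'(2) by simp
    from runs_Seq[OF s'(1) this]
    have body: "runs (Seq c (set_n x (NAdd (Nv x) (NConst 1)))) (t + 1 + 1) s (set_nat x (Suc i) s')" .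
    obtain s'' where s'': "runs ?W (k * (t + 3) + 1) (set_nat x (Suc i) s') s''" "Inv N s''" "nats s'' x 0 0 = N"
      using Suc.IH[of "Suc i" "set_nat x (Suc i) s'"] Suc.prems s' by auto
    have b: "bval (NLess (Nv x) e) s" using bound[of i s] Suc.prems i by simp
    have "runs ?W (t + 1 + 1 + (k * (t + 3) + 1) + 1) s s''"
      by (rule runs_While_True[OF b body s''(1)])
    then have "runs ?W (Suc k * (t + 3) + 1) s s''" by (rule runs_mono) simp
    then show ?case using s'' by blast
  qed
  obtain s' where s': "runs ?W (N * (t + 3) + 1) (set_nat x 0 s) s'" "Inv N s'" "nats s' x 0 0 = N"
    using loop[of N 0 "set_nat x 0 s"] I0 by auto
  have "runs (For x e c) (1 + (N * (t + 3) + 1) + 1) s s'"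
    unfolding For_def using runs_set_n[of x "NConst 0" s] s'(1) by (intro runs_Seq[where ?s1.0="set_nat x 0 s"]) simp_all
  then have "runs (For x e c) (N * (t + 3) + 3) s s'" by (rule runs_mono) simp
  then show ?thesis using s' by blast
qed

definition sum_into :: "string \<Rightarrow> string \<Rightarrow> nexp \<Rightarrow> rexp \<Rightarrow> com" where
  "sum_into acc x e ex = Seq (set_r acc (ROfNat (NConst 0))) (For x e (set_r acc (RAdd (Rv acc) ex)))"

lemma runs_sum_into:
  assumes e: "\<And>i v. nval e (set_nat x i (set_real acc v s)) = N"
    and ex: "\<And>i v. i < N \<Longrightarrow> rval ex (set_nat x i (set_real acc v s)) = f i"
  shows "runs (sum_into acc x e ex) (4 * N + 5) s (set_nat x N (set_real acc (\<Sum>i<N. f i) s))"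
proof -
  let ?S = "\<lambda>i. set_nat x i (set_real acc (\<Sum>i<i. f i) s)"
  have "\<exists>s'. runs (For x e (set_r acc (RAdd (Rv acc) ex))) (N * (1 + 3) + 3) (set_real acc 0 s) s'
      \<and> s' = ?S N \<and> nats s' x 0 0 = N"
  proof (rule runs_For)
    show "set_nat x 0 (set_real acc 0 s) = ?S 0" by simp
    fix i s1 assume s1: "i < N" "s1 = ?S i" "nats s1 x 0 0 = i"
    have v: "rval (RAdd (Rv acc) ex) s1 = (\<Sum>i<Suc i. f i)"
      using s1 ex[of i "\<Sum>i<i. f i"] by simp
    show "\<exists>s'. runs (set_r acc (RAdd (Rv acc) ex)) 1 s1 s' \<and> nats s' x 0 0 = i \<and> set_nat x (Suc i) s' = ?S (Suc i)"
      by (rule exI[of _ "set_real acc (\<Sum>i<Suc i. f i) s1"])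
        (use runs_set_r[of acc "RAdd (Rv acc) ex" s1] v s1 in \<open>auto intro!: ram_state_eqI\<close>)
  qed (use e in auto)
  then have *: "runs (For x e (set_r acc (RAdd (Rv acc) ex))) (4 * N + 3) (set_real acc 0 s) (?S N)"
    by (auto simp: algebra_simps)
  have "runs (sum_into acc x e ex) (1 + (4 * N + 3) + 1) s (?S N)"
    unfolding sum_into_def using runs_set_r[of acc "ROfNat (NConst 0)" s] *
    by (intro runs_Seq[where ?s1.0="set_real acc 0 s"]) simp_all
  then show ?thesis by (rule runs_mono) simp
qed

text \<open>The expression is evaluated while columns below \<open>c\<close> of row \<open>R\<close>
  are already overwritten, so it may read the very entry that it replaces, as the updates of
  \<open>F\<close> do.\<close>

lemma runs_map_row:
  assumes e: "\<And>i f. nval e (set_nat x i (set_reals a f s)) = N"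
    and row: "\<And>i f. nval er (set_nat x i (set_reals a f s)) = R"
    and ex: "\<And>c. c < N \<Longrightarrow> rval ex (set_nat x c (set_reals a ((reals s a)(R := \<lambda>c'. if c' < c then f c' else reals s a R c')) s)) = f c"
  shows "runs (For x e (RAssign a er (Nv x) ex)) (4 * N + 3) s
    (set_nat x N (set_reals a ((reals s a)(R := \<lambda>c. if c < N then f c else reals s a R c)) s))"
proof -
  let ?S = "\<lambda>i. set_nat x i (set_reals a ((reals s a)(R := \<lambda>c. if c < i then f c else reals s a R c)) s)"
  have "\<exists>s'. runs (For x e (RAssign a er (Nv x) ex)) (N * (1 + 3) + 3) s s' \<and> s' = ?S N \<and> nats s' x 0 0 = N"
  proof (rule runs_For)
    show "set_nat x 0 s = ?S 0" by (auto intro!: ram_state_eqI)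
    fix i s1 assume s1: "i < N" "s1 = ?S i" "nats s1 x 0 0 = i"
    have "runs (RAssign a er (Nv x) ex) 1 s1 (write_real a R i (f i) s1)"
      using runs_RAssign[of a er "Nv x" ex s1] ex[of i] row[of i] s1 by simp
    moreover have "set_nat x (Suc i) (write_real a R i (f i) s1) = ?S (Suc i)"
      using s1(2) by (auto intro!: ram_state_eqI ext simp: less_Suc_eq)
    ultimately show "\<exists>s'. runs (RAssign a er (Nv x) ex) 1 s1 s' \<and> nats s' x 0 0 = i \<and> set_nat x (Suc i) s' = ?S (Suc i)"
      using s1(3) by (intro exI[of _ "write_real a R i (f i) s1"]) simp
  qed (use e in auto)
  then show ?thesis by (auto simp: algebra_simps)
qed

section \<open>Program fragments\<close>

text \<open>The program stores a sketch as \<open>2 * S\<close> unsigned buckets and subtracts them on access.\<close>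
definition signed :: "nat \<Rightarrow> (nat \<Rightarrow> nat \<Rightarrow> real) \<Rightarrow> nat \<Rightarrow> nat \<Rightarrow> real" where
  "signed S f a c = f a c - f (S + a) c"

abbreviation M_exp :: "string \<Rightarrow> rexp" where
  "M_exp x \<equiv> RSub (RCell ''M'' (Nv x) (Nv ''c'')) (RCell ''M'' (NAdd (Nv ''s'') (Nv x)) (Nv ''c''))"

abbreviation F_exp :: "string \<Rightarrow> rexp" where
  "F_exp x \<equiv> RCell ''F'' (Nv x) (Nv ''c'')"

definition gs_copy :: com where
  "gs_copy = For ''c'' (Nv ''n'') (RAssign ''F'' (Nv ''i'') (Nv ''c'') (M_exp ''i''))"

definition gs_project :: com where
  "gs_project = For ''j'' (Nv ''i'')
     (Seq (sum_into ''q'' ''c'' (Nv ''n'') (RMul (M_exp ''i'') (F_exp ''j'')))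
       (For ''c'' (Nv ''n'') (RAssign ''F'' (Nv ''i'') (Nv ''c'') (RSub (F_exp ''i'') (RMul (Rv ''q'') (F_exp ''j''))))))"

definition gs_normalize :: com where
  "gs_normalize = Seq (sum_into ''q'' ''c'' (Nv ''n'') (RMul (F_exp ''i'') (F_exp ''i'')))
     (For ''c'' (Nv ''n'') (RAssign ''F'' (Nv ''i'') (Nv ''c'') (RDiv (F_exp ''i'') (RSqrt (Rv ''q'')))))"

definition gs_com :: com where
  "gs_com = For ''i'' (Nv ''s'') (Seq gs_copy (Seq gs_project gs_normalize))"

lemma runs_gs_project:
  fixes s :: ram_state
  assumes n: "nats s ''n'' 0 0 = n" and S: "nats s ''s'' 0 0 = S" and i: "nats s ''i'' 0 0 = i"
  defines "v \<equiv> signed S (reals s ''M'') i" and "F \<equiv> reals s ''F''"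
  assumes Fi: "\<And>c. c < n \<Longrightarrow> F i c = v c"
  shows "\<exists>s'. runs gs_project (i * (8 * n + 12) + 3) s s' \<and> agree {''j'', ''c'', ''q'', ''F''} s s' \<and>
    reals s' ''F'' = F(i := \<lambda>c. if c < n then gs_residual n i F v c else F i c)"
proof -
  let ?body = "Seq (sum_into ''q'' ''c'' (Nv ''n'') (RMul (M_exp ''i'') (F_exp ''j'')))
       (For ''c'' (Nv ''n'') (RAssign ''F'' (Nv ''i'') (Nv ''c'') (RSub (F_exp ''i'') (RMul (Rv ''q'') (F_exp ''j'')))))"
  \<comment> \<open>After \<open>j\<close> rounds row \<open>i\<close> is \<open>v\<close> minus its
    first \<open>j\<close> components. The coefficients come from \<open>v\<close>, so they do not
    depend on the rounds already done.\<close>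
  define G where "G = (\<lambda>j. F(i := \<lambda>c. if c < n then v c - (\<Sum>j<j. dot n v (F j) * F j c) else F i c))"
  define Inv where "Inv = (\<lambda>j s'. agree {''j'', ''c'', ''q'', ''F''} s s' \<and> reals s' ''F'' = G j)"
  have "\<exists>s'. runs gs_project (i * (8 * n + 9 + 3) + 3) s s' \<and> Inv i s' \<and> nats s' ''j'' 0 0 = i"
    unfolding gs_project_def
  proof (rule runs_For)
    show "Inv 0 (set_nat ''j'' 0 s)" using Fi by (auto simp: Inv_def G_def F_def agree_refl fun_eq_iff)
  next
    fix j s1 assume "Inv j s1"
    then show "nval (Nv ''i'') s1 = i" using i by (auto simp: Inv_def agree_D)
  next
    fix j s1 assume j: "j < i" and inv: "Inv j s1" and j1: "nats s1 ''j'' 0 0 = j"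
    have ag: "agree {''j'', ''c'', ''q'', ''F''} s s1" and F1: "reals s1 ''F'' = G j" using inv by (auto simp: Inv_def)
    have [simp]: "nats s1 ''n'' 0 0 = n" "nats s1 ''i'' 0 0 = i" "nats s1 ''s'' 0 0 = S" "reals s1 ''M'' = reals s ''M''"
      using ag n i S by (simp_all add: agree_D)
    define s2 where "s2 = set_nat ''c'' n (set_real ''q'' (\<Sum>c<n. v c * F j c) s1)"
    have Gj: "G j j = F j" using j by (simp add: G_def)
    have r1: "runs (sum_into ''q'' ''c'' (Nv ''n'') (RMul (M_exp ''i'') (F_exp ''j''))) (4 * n + 5) s1 s2"
      unfolding s2_def by (rule runs_sum_into) (simp_all add: j1 F1 Gj v_def signed_def)
    let ?f = "\<lambda>c. G j i c - (\<Sum>c<n. v c * F j c) * F j c"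
    define s3 where "s3 = set_nat ''c'' n (set_reals ''F'' ((reals s2 ''F'')(i := \<lambda>c. if c < n then ?f c else reals s2 ''F'' i c)) s2)"
    have r2: "runs (For ''c'' (Nv ''n'') (RAssign ''F'' (Nv ''i'') (Nv ''c'') (RSub (F_exp ''i'') (RMul (Rv ''q'') (F_exp ''j''))))) (4 * n + 3) s2 s3"
      unfolding s3_def by (rule runs_map_row) (use j Gj in \<open>simp_all add: s2_def j1 F1\<close>)
    have "reals s3 ''F'' = G (Suc j)"
      unfolding s3_def using j by (auto simp: s2_def F1 G_def dot_def intro!: ext)
    then have "Inv (Suc j) (set_nat ''j'' (Suc j) s3)"
      using ag by (simp add: Inv_def s3_def s2_def)
    moreover have "nats s3 ''j'' 0 0 = j" by (simp add: s3_def s2_def j1)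
    moreover have "runs ?body (8 * n + 9) s1 s3"
      using runs_Seq[OF r1 r2] by (rule runs_mono) simp
    ultimately show "\<exists>s'. runs ?body (8 * n + 9) s1 s'
       \<and> nats s' ''j'' 0 0 = j \<and> Inv (Suc j) (set_nat ''j'' (Suc j) s')" by blast
  qed
  then show ?thesis by (rule ex_runs_mono) (auto simp: Inv_def G_def gs_residual_def fun_eq_iff)
qed

lemma runs_gs:
  assumes n: "nats s ''n'' 0 0 = n" and S: "nats s ''s'' 0 0 = S"
  shows "\<exists>s'. runs gs_com (S * (S * (8 * n + 12) + 12 * n + 20) + 3) s s' \<and> agree {''i'', ''j'', ''c'', ''q'', ''F''} s s' \<and>
    gs_inv n S (signed S (reals s ''M'')) (reals s' ''F'')"
proof -
  let ?body = "Seq gs_copy (Seq gs_project gs_normalize)"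
  let ?X = "{''i'', ''j'', ''c'', ''q'', ''F''}"
  define M where "M = signed S (reals s ''M'')"
  define Inv where "Inv = (\<lambda>i s'. agree ?X s s' \<and> gs_inv n i M (reals s' ''F''))"
  have "\<exists>s'. runs gs_com (S * ((S * (8 * n + 12) + 12 * n + 17) + 3) + 3) s s' \<and> Inv S s' \<and> nats s' ''i'' 0 0 = S"
    unfolding gs_com_def
  proof (rule runs_For)
    show "Inv 0 (set_nat ''i'' 0 s)" by (simp add: Inv_def gs_inv_def agree_refl)
  next
    fix i s1 assume "Inv i s1"
    then show "nval (Nv ''s'') s1 = S" using S by (auto simp: Inv_def agree_D)
  next
    fix i s1 assume i: "i < S" and inv: "Inv i s1" and i1: "nats s1 ''i'' 0 0 = i"
    have ag: "agree ?X s s1" and gs: "gs_inv n i M (reals s1 ''F'')" using inv by (auto simp: Inv_def)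
    have [simp]: "nats s1 ''n'' 0 0 = n" "nats s1 ''s'' 0 0 = S" "reals s1 ''M'' = reals s ''M''"
      using ag n S by (simp_all add: agree_D)
    define F where "F = reals s1 ''F''"
    define s2 where "s2 = set_nat ''c'' n (set_reals ''F'' (F(i := \<lambda>c. if c < n then M i c else F i c)) s1)"
    have r1: "runs gs_copy (4 * n + 3) s1 s2"
      unfolding s2_def gs_copy_def F_def by (rule runs_map_row) (simp_all add: i1 M_def signed_def)
    have [simp]: "nats s2 ''n'' 0 0 = n" "nats s2 ''s'' 0 0 = S" "nats s2 ''i'' 0 0 = i" "reals s2 ''M'' = reals s ''M''"
      by (simp_all add: s2_def i1)
    have F2: "reals s2 ''F'' = F(i := \<lambda>c. if c < n then M i c else F i c)" by (simp add: s2_def)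
    have M2: "signed S (reals s2 ''M'') = M" by (simp add: M_def)
    obtain s3 where r2: "runs gs_project (i * (8 * n + 12) + 3) s2 s3" and ag3: "agree {''j'', ''c'', ''q'', ''F''} s2 s3"
      and F3: "reals s3 ''F'' = (reals s2 ''F'')(i := \<lambda>c. if c < n then gs_residual n i (reals s2 ''F'') (M i) c else reals s2 ''F'' i c)"
      using runs_gs_project[of s2 n S i] F2 unfolding M2 by auto
    have res: "gs_residual n i (reals s2 ''F'') (M i) = gs_residual n i F (M i)"
      unfolding gs_residual_def F2 by (rule ext) simp
    define r where "r = gs_residual n i F (M i)"
    have F3': "reals s3 ''F'' = F(i := \<lambda>c. if c < n then r c else F i c)"
      unfolding F3 res unfolding F2 r_def by (auto simp: fun_eq_iff)
    have [simp]: "nats s3 ''n'' 0 0 = n" "nats s3 ''i'' 0 0 = i" using ag3 by (simp_all add: agree_D)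
    define s4 where "s4 = set_nat ''c'' n (set_real ''q'' (\<Sum>c<n. r c * r c) s3)"
    have r3: "runs (sum_into ''q'' ''c'' (Nv ''n'') (RMul (F_exp ''i'') (F_exp ''i''))) (4 * n + 5) s3 s4"
      unfolding s4_def by (rule runs_sum_into) (simp_all add: F3')
    let ?f = "\<lambda>c. r c / sqrt (\<Sum>c<n. r c * r c)"
    define s5 where "s5 = set_nat ''c'' n (set_reals ''F'' ((reals s4 ''F'')(i := \<lambda>c. if c < n then ?f c else reals s4 ''F'' i c)) s4)"
    have r4: "runs (For ''c'' (Nv ''n'') (RAssign ''F'' (Nv ''i'') (Nv ''c'') (RDiv (F_exp ''i'') (RSqrt (Rv ''q''))))) (4 * n + 3) s4 s5"
      unfolding s5_def by (rule runs_map_row) (simp_all add: s4_def F3')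
    have F5: "reals s5 ''F'' = F(i := \<lambda>c. if c < n then ?f c else F i c)"
      by (auto simp: s5_def s4_def F3' intro!: ext)
    have "gs_inv n (Suc i) M (F(i := \<lambda>c. r c / sqrt (dot n r r)))"
      using gs_inv_step[OF gs] by (simp add: F_def r_def)
    then have "gs_inv n (Suc i) M (reals s5 ''F'')"
      by (rule gs_inv_cong) (auto simp: F5 dot_def)
    moreover have "agree ?X s s3"
    proof -
      have "agree ?X s s2" using ag by (simp add: s2_def)
      from agree_trans[OF this ag3, of ?X] show ?thesis by simp
    qed
    then have "agree ?X s s5" by (simp add: s5_def s4_def)
    ultimately have "Inv (Suc i) (set_nat ''i'' (Suc i) s5)" by (simp add: Inv_def)
    moreover have "nats s5 ''i'' 0 0 = i" by (simp add: s5_def s4_def)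
    moreover have "runs ?body (4 * n + 3 + ((i * (8 * n + 12) + 3) + ((4 * n + 5) + (4 * n + 3) + 1) + 1) + 1) s1 s5"
      unfolding gs_normalize_def by (intro runs_Seq[OF r1] runs_Seq[OF r2] runs_Seq[OF r3] r4)
    then have "runs ?body (S * (8 * n + 12) + 12 * n + 17) s1 s5"
    proof (rule runs_mono)
      have "i * (8 * n + 12) \<le> S * (8 * n + 12)" using i by (intro mult_right_mono) auto
      then show "4 * n + 3 + ((i * (8 * n + 12) + 3) + ((4 * n + 5) + (4 * n + 3) + 1) + 1) + 1 \<le> S * (8 * n + 12) + 12 * n + 17"
        by linarith
    qed
    ultimately show "\<exists>s'. runs ?body (S * (8 * n + 12) + 12 * n + 17) s1 s'
       \<and> nats s' ''i'' 0 0 = i \<and> Inv (Suc i) (set_nat ''i'' (Suc i) s')" by blast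
  qed
  then show ?thesis by (rule ex_runs_mono) (auto simp: Inv_def M_def)
qed

section \<open>Jacobi sweeps on the machine\<close>

definition jacobi_step :: "nat \<Rightarrow> nat \<Rightarrow> (nat \<Rightarrow> nat \<Rightarrow> real) \<Rightarrow> real \<Rightarrow> nat \<Rightarrow> nat \<Rightarrow> (nat \<Rightarrow> nat \<Rightarrow> real) \<Rightarrow> nat \<Rightarrow> nat \<Rightarrow> real" where
  "jacobi_step n s M \<theta> i j f =
    (let b = quad n s M (f i) (f j); e = gain (quad n s M (f i) (f i)) b (quad n s M (f j) (f j))
     in if \<theta> < e then rot n i j b e f else f)"

definition jacobi_frame :: "nat \<Rightarrow> nat \<Rightarrow> (nat \<Rightarrow> nat \<Rightarrow> real) \<Rightarrow> (nat \<Rightarrow> nat \<Rightarrow> real) \<Rightarrow> bool" where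
  "jacobi_frame n s M f \<longleftrightarrow> contractive n s f \<and> (\<forall>a<s. reproduces n s f (M a))"

text \<open>Either all \<open>t\<close> sweeps have made progress, or the frame is settled and later
  sweeps leave it alone. As the potential is bounded, a large \<open>t\<close> forces the second
  case; no stopping test is required.\<close>

definition sweep_start :: "nat \<Rightarrow> nat \<Rightarrow> (nat \<Rightarrow> nat \<Rightarrow> real) \<Rightarrow> real \<Rightarrow> nat \<Rightarrow> (nat \<Rightarrow> nat \<Rightarrow> real) \<Rightarrow> bool" where
  "sweep_start n s M \<theta> t f \<longleftrightarrow> jacobi_frame n s M f \<and>
     (jacobi_potential n s M f \<ge> real t * \<theta> \<or> jacobi_settled n s M \<theta> f)"

text \<open>During sweep \<open>t\<close>, just before the pair \<open>(i, j)\<close>: either the sweep has already rotated, or it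
  has changed nothing and found all earlier pairs settled.\<close>
definition sweep_inv :: "nat \<Rightarrow> nat \<Rightarrow> (nat \<Rightarrow> nat \<Rightarrow> real) \<Rightarrow> real \<Rightarrow> nat \<Rightarrow> nat \<Rightarrow> nat \<Rightarrow> (nat \<Rightarrow> nat \<Rightarrow> real) \<Rightarrow> bool" where
  "sweep_inv n s M \<theta> t i j f \<longleftrightarrow> jacobi_frame n s M f \<and>
     (jacobi_potential n s M f \<ge> real (Suc t) * \<theta> \<or>
      (\<forall>i' j'. i' < j' \<longrightarrow> j' < s \<longrightarrow> i' < i \<or> i' = i \<and> j' < j \<longrightarrow>
         gain (quad n s M (f i') (f i')) (quad n s M (f i') (f j')) (quad n s M (f j') (f j')) \<le> \<theta>) \<and>
      (jacobi_potential n s M f \<ge> real t * \<theta> \<or> jacobi_settled n s M \<theta> f))"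

lemma sweep_inv_start: "sweep_start n s M \<theta> t f \<Longrightarrow> sweep_inv n s M \<theta> t 0 0 f"
  by (auto simp: sweep_start_def sweep_inv_def)

lemma sweep_inv_row: "sweep_inv n s M \<theta> t i s f \<Longrightarrow> sweep_inv n s M \<theta> t (Suc i) 0 f"
  by (auto simp: sweep_inv_def less_Suc_eq)

lemma sweep_inv_end: "sweep_inv n s M \<theta> t s 0 f \<Longrightarrow> sweep_start n s M \<theta> (Suc t) f"
  by (auto simp: sweep_start_def sweep_inv_def jacobi_settled_def)

lemma sweep_inv_skip: "sweep_inv n s M \<theta> t i j f \<Longrightarrow> \<not> i < j \<Longrightarrow> sweep_inv n s M \<theta> t i (Suc j) f"
  unfolding sweep_inv_def by (metis less_Suc_eq)

lemma sweep_inv_step: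
  assumes inv: "sweep_inv n s M \<theta> t i j f" and ij: "i < j" "j < s" and \<theta>: "\<theta> \<ge> 0"
  shows "sweep_inv n s M \<theta> t i (Suc j) (jacobi_step n s M \<theta> i j f)"
proof -
  define b where "b = quad n s M (f i) (f j)"
  define e where "e = gain (quad n s M (f i) (f i)) b (quad n s M (f j) (f j))"
  show ?thesis
  proof (cases "\<theta> < e")
    case False
    then have "jacobi_step n s M \<theta> i j f = f" by (simp add: jacobi_step_def Let_def b_def e_def)
    moreover have "sweep_inv n s M \<theta> t i (Suc j) f"
      using inv False unfolding sweep_inv_def b_def e_def less_Suc_eq by (metis not_less)
    ultimately show ?thesis by simp
  next
    case True
    then have step: "jacobi_step n s M \<theta> i j f = rot n i j b e f"
      by (simp add: jacobi_step_def Let_def b_def e_def)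
    have e: "e > 0" and be: "b\<^sup>2 + e\<^sup>2 > 0" using True \<theta> by (auto simp: add_nonneg_pos)
    have frame: "jacobi_frame n s M (rot n i j b e f)"
      using inv ij be rot_contractive[of n s f i j b e] rot_reproduces[of n s f _ i j b e]
      by (auto simp: sweep_inv_def jacobi_frame_def)
    have pot: "jacobi_potential n s M (rot n i j b e f) \<ge> jacobi_potential n s M f + e"
      using rot_potential[OF ij, of n M f] e by (simp add: b_def e_def)
    \<comment> \<open>A rotation happens only on an unsettled frame, so the potential was at least t
      \<theta> already; now it gains e > \<theta>.\<close>
    have "\<not> jacobi_settled n s M \<theta> f"
      using True ij by (auto simp: jacobi_settled_def e_def b_def not_le)
    then have "jacobi_potential n s M f \<ge> real t * \<theta> \<or> jacobi_potential n s M f \<ge> real (Suc t) * \<theta>"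
      using inv by (auto simp: sweep_inv_def)
    then have "jacobi_potential n s M (rot n i j b e f) \<ge> real (Suc t) * \<theta>"
      using pot True e by (auto simp: algebra_simps)
    then show ?thesis unfolding step sweep_inv_def using frame by blast
  qed
qed

text \<open>The 2x2 block is recomputed from \<open>M\<close> for every pair, so no Gram matrix is
  stored or updated. The cells \<open>A\<close>, \<open>B\<close>, \<open>D\<close> hold the
  arguments of \<open>gain\<close>, and \<open>E\<close> will hold its value.\<close>

definition gram_com :: com where
  "gram_com = For ''a'' (Nv ''s'')
     (Seq (sum_into ''y'' ''c'' (Nv ''n'') (RMul (M_exp ''a'') (F_exp ''i'')))
     (Seq (sum_into ''z'' ''c'' (Nv ''n'') (RMul (M_exp ''a'') (F_exp ''j'')))
     (Seq (set_r ''A'' (RAdd (Rv ''A'') (RMul (Rv ''y'') (Rv ''y''))))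
     (Seq (set_r ''B'' (RAdd (Rv ''B'') (RMul (Rv ''y'') (Rv ''z''))))
          (set_r ''D'' (RAdd (Rv ''D'') (RMul (Rv ''z'') (Rv ''z''))))))))"

definition rot_com :: com where
  "rot_com = For ''c'' (Nv ''n'')
     (Seq (set_r ''y'' (F_exp ''i''))
     (Seq (set_r ''z'' (F_exp ''j''))
     (Seq (RAssign ''F'' (Nv ''i'') (Nv ''c'') (RDiv (RAdd (RMul (Rv ''B'') (Rv ''y'')) (RMul (Rv ''E'') (Rv ''z''))) (Rv ''q'')))
          (RAssign ''F'' (Nv ''j'') (Nv ''c'') (RDiv (RSub (RMul (Rv ''B'') (Rv ''z'')) (RMul (Rv ''E'') (Rv ''y''))) (Rv ''q''))))))"

abbreviation R0 :: rexp where "R0 \<equiv> ROfNat (NConst 0)"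

definition gain_exp :: rexp where
  "gain_exp = RDiv (RAdd (RSub (Rv ''D'') (Rv ''A''))
     (RSqrt (RAdd (RMul (RSub (Rv ''A'') (Rv ''D'')) (RSub (Rv ''A'') (Rv ''D'')))
        (RMul (ROfNat (NConst 4)) (RMul (Rv ''B'') (Rv ''B'')))))) (ROfNat (NConst 2))"

text \<open>The assignment to the scratch variable \<open>a\<close> in the last branch acts as a
  skip.\<close>

definition pair_com :: com where
  "pair_com = Seq (set_r ''A'' R0) (Seq (set_r ''B'' R0) (Seq (set_r ''D'' R0) (Seq gram_com
     (Seq (set_r ''E'' gain_exp)
       (If (RLess (Rv ''theta'') (Rv ''E''))
         (Seq (set_r ''q'' (RSqrt (RAdd (RMul (Rv ''B'') (Rv ''B'')) (RMul (Rv ''E'') (Rv ''E''))))) rot_com)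
         (set_n ''a'' (NConst 0)))))))"

definition jacobi_com :: com where
  "jacobi_com = For ''t'' (Nv ''K'') (For ''i'' (Nv ''s'') (For ''j'' (Nv ''s'')
     (If (NLess (Nv ''i'') (Nv ''j'')) pair_com (set_n ''a'' (NConst 0)))))"

lemma runs_gram:
  fixes s :: ram_state
  assumes n: "nats s ''n'' 0 0 = n" and S: "nats s ''s'' 0 0 = S"
    and i: "nats s ''i'' 0 0 = i" and j: "nats s ''j'' 0 0 = j"
    and zero: "reals s ''A'' 0 0 = 0" "reals s ''B'' 0 0 = 0" "reals s ''D'' 0 0 = 0"
  defines "M \<equiv> signed S (reals s ''M'')" and "F \<equiv> reals s ''F''"
  shows "\<exists>s'. runs gram_com (S * (8 * n + 20) + 3) s s' \<and> agree {''a'', ''c'', ''y'', ''z'', ''A'', ''B'', ''D''} s s' \<and>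
    reals s' ''A'' 0 0 = quad n S M (F i) (F i) \<and> reals s' ''B'' 0 0 = quad n S M (F i) (F j) \<and>
    reals s' ''D'' 0 0 = quad n S M (F j) (F j)"
proof -
  let ?body = "Seq (sum_into ''y'' ''c'' (Nv ''n'') (RMul (M_exp ''a'') (F_exp ''i'')))
     (Seq (sum_into ''z'' ''c'' (Nv ''n'') (RMul (M_exp ''a'') (F_exp ''j'')))
     (Seq (set_r ''A'' (RAdd (Rv ''A'') (RMul (Rv ''y'') (Rv ''y''))))
     (Seq (set_r ''B'' (RAdd (Rv ''B'') (RMul (Rv ''y'') (Rv ''z''))))
          (set_r ''D'' (RAdd (Rv ''D'') (RMul (Rv ''z'') (Rv ''z'')))))))"
  let ?X = "{''a'', ''c'', ''y'', ''z'', ''A'', ''B'', ''D''}"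
  define Inv where "Inv = (\<lambda>a s'. agree ?X s s' \<and>
    reals s' ''A'' 0 0 = quad n a M (F i) (F i) \<and> reals s' ''B'' 0 0 = quad n a M (F i) (F j) \<and>
    reals s' ''D'' 0 0 = quad n a M (F j) (F j))"
  have "\<exists>s'. runs gram_com (S * ((8 * n + 17) + 3) + 3) s s' \<and> Inv S s' \<and> nats s' ''a'' 0 0 = S"
    unfolding gram_com_def
  proof (rule runs_For)
    show "Inv 0 (set_nat ''a'' 0 s)" using zero by (simp add: Inv_def quad_def agree_refl)
  next
    fix a s1 assume "Inv a s1"
    then show "nval (Nv ''s'') s1 = S" using S by (auto simp: Inv_def agree_D)
  next
    fix a s1 assume a: "a < S" and inv: "Inv a s1" and a1: "nats s1 ''a'' 0 0 = a"
    have ag: "agree ?X s s1" using inv by (auto simp: Inv_def)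
    have [simp]: "nats s1 ''n'' 0 0 = n" "nats s1 ''s'' 0 0 = S" "nats s1 ''i'' 0 0 = i" "nats s1 ''j'' 0 0 = j"
       "reals s1 ''M'' = reals s ''M''" "reals s1 ''F'' = F"
      using ag n S i j by (simp_all add: agree_D F_def)
    define s2 where "s2 = set_nat ''c'' n (set_real ''y'' (\<Sum>c<n. M a c * F i c) s1)"
    have r1: "runs (sum_into ''y'' ''c'' (Nv ''n'') (RMul (M_exp ''a'') (F_exp ''i''))) (4 * n + 5) s1 s2"
      unfolding s2_def by (rule runs_sum_into) (simp_all add: a1 M_def signed_def)
    define s3 where "s3 = set_nat ''c'' n (set_real ''z'' (\<Sum>c<n. M a c * F j c) s2)"
    have r2: "runs (sum_into ''z'' ''c'' (Nv ''n'') (RMul (M_exp ''a'') (F_exp ''j''))) (4 * n + 5) s2 s3"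
      unfolding s3_def by (rule runs_sum_into) (simp_all add: a1 M_def signed_def s2_def)
    note r3 = runs_set_r[of "''A''" "RAdd (Rv ''A'') (RMul (Rv ''y'') (Rv ''y''))" s3]
    define s4 where "s4 = set_real ''A'' (rval (RAdd (Rv ''A'') (RMul (Rv ''y'') (Rv ''y''))) s3) s3"
    note r4 = runs_set_r[of "''B''" "RAdd (Rv ''B'') (RMul (Rv ''y'') (Rv ''z''))" s4]
    define s5 where "s5 = set_real ''B'' (rval (RAdd (Rv ''B'') (RMul (Rv ''y'') (Rv ''z''))) s4) s4"
    note r5 = runs_set_r[of "''D''" "RAdd (Rv ''D'') (RMul (Rv ''z'') (Rv ''z''))" s5]
    define s6 where "s6 = set_real ''D'' (rval (RAdd (Rv ''D'') (RMul (Rv ''z'') (Rv ''z''))) s5) s5"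
    from runs_Seq[OF r1 runs_Seq[OF r2 runs_Seq[OF r3[folded s4_def] runs_Seq[OF r4[folded s5_def] r5[folded s6_def]]]]]
    have run: "runs ?body (8 * n + 17) s1 s6"
      by (rule runs_mono) simp
    have "Inv (Suc a) (set_nat ''a'' (Suc a) s6)"
      using inv by (simp add: Inv_def s6_def s5_def s4_def s3_def s2_def quad_def dot_def)
    moreover have "nats s6 ''a'' 0 0 = a" by (simp add: s6_def s5_def s4_def s3_def s2_def a1)
    ultimately show "\<exists>s'. runs ?body (8 * n + 17) s1 s'
      \<and> nats s' ''a'' 0 0 = a \<and> Inv (Suc a) (set_nat ''a'' (Suc a) s')" using run by blast
  qed
  then show ?thesis by (rule ex_runs_mono) (auto simp: Inv_def)
qed

lemma runs_rot:
  fixes s :: ram_state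
  assumes n: "nats s ''n'' 0 0 = n" and i: "nats s ''i'' 0 0 = i" and j: "nats s ''j'' 0 0 = j" and ij: "i \<noteq> j"
    and q: "reals s ''q'' 0 0 = sqrt ((reals s ''B'' 0 0)\<^sup>2 + (reals s ''E'' 0 0)\<^sup>2)"
  shows "\<exists>s'. runs rot_com (n * 10 + 3) s s' \<and> agree {''c'', ''y'', ''z'', ''F''} s s' \<and>
    reals s' ''F'' = rot n i j (reals s ''B'' 0 0) (reals s ''E'' 0 0) (reals s ''F'')"
proof -
  let ?X = "{''c'', ''y'', ''z'', ''F''}"
  define b e F where "b = reals s ''B'' 0 0" and "e = reals s ''E'' 0 0" and "F = reals s ''F''"
  \<comment> \<open>After \<open>c\<close> columns the array is the rotation restricted to columns
    below \<open>c\<close>.\<close>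
  define Inv where "Inv = (\<lambda>c s'. agree ?X s s' \<and> reals s' ''F'' = rot c i j b e F)"
  have "\<exists>s'. runs rot_com (n * (7 + 3) + 3) s s' \<and> Inv n s' \<and> nats s' ''c'' 0 0 = n"
    unfolding rot_com_def
  proof (rule runs_For)
    show "Inv 0 (set_nat ''c'' 0 s)" by (simp add: Inv_def agree_refl rot_def F_def)
  next
    fix a s1 assume "Inv a s1"
    then show "nval (Nv ''n'') s1 = n" using n by (auto simp: Inv_def agree_D)
  next
    fix c s1 assume c: "c < n" and inv: "Inv c s1" and c1: "nats s1 ''c'' 0 0 = c"
    have ag: "agree ?X s s1" and F1: "reals s1 ''F'' = rot c i j b e F" using inv by (auto simp: Inv_def)
    have [simp]: "nats s1 ''n'' 0 0 = n" "nats s1 ''i'' 0 0 = i" "nats s1 ''j'' 0 0 = j"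
       "reals s1 ''B'' 0 0 = b" "reals s1 ''E'' 0 0 = e" "reals s1 ''q'' 0 0 = sqrt (b\<^sup>2 + e\<^sup>2)"
      using ag n i j q by (simp_all add: agree_D b_def e_def)
    let ?c1 = "set_r ''y'' (F_exp ''i'')" and ?c2 = "set_r ''z'' (F_exp ''j'')"
    let ?e3 = "RDiv (RAdd (RMul (Rv ''B'') (Rv ''y'')) (RMul (Rv ''E'') (Rv ''z''))) (Rv ''q'')"
    let ?e4 = "RDiv (RSub (RMul (Rv ''B'') (Rv ''z'')) (RMul (Rv ''E'') (Rv ''y''))) (Rv ''q'')"
    let ?c3 = "RAssign ''F'' (Nv ''i'') (Nv ''c'') ?e3" and ?c4 = "RAssign ''F'' (Nv ''j'') (Nv ''c'') ?e4"
    define s2 where "s2 = set_real ''y'' (F i c) s1"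
    have r1: "runs ?c1 1 s1 s2"
      using runs_set_r[of "''y''" "F_exp ''i''" s1] ij by (simp add: s2_def F1 rot_def c1)
    define s3 where "s3 = set_real ''z'' (F j c) s2"
    have r2: "runs ?c2 1 s2 s3"
      using runs_set_r[of "''z''" "F_exp ''j''" s2] ij by (simp add: s2_def s3_def F1 rot_def c1)
    define s4 where "s4 = write_real ''F'' i c ((b * F i c + e * F j c) / sqrt (b\<^sup>2 + e\<^sup>2)) s3"
    have r3: "runs ?c3 1 s3 s4"
      using runs_RAssign[of "''F''" "Nv ''i''" "Nv ''c''" ?e3 s3] by (simp add: s2_def s3_def s4_def c1)
    define s5 where "s5 = write_real ''F'' j c ((b * F j c - e * F i c) / sqrt (b\<^sup>2 + e\<^sup>2)) s4"
    have r4: "runs ?c4 1 s4 s5"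
      using runs_RAssign[of "''F''" "Nv ''j''" "Nv ''c''" ?e4 s4] by (simp add: s2_def s3_def s4_def s5_def c1)
    have run: "runs (Seq ?c1 (Seq ?c2 (Seq ?c3 ?c4))) 7 s1 s5"
      by (rule runs_mono[OF runs_Seq[OF r1 runs_Seq[OF r2 runs_Seq[OF r3 r4]]]]) simp
    have "reals s5 ''F'' = rot (Suc c) i j b e F"
      using ij by (auto simp: s5_def s4_def s3_def s2_def F1 rot_def less_Suc_eq intro!: ext)
    then have "Inv (Suc c) (set_nat ''c'' (Suc c) s5)"
      using ag by (simp add: Inv_def s5_def s4_def s3_def s2_def)
    moreover have "nats s5 ''c'' 0 0 = c" by (simp add: s5_def s4_def s3_def s2_def c1)
    ultimately show "\<exists>s'. runs (Seq ?c1 (Seq ?c2 (Seq ?c3 ?c4))) 7 s1 s' \<and> nats s' ''c'' 0 0 = c \<and>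
      Inv (Suc c) (set_nat ''c'' (Suc c) s')" using run by blast
  qed
  then show ?thesis by (rule ex_runs_mono) (auto simp: Inv_def b_def e_def F_def)
qed

lemma runs_pair:
  fixes s :: ram_state
  assumes n: "nats s ''n'' 0 0 = n" and S: "nats s ''s'' 0 0 = S"
    and i: "nats s ''i'' 0 0 = i" and j: "nats s ''j'' 0 0 = j" and ij: "i \<noteq> j"
  shows "\<exists>s'. runs pair_com (S * (8 * n + 20) + n * 10 + 20) s s' \<and>
    agree {''a'', ''c'', ''y'', ''z'', ''A'', ''B'', ''D'', ''E'', ''q'', ''F''} s s' \<and>
    reals s' ''F'' = jacobi_step n S (signed S (reals s ''M'')) (reals s ''theta'' 0 0) i j (reals s ''F'')"
proof -
  let ?X = "{''a'', ''c'', ''y'', ''z'', ''A'', ''B'', ''D'', ''E'', ''q'', ''F''}"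
  define M F where "M = signed S (reals s ''M'')" and "F = reals s ''F''"
  define s1 where "s1 = set_real ''D'' 0 (set_real ''B'' 0 (set_real ''A'' 0 s))"
  obtain s2 where r2: "runs gram_com (S * (8 * n + 20) + 3) s1 s2"
    and ag2: "agree {''a'', ''c'', ''y'', ''z'', ''A'', ''B'', ''D''} s1 s2"
    and v2: "reals s2 ''A'' 0 0 = quad n S M (F i) (F i)" "reals s2 ''B'' 0 0 = quad n S M (F i) (F j)"
      "reals s2 ''D'' 0 0 = quad n S M (F j) (F j)"
    using runs_gram[of s1 n S i j] assms by (auto simp: s1_def M_def F_def)
  define b e where "b = quad n S M (F i) (F j)" and "e = gain (quad n S M (F i) (F i)) b (quad n S M (F j) (F j))"
  define s3 where "s3 = set_real ''E'' e s2"
  have r3: "runs (set_r ''E'' gain_exp) 1 s2 s3"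
    using runs_set_r[of "''E''" gain_exp s2] v2 by (simp add: s3_def e_def b_def gain_def gain_exp_def power2_eq_square)
  let ?sq = "RSqrt (RAdd (RMul (Rv ''B'') (Rv ''B'')) (RMul (Rv ''E'') (Rv ''E'')))"
  let ?If = "If (RLess (Rv ''theta'') (Rv ''E'')) (Seq (set_r ''q'' ?sq) rot_com) (set_n ''a'' (NConst 0))"
  have ag3: "agree ?X s s3"
  proof -
    have "agree ?X s s1" by (simp add: s1_def agree_refl)
    from agree_trans[OF this ag2, of ?X] show ?thesis by (simp add: s3_def)
  qed
  have st3: "nats s3 ''n'' 0 0 = n" "nats s3 ''i'' 0 0 = i" "nats s3 ''j'' 0 0 = j" "reals s3 ''theta'' = reals s ''theta''"
    using ag3 n i j by (simp_all add: agree_D)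
  have F3: "reals s3 ''F'' = F" using ag2 by (simp add: s3_def agree_D s1_def F_def)
  have "\<exists>s'. runs ?If (n * 10 + 6) s3 s' \<and> agree ?X s s' \<and>
    reals s' ''F'' = jacobi_step n S M (reals s ''theta'' 0 0) i j F"
  proof (cases "reals s ''theta'' 0 0 < e")
    case True
    define s4 where "s4 = set_real ''q'' (sqrt (b\<^sup>2 + e\<^sup>2)) s3"
    have r4: "runs (set_r ''q'' ?sq) 1 s3 s4"
      using runs_set_r[of "''q''" ?sq s3] v2 by (simp add: s4_def s3_def b_def power2_eq_square)
    obtain s5 where r5: "runs rot_com (n * 10 + 3) s4 s5" and ag5: "agree {''c'', ''y'', ''z'', ''F''} s4 s5"
      and F5: "reals s5 ''F'' = rot n i j b e F"
      using runs_rot[of s4 n i j] st3 ij F3 v2 by (auto simp: s4_def s3_def b_def)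
    have "runs ?If (n * 10 + 6) s3 s5"
    proof (rule runs_mono)
      show "runs ?If (1 + (n * 10 + 3) + 1 + 1) s3 s5"
        by (rule runs_If) (use True st3 runs_Seq[OF r4 r5] in \<open>simp add: s3_def\<close>)
    qed simp
    moreover have "agree ?X s s5"
    proof -
      have "agree ?X s s4" using ag3 by (simp add: s4_def)
      from agree_trans[OF this ag5, of ?X] show ?thesis by simp
    qed
    moreover have "reals s5 ''F'' = jacobi_step n S M (reals s ''theta'' 0 0) i j F"
      using True F5 by (simp add: jacobi_step_def Let_def b_def e_def)
    ultimately show ?thesis by blast
  next
    case False
    define s4 where "s4 = set_nat ''a'' 0 s3"
    have "runs ?If (n * 10 + 6) s3 s4"
    proof (rule runs_mono)
      show "runs ?If (1 + 1) s3 s4"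
        by (rule runs_If) (use False st3 runs_set_n[of "''a''" "NConst 0" s3] in \<open>simp add: s3_def s4_def\<close>)
    qed simp
    moreover have "agree ?X s s4" using ag3 by (simp add: s4_def)
    moreover have "reals s4 ''F'' = jacobi_step n S M (reals s ''theta'' 0 0) i j F"
      using False F3 by (simp add: jacobi_step_def Let_def b_def e_def s4_def)
    ultimately show ?thesis by blast
  qed
  then obtain s4 where r4: "runs ?If (n * 10 + 6) s3 s4" and ag4: "agree ?X s s4"
    and F4: "reals s4 ''F'' = jacobi_step n S M (reals s ''theta'' 0 0) i j F" by blast
  have z: "runs (set_r x R0) 1 s (set_real x 0 s)" for x s using runs_set_r[of x R0 s] by simp
  have "runs pair_com (S * (8 * n + 20) + n * 10 + 20) s s4"
    unfolding pair_com_def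
    by (rule runs_mono[OF runs_Seq[OF z runs_Seq[OF z runs_Seq[OF z runs_Seq[OF r2[unfolded s1_def] runs_Seq[OF r3 r4]]]]]]) simp
  then show ?thesis using ag4 F4 by (auto simp: M_def F_def)
qed

lemma runs_jacobi:
  fixes s :: ram_state
  assumes n: "nats s ''n'' 0 0 = n" and S: "nats s ''s'' 0 0 = S" and K: "nats s ''K'' 0 0 = K"
  defines "M \<equiv> signed S (reals s ''M'')" and "\<theta> \<equiv> reals s ''theta'' 0 0"
  assumes \<theta>: "\<theta> \<ge> 0" and start: "sweep_start n S M \<theta> 0 (reals s ''F'')"
  shows "\<exists>s'. runs jacobi_com (K * (S * (S * (S * (8 * n + 20) + n * 10 + 24) + 6) + 6) + 3) s s' \<and>
    agree {''t'', ''i'', ''j'', ''a'', ''c'', ''y'', ''z'', ''A'', ''B'', ''D'', ''E'', ''q'', ''F''} s s' \<and>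
    sweep_start n S M \<theta> K (reals s' ''F'')"
proof -
  let ?Y = "{''a'', ''c'', ''y'', ''z'', ''A'', ''B'', ''D'', ''E'', ''q'', ''F''}"
  let ?X = "{''t'', ''i'', ''j'', ''a'', ''c'', ''y'', ''z'', ''A'', ''B'', ''D'', ''E'', ''q'', ''F''}"
  let ?pair = "If (NLess (Nv ''i'') (Nv ''j'')) pair_com (set_n ''a'' (NConst 0))"
  let ?T = "S * (8 * n + 20) + n * 10 + 21"
  have st: "nats s' ''n'' 0 0 = n" "nats s' ''s'' 0 0 = S" "nats s' ''K'' 0 0 = K"
    "reals s' ''M'' = reals s ''M''" "reals s' ''theta'' 0 0 = \<theta>" if "agree ?X s s'" for s'
    using that n S K by (simp_all add: agree_D \<theta>_def)
  define I1 where "I1 = (\<lambda>t i j s'. agree ?X s s' \<and> nats s' ''t'' 0 0 = t \<and> nats s' ''i'' 0 0 = i \<and> sweep_inv n S M \<theta> t i j (reals s' ''F''))"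
  define I2 where "I2 = (\<lambda>t i s'. agree ?X s s' \<and> nats s' ''t'' 0 0 = t \<and> sweep_inv n S M \<theta> t i 0 (reals s' ''F''))"
  define I3 where "I3 = (\<lambda>t s'. agree ?X s s' \<and> sweep_start n S M \<theta> t (reals s' ''F''))"
  have inner: "\<exists>s'. runs (For ''j'' (Nv ''s'') ?pair) (S * (?T + 3) + 3) s1 s' \<and> I1 t i S s' \<and> nats s' ''j'' 0 0 = S"
    if "I2 t i s1" "nats s1 ''i'' 0 0 = i" for t i s1
  proof (rule runs_For)
    show "I1 t i 0 (set_nat ''j'' 0 s1)" using that by (simp add: I1_def I2_def)
  next
    fix j s2 assume "I1 t i j s2"
    then show "nval (Nv ''s'') s2 = S" using st by (auto simp: I1_def)
  next
    fix j s2 assume j: "j < S" and inv: "I1 t i j s2" and j2: "nats s2 ''j'' 0 0 = j"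
    have ag: "agree ?X s s2" and i2: "nats s2 ''i'' 0 0 = i" and t2: "nats s2 ''t'' 0 0 = t"
      and sw: "sweep_inv n S M \<theta> t i j (reals s2 ''F'')" using inv by (auto simp: I1_def)
    show "\<exists>s'. runs ?pair ?T s2 s' \<and> nats s' ''j'' 0 0 = j \<and> I1 t i (Suc j) (set_nat ''j'' (Suc j) s')"
    proof (cases "i < j")
      case True
      obtain s3 where r: "runs pair_com (S * (8 * n + 20) + n * 10 + 20) s2 s3" and ag3: "agree ?Y s2 s3"
        and F3: "reals s3 ''F'' = jacobi_step n S M \<theta> i j (reals s2 ''F'')"
        using runs_pair[of s2 n S i j] st[OF ag] i2 j2 True by (auto simp: M_def)
      have "runs ?pair (S * (8 * n + 20) + n * 10 + 20 + 1) s2 s3"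
        by (rule runs_If) (use r True i2 j2 in simp)
      then have "runs ?pair ?T s2 s3" by (rule runs_mono) simp
      moreover have "agree ?X s s3" by (rule agree_trans[OF ag ag3]) auto
      moreover have "sweep_inv n S M \<theta> t i (Suc j) (reals s3 ''F'')"
        unfolding F3 by (rule sweep_inv_step[OF sw True j \<theta>])
      ultimately show ?thesis using agree_D[OF ag3] i2 j2 t2
        by (intro exI[of _ s3]) (simp add: I1_def)
    next
      case False
      have "runs ?pair (1 + 1) s2 (set_nat ''a'' 0 s2)"
        by (rule runs_If) (use runs_set_n[of "''a''" "NConst 0" s2] False i2 j2 in simp)
      then have "runs ?pair ?T s2 (set_nat ''a'' 0 s2)" by (rule runs_mono) simp
      then show ?thesis using sweep_inv_skip[OF sw False] ag i2 j2 t2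
        by (intro exI[of _ "set_nat ''a'' 0 s2"]) (simp add: I1_def)
    qed
  qed
  have middle: "\<exists>s'. runs (For ''i'' (Nv ''s'') (For ''j'' (Nv ''s'') ?pair)) (S * ((S * (?T + 3) + 3) + 3) + 3) s1 s'
      \<and> I2 t S s' \<and> nats s' ''i'' 0 0 = S"
    if "I3 t s1" "nats s1 ''t'' 0 0 = t" for t s1
  proof (rule runs_For)
    show "I2 t 0 (set_nat ''i'' 0 s1)" using that sweep_inv_start by (simp add: I2_def I3_def)
  next
    fix i s2 assume "I2 t i s2"
    then show "nval (Nv ''s'') s2 = S" using st by (auto simp: I2_def)
  next
    fix i s2 assume i: "i < S" "I2 t i s2" "nats s2 ''i'' 0 0 = i"
    from inner[OF i(2,3)] obtain s3 where s3: "runs (For ''j'' (Nv ''s'') ?pair) (S * (?T + 3) + 3) s2 s3" "I1 t i S s3"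
      by blast
    then show "\<exists>s'. runs (For ''j'' (Nv ''s'') ?pair) (S * (?T + 3) + 3) s2 s' \<and> nats s' ''i'' 0 0 = i \<and> I2 t (Suc i) (set_nat ''i'' (Suc i) s')"
      using sweep_inv_row by (intro exI[of _ s3]) (simp add: I1_def I2_def)
  qed
  have "\<exists>s'. runs jacobi_com (K * ((S * ((S * (?T + 3) + 3) + 3) + 3) + 3) + 3) s s' \<and> I3 K s' \<and> nats s' ''t'' 0 0 = K"
    unfolding jacobi_com_def
  proof (rule runs_For)
    show "I3 0 (set_nat ''t'' 0 s)" using start by (simp add: I3_def agree_refl)
  next
    fix t s2 assume "I3 t s2"
    then show "nval (Nv ''K'') s2 = K" using st by (auto simp: I3_def)
  next
    fix t s2 assume t: "t < K" "I3 t s2" "nats s2 ''t'' 0 0 = t"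
    from middle[OF t(2,3)] obtain s3 where
      s3: "runs (For ''i'' (Nv ''s'') (For ''j'' (Nv ''s'') ?pair)) (S * ((S * (?T + 3) + 3) + 3) + 3) s2 s3" "I2 t S s3" by blast
    then show "\<exists>s'. runs (For ''i'' (Nv ''s'') (For ''j'' (Nv ''s'') ?pair)) (S * ((S * (?T + 3) + 3) + 3) + 3) s2 s'
        \<and> nats s' ''t'' 0 0 = t \<and> I3 (Suc t) (set_nat ''t'' (Suc t) s')"
      using sweep_inv_end by (intro exI[of _ s3]) (simp add: I2_def I3_def)
  qed
  then show ?thesis by (rule ex_runs_mono) (auto simp: I3_def)
qed

section \<open>Reading the nonzero entries and writing the factors\<close>

definition read_com :: "string \<Rightarrow> nexp \<Rightarrow> nexp \<Rightarrow> rexp \<Rightarrow> com" where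
  "read_com a ex ey ev = For ''e'' (Nv ''nnz'')
     (If (NLess (NConst 0) (NCell ''W'' (NCell ''row'' (Nv ''e'') (NConst 0)) (NCell ''col'' (Nv ''e'') (NConst 0))))
       (RAssign a ex ey (RAdd (RCell a ex ey) ev)) (set_n ''e'' (Nv ''e'')))"

text \<open>One scheme covers all three passes over the list: sketching rows into \<open>M\<close>,
  summing squares into \<open>beta\<close>, and sketching columns into \<open>C\<close>. No other
  loop of the program depends on the number of nonzeros.\<close>

lemma runs_read:
  fixes s :: ram_state and X Y :: "nat \<Rightarrow> nat"
  assumes N: "nats s ''nnz'' 0 0 = N"
    and W: "\<And>e. e < N \<Longrightarrow> nats s ''W'' (nats s ''row'' e 0) (nats s ''col'' e 0) = of_bool (w e)"
    and X: "\<And>e f. e < N \<Longrightarrow> nval ex (set_nat ''e'' e (set_reals a f s)) = X e"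
    and Y: "\<And>e f. e < N \<Longrightarrow> nval ey (set_nat ''e'' e (set_reals a f s)) = Y e"
    and V: "\<And>e f. e < N \<Longrightarrow> rval ev (set_nat ''e'' e (set_reals a f s)) = V e"
  shows "runs (read_com a ex ey ev) (N * 5 + 3) s (set_nat ''e'' N
    (set_reals a (\<lambda>i j. reals s a i j + (\<Sum>e<N. if w e \<and> X e = i \<and> Y e = j then V e else 0)) s))"
proof -
  define st where "st = (\<lambda>N'. set_nat ''e'' N'
    (set_reals a (\<lambda>i j. reals s a i j + (\<Sum>e<N'. if w e \<and> X e = i \<and> Y e = j then V e else 0)) s))"
  have "\<exists>s'. runs (read_com a ex ey ev) (N * (2 + 3) + 3) s s' \<and> s' = st N \<and> nats s' ''e'' 0 0 = N"
    unfolding read_com_def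
  proof (rule runs_For)
    show "set_nat ''e'' 0 s = st 0" by (intro ram_state_eqI) (simp_all add: st_def)
  next
    fix e s1 assume "s1 = st e"
    then show "nval (Nv ''nnz'') s1 = N" using N by (simp add: st_def)
  next
    fix e s1 assume e: "e < N" and s1: "s1 = st e" and e1: "nats s1 ''e'' 0 0 = e"
    have vals: "nval ex s1 = X e" "nval ey s1 = Y e" "rval ev s1 = V e"
      using X[OF e] Y[OF e] V[OF e] by (simp_all add: s1 st_def)
    have w1: "nats s1 ''W'' (nats s1 ''row'' e 0) (nats s1 ''col'' e 0) = of_bool (w e)"
      using W[OF e] by (simp add: s1 st_def)
    let ?If = "com.If (NLess (NConst 0) (NCell ''W'' (NCell ''row'' (Nv ''e'') (NConst 0)) (NCell ''col'' (Nv ''e'') (NConst 0))))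
       (RAssign a ex ey (RAdd (RCell a ex ey) ev)) (set_n ''e'' (Nv ''e''))"
    let ?s' = "if w e then write_real a (X e) (Y e) (reals s1 a (X e) (Y e) + V e) s1 else s1"
    have "runs ?If (1 + 1) s1 ?s'"
    proof (rule runs_If)
      have "set_nat ''e'' e s1 = s1" using e1 by (intro ram_state_eqI) (auto simp: fun_eq_iff)
      then show "runs (if bval (NLess (NConst 0) (NCell ''W'' (NCell ''row'' (Nv ''e'') (NConst 0)) (NCell ''col'' (Nv ''e'') (NConst 0)))) s1
         then RAssign a ex ey (RAdd (RCell a ex ey) ev) else set_n ''e'' (Nv ''e'')) 1 s1 ?s'"
        using runs_RAssign[of a ex ey "RAdd (RCell a ex ey) ev" s1] runs_set_n[of "''e''" "Nv ''e''" s1] vals w1 e1 by auto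
    qed
    then have "runs ?If 2 s1 ?s'" by (rule runs_mono) simp
    moreover have "set_nat ''e'' (Suc e) ?s' = st (Suc e)"
      by (intro ram_state_eqI) (auto simp: s1 st_def fun_eq_iff)
    moreover have "nats ?s' ''e'' 0 0 = e" using e1 by simp
    ultimately show "\<exists>s'. runs ?If 2 s1 s' \<and> nats s' ''e'' 0 0 = e \<and> set_nat ''e'' (Suc e) s' = st (Suc e)" by blast
  qed
  then show ?thesis by (auto simp: st_def)
qed

text \<open>While a frame vector is copied into a column of \<open>V\<close>, its unsigned sketch is
  collected in \<open>Z\<close>. \<open>factor_U_com\<close> then needs only S products per entry of
  \<open>U\<close> instead of a pass over a row of \<open>B\<close>.\<close>

definition factor_V_com :: com where
  "factor_V_com = (let h = NCell ''h'' (Nv ''j'') (NConst 0); f = RCell ''F'' (Nv ''l'') (Nv ''j'') in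
     For ''j'' (Nv ''n'') (Seq (RAssign ''V'' (Nv ''j'') (Nv ''l'') f)
       (RAssign ''Z'' h (Nv ''l'') (RAdd (RCell ''Z'' h (Nv ''l'')) f))))"

definition factor_U_com :: com where
  "factor_U_com = For ''i'' (Nv ''n'')
     (Seq (sum_into ''q'' ''b'' (Nv ''s'') (RMul
         (RSub (RCell ''C'' (Nv ''i'') (Nv ''b'')) (RCell ''C'' (Nv ''i'') (NAdd (Nv ''s'') (Nv ''b''))))
         (RSub (RCell ''Z'' (Nv ''b'') (Nv ''l'')) (RCell ''Z'' (NAdd (Nv ''s'') (Nv ''b'')) (Nv ''l'')))))
       (RAssign ''U'' (Nv ''i'') (Nv ''l'') (Rv ''q'')))"

definition output_com :: com where
  "output_com = Seq (set_n ''r'' (Nv ''rank'')) (For ''l'' (Nv ''rank'') (Seq factor_V_com factor_U_com))"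

lemma runs_factor_V:
  fixes s :: ram_state
  assumes n: "nats s ''n'' 0 0 = n" and l: "nats s ''l'' 0 0 = l" and Z0: "\<And>v. reals s ''Z'' v l = 0"
  defines "h \<equiv> \<lambda>i. nats s ''h'' i 0" and "F \<equiv> reals s ''F''"
  shows "\<exists>s'. runs factor_V_com (n * 6 + 3) s s' \<and> agree {''j'', ''V'', ''Z''} s s' \<and>
    (\<forall>i l'. reals s' ''V'' i l' = (if l' = l \<and> i < n then F l i else reals s ''V'' i l')) \<and>
    (\<forall>v l'. reals s' ''Z'' v l' = (if l' = l then \<Sum>i<n. of_bool (h i = v) * F l i else reals s ''Z'' v l'))"
proof -
  let ?X = "{''j'', ''V'', ''Z''}"
  let ?h = "NCell ''h'' (Nv ''j'') (NConst 0)" and ?f = "RCell ''F'' (Nv ''l'') (Nv ''j'')"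
  define Inv where "Inv = (\<lambda>j s'. agree ?X s s' \<and>
    (\<forall>i l'. reals s' ''V'' i l' = (if l' = l \<and> i < j then F l i else reals s ''V'' i l')) \<and>
    (\<forall>v l'. reals s' ''Z'' v l' = (if l' = l then \<Sum>i<j. of_bool (h i = v) * F l i else reals s ''Z'' v l')))"
  have "\<exists>s'. runs factor_V_com (n * (3 + 3) + 3) s s' \<and> Inv n s' \<and> nats s' ''j'' 0 0 = n"
    unfolding factor_V_com_def Let_def
  proof (rule runs_For)
    show "Inv 0 (set_nat ''j'' 0 s)" using Z0 by (simp add: Inv_def agree_refl)
  next
    fix j s1 assume "Inv j s1"
    then show "nval (Nv ''n'') s1 = n" using n by (auto simp: Inv_def agree_D)
  next
    fix j s1 assume j: "j < n" and inv: "Inv j s1" and j1: "nats s1 ''j'' 0 0 = j"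
    have ag: "agree ?X s s1" using inv by (simp add: Inv_def)
    have st: "nats s1 ''l'' 0 0 = l" "reals s1 ''F'' = F" "nats s1 ''h'' j 0 = h j"
      using ag l by (simp_all add: agree_D F_def h_def)
    define s2 where "s2 = write_real ''V'' j l (F l j) s1"
    have r1: "runs (RAssign ''V'' (Nv ''j'') (Nv ''l'') ?f) 1 s1 s2"
      using runs_RAssign[of "''V''" "Nv ''j''" "Nv ''l''" ?f s1] st j1 by (simp add: s2_def)
    define s3 where "s3 = write_real ''Z'' (h j) l (reals s1 ''Z'' (h j) l + F l j) s2"
    have r2: "runs (RAssign ''Z'' ?h (Nv ''l'') (RAdd (RCell ''Z'' ?h (Nv ''l'')) ?f)) 1 s2 s3"
      using runs_RAssign[of "''Z''" ?h "Nv ''l''" "RAdd (RCell ''Z'' ?h (Nv ''l'')) ?f" s2] st j1 by (simp add: s2_def s3_def)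
    have run: "runs (Seq (RAssign ''V'' (Nv ''j'') (Nv ''l'') ?f)
       (RAssign ''Z'' ?h (Nv ''l'') (RAdd (RCell ''Z'' ?h (Nv ''l'')) ?f))) 3 s1 s3"
      by (rule runs_mono[OF runs_Seq[OF r1 r2]]) simp
    have "Inv (Suc j) (set_nat ''j'' (Suc j) s3)"
      using inv by (auto simp: Inv_def s3_def s2_def)
    moreover have "nats s3 ''j'' 0 0 = j" using j1 by (simp add: s3_def s2_def)
    ultimately show "\<exists>s'. runs (Seq (RAssign ''V'' (Nv ''j'') (Nv ''l'') ?f)
       (RAssign ''Z'' ?h (Nv ''l'') (RAdd (RCell ''Z'' ?h (Nv ''l'')) ?f))) 3 s1 s' \<and> nats s' ''j'' 0 0 = j \<and>
       Inv (Suc j) (set_nat ''j'' (Suc j) s')" using run by blast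
  qed
  then show ?thesis by (rule ex_runs_mono) (auto simp: Inv_def)
qed

lemma runs_factor_U:
  fixes s :: ram_state
  assumes n: "nats s ''n'' 0 0 = n" and l: "nats s ''l'' 0 0 = l" and S: "nats s ''s'' 0 0 = S"
  defines "u \<equiv> \<lambda>i. \<Sum>b<S. (reals s ''C'' i b - reals s ''C'' i (S + b)) * (reals s ''Z'' b l - reals s ''Z'' (S + b) l)"
  shows "\<exists>s'. runs factor_U_com (n * (4 * S + 10) + 3) s s' \<and> agree {''i'', ''b'', ''q'', ''U''} s s' \<and>
    (\<forall>i l'. reals s' ''U'' i l' = (if l' = l \<and> i < n then u i else reals s ''U'' i l'))"
proof -
  let ?X = "{''i'', ''b'', ''q'', ''U''}"
  let ?e = "RMul (RSub (RCell ''C'' (Nv ''i'') (Nv ''b'')) (RCell ''C'' (Nv ''i'') (NAdd (Nv ''s'') (Nv ''b''))))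
         (RSub (RCell ''Z'' (Nv ''b'') (Nv ''l'')) (RCell ''Z'' (NAdd (Nv ''s'') (Nv ''b'')) (Nv ''l'')))"
  let ?c = "Seq (sum_into ''q'' ''b'' (Nv ''s'') ?e) (RAssign ''U'' (Nv ''i'') (Nv ''l'') (Rv ''q''))"
  define Inv where "Inv = (\<lambda>j s'. agree ?X s s' \<and>
    (\<forall>i l'. reals s' ''U'' i l' = (if l' = l \<and> i < j then u i else reals s ''U'' i l')))"
  have "\<exists>s'. runs factor_U_com (n * ((4 * S + 7) + 3) + 3) s s' \<and> Inv n s' \<and> nats s' ''i'' 0 0 = n"
    unfolding factor_U_com_def
  proof (rule runs_For)
    show "Inv 0 (set_nat ''i'' 0 s)" by (simp add: Inv_def agree_refl)
  next
    fix j s1 assume "Inv j s1"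
    then show "nval (Nv ''n'') s1 = n" using n by (auto simp: Inv_def agree_D)
  next
    fix i s1 assume i: "i < n" and inv: "Inv i s1" and i1: "nats s1 ''i'' 0 0 = i"
    have ag: "agree ?X s s1" using inv by (simp add: Inv_def)
    have st: "nats s1 ''l'' 0 0 = l" "nats s1 ''s'' 0 0 = S" "reals s1 ''C'' = reals s ''C''" "reals s1 ''Z'' = reals s ''Z''"
      using ag l S by (simp_all add: agree_D)
    define s2 where "s2 = set_nat ''b'' S (set_real ''q'' (u i) s1)"
    have r1: "runs (sum_into ''q'' ''b'' (Nv ''s'') ?e) (4 * S + 5) s1 s2"
      unfolding s2_def u_def by (rule runs_sum_into) (simp_all add: st i1)
    define s3 where "s3 = write_real ''U'' i l (u i) s2"
    have r2: "runs (RAssign ''U'' (Nv ''i'') (Nv ''l'') (Rv ''q'')) 1 s2 s3"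
      using runs_RAssign[of "''U''" "Nv ''i''" "Nv ''l''" "Rv ''q''" s2] st i1 by (simp add: s2_def s3_def)
    have run: "runs ?c (4 * S + 7) s1 s3"
      by (rule runs_mono[OF runs_Seq[OF r1 r2]]) simp
    have "Inv (Suc i) (set_nat ''i'' (Suc i) s3)"
      using inv by (auto simp: Inv_def s3_def s2_def)
    moreover have "nats s3 ''i'' 0 0 = i" using i1 by (simp add: s3_def s2_def)
    ultimately show "\<exists>s'. runs ?c (4 * S + 7) s1 s' \<and> nats s' ''i'' 0 0 = i \<and> Inv (Suc i) (set_nat ''i'' (Suc i) s')"
      using run by blast
  qed
  then show ?thesis by (rule ex_runs_mono) (auto simp: Inv_def)
qed

lemma runs_output:
  fixes s :: ram_state
  assumes n: "nats s ''n'' 0 0 = n" and S: "nats s ''s'' 0 0 = S" and k: "nats s ''rank'' 0 0 = k"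
    and Z0: "\<And>v l. reals s ''Z'' v l = 0"
  defines "z \<equiv> \<lambda>l v. \<Sum>j<n. of_bool (nats s ''h'' j 0 = v) * reals s ''F'' l j"
  shows "\<exists>s'. runs output_com (k * (n * (4 * S + 16) + 10) + 5) s s' \<and> nats s' ''r'' 0 0 = k \<and>
    (\<forall>i<n. \<forall>l<k. reals s' ''V'' i l = reals s ''F'' l i \<and>
      reals s' ''U'' i l = (\<Sum>b<S. (reals s ''C'' i b - reals s ''C'' i (S + b)) * (z l b - z l (S + b))))"
proof -
  let ?X = "{''r'', ''l'', ''i'', ''j'', ''b'', ''q'', ''V'', ''Z'', ''U''}"
  define s0 where "s0 = set_nat ''r'' k s"
  have r0: "runs (set_n ''r'' (Nv ''rank'')) 1 s s0"
    using runs_set_n[of "''r''" "Nv ''rank''" s] k by (simp add: s0_def)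
  define Inv where "Inv = (\<lambda>l s'. agree ?X s s' \<and> nats s' ''r'' 0 0 = k \<and>
    (\<forall>v. \<forall>l'\<ge>l. reals s' ''Z'' v l' = 0) \<and>
    (\<forall>i<n. \<forall>l'<l. reals s' ''V'' i l' = reals s ''F'' l' i \<and>
      reals s' ''U'' i l' = (\<Sum>b<S. (reals s ''C'' i b - reals s ''C'' i (S + b)) * (z l' b - z l' (S + b)))))"
  have "\<exists>s'. runs (For ''l'' (Nv ''rank'') (Seq factor_V_com factor_U_com)) (k * ((n * 6 + 3 + (n * (4 * S + 10) + 3) + 1) + 3) + 3) s0 s' \<and> Inv k s' \<and> nats s' ''l'' 0 0 = k"
  proof (rule runs_For)
    show "Inv 0 (set_nat ''l'' 0 s0)" by (simp add: Inv_def agree_refl s0_def Z0)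
  next
    fix j s1 assume "Inv j s1"
    then show "nval (Nv ''rank'') s1 = k" using k by (auto simp: Inv_def agree_D)
  next
    fix l s1 assume l: "l < k" and inv: "Inv l s1" and l1: "nats s1 ''l'' 0 0 = l"
    have ag: "agree ?X s s1" using inv by (simp add: Inv_def)
    have st: "nats s1 ''n'' 0 0 = n" "nats s1 ''s'' 0 0 = S" "reals s1 ''C'' = reals s ''C''" "reals s1 ''F'' = reals s ''F''"
        "nats s1 ''h'' = nats s ''h''"
      using ag n S by (simp_all add: agree_D)
    obtain s2 where r1: "runs factor_V_com (n * 6 + 3) s1 s2" and ag2: "agree {''j'', ''V'', ''Z''} s1 s2"
      and V2: "\<And>i l'. reals s2 ''V'' i l' = (if l' = l \<and> i < n then reals s ''F'' l i else reals s1 ''V'' i l')"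
      and Z2: "\<And>v l'. reals s2 ''Z'' v l' = (if l' = l then z l v else reals s1 ''Z'' v l')"
      using runs_factor_V[of s1 n l] st l1 inv by (auto simp: Inv_def z_def)
    have st2: "nats s2 ''n'' 0 0 = n" "nats s2 ''s'' 0 0 = S" "reals s2 ''C'' = reals s ''C''" "nats s2 ''l'' 0 0 = l"
        "reals s2 ''U'' = reals s1 ''U''"
      using ag2 st l1 by (simp_all add: agree_D)
    obtain s3 where r2: "runs factor_U_com (n * (4 * S + 10) + 3) s2 s3" and ag3: "agree {''i'', ''b'', ''q'', ''U''} s2 s3"
      and U3: "\<And>i l'. reals s3 ''U'' i l' = (if l' = l \<and> i < n then
        \<Sum>b<S. (reals s ''C'' i b - reals s ''C'' i (S + b)) * (z l b - z l (S + b)) else reals s1 ''U'' i l')"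
      using runs_factor_U[of s2 n l S] st2 by (auto simp: Z2)
    have st3: "reals s3 ''V'' = reals s2 ''V''" "reals s3 ''Z'' = reals s2 ''Z''" "nats s3 ''l'' 0 0 = l" "nats s3 ''r'' 0 0 = k"
      using ag3 ag2 st2 inv by (simp_all add: agree_D Inv_def)
    from agree_trans[OF ag ag2, of ?X] have "agree ?X s s2" by simp
    from agree_trans[OF this ag3, of ?X] have ag3': "agree ?X s s3" by simp
    have "Inv (Suc l) (set_nat ''l'' (Suc l) s3)"
      using inv ag3' st3 by (auto simp: Inv_def V2 Z2 U3 less_Suc_eq)
    then show "\<exists>s'. runs (Seq factor_V_com factor_U_com) (n * 6 + 3 + (n * (4 * S + 10) + 3) + 1) s1 s' \<and> nats s' ''l'' 0 0 = l \<and>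
      Inv (Suc l) (set_nat ''l'' (Suc l) s')" using runs_Seq[OF r1 r2] st3 by blast
  qed
  then obtain s' where s': "runs (For ''l'' (Nv ''rank'') (Seq factor_V_com factor_U_com)) (k * ((n * 6 + 3 + (n * (4 * S + 10) + 3) + 1) + 3) + 3) s0 s'"
    "Inv k s'" by blast
  have "runs output_com (k * (n * (4 * S + 16) + 10) + 5) s s'"
    unfolding output_com_def by (rule runs_mono[OF runs_Seq[OF r0 s'(1)]]) (simp add: algebra_simps)
  then show ?thesis using s'(2) by (auto simp: Inv_def)
qed

section \<open>Counting up to a real bound\<close>

text \<open>Reals cannot be rounded to naturals, so the ceiling of e2 / e1 is found by counting up.
  The time is linear in the result, which is affordable for both the sketch size and the number of
  sweeps.\<close>

definition count_com :: "string \<Rightarrow> rexp \<Rightarrow> rexp \<Rightarrow> com" where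
  "count_com x e1 e2 = While (RLess (RMul (ROfNat (Nv x)) e1) e2) (set_n x (NAdd (Nv x) (NConst 1)))"

lemma runs_count:
  fixes s :: ram_state
  assumes p: "p > 0" and e: "\<And>v. rval e1 (set_nat x v s) = p" "\<And>v. rval e2 (set_nat x v s) = q"
    and q: "q \<ge> 0" and zero: "nats s x 0 0 = 0"
  shows "\<exists>v. runs (count_com x e1 e2) (2 * v + 1) s (set_nat x v s) \<and> real v * p \<ge> q \<and> real v \<le> q / p + 1"
proof -
  let ?c = "count_com x e1 e2"
  define N where "N = nat \<lceil>q / p\<rceil>"
  have N: "real N \<ge> q / p" and Nle: "real N \<le> q / p + 1"
    using p q by (auto simp: N_def)
  have b: "bval (RLess (RMul (ROfNat (Nv x)) e1) e2) (set_nat x v s) \<longleftrightarrow> v < N" for v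
  proof -
    have "v < N \<longleftrightarrow> real v < q / p" unfolding N_def by (simp add: zless_nat_eq_int_zless less_ceiling_iff)
    also have "\<dots> \<longleftrightarrow> real v * p < q" using p by (simp add: field_simps)
    finally show ?thesis by (simp add: e)
  qed
  have up: "runs ?c (2 * k + 1) (set_nat x v s) (set_nat x N s)" if "k + v = N" for k v
    using that
  proof (induction k arbitrary: v)
    case 0
    then have "\<not> bval (RLess (RMul (ROfNat (Nv x)) e1) e2) (set_nat x v s)" using b[of v] by simp
    from runs_While_False[OF this] show ?case using 0 by (simp add: count_com_def)
  next
    case (Suc k)
    have "runs (set_n x (NAdd (Nv x) (NConst 1))) 1 (set_nat x v s) (set_nat x (Suc v) s)"
      using runs_set_n[of x "NAdd (Nv x) (NConst 1)" "set_nat x v s"] by (simp add: set_nat_def write_nat_def)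
    from runs_While_True[OF _ this Suc.IH[of "Suc v", unfolded count_com_def]] show ?case
      unfolding count_com_def using b[of v] Suc.prems by simp
  qed
  have "set_nat x 0 s = s" using zero by (intro ram_state_eqI) (auto simp: fun_eq_iff)
  then have "runs ?c (2 * N + 1) s (set_nat x N s)" using up[of N 0] by simp
  moreover have "real N * p \<ge> q" using N p by (simp add: field_simps)
  ultimately show ?thesis using Nle by blast
qed

section \<open>Drawing a hash function\<close>

definition draw_com :: "string \<Rightarrow> com" where
  "draw_com a = For ''i'' (Nv ''n'') (Draw a (Nv ''i'') (NConst 0) (NSub (NAdd (Nv ''s'') (Nv ''s'')) (NConst 1)))"

text \<open>The loop counter is included, so that with m in place of \<open>n\<close> this is the
  state after m draws.\<close>

definition store_hash :: "string \<Rightarrow> nat \<Rightarrow> (nat \<Rightarrow> nat) \<Rightarrow> ram_state \<Rightarrow> ram_state" where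
  "store_hash a n g s = set_nat ''i'' n (set_nats a (\<lambda>i j. if j = 0 \<and> i < n then g i else nats s a i j) s)"

text \<open>All random branches take the same number of steps, which permits an exact time: two
  steps to enter the loop, four per draw, one to leave.\<close>

lemma run_draw:
  fixes s :: ram_state
  assumes n: "nats s ''n'' 0 0 = n" and S: "nats s ''s'' 0 0 = S" and a: "a \<notin> {''n'', ''s'', ''i''}"
  shows "ram_run (4 * n + 3) (draw_com a # K, s) = map_pmf (\<lambda>g. (K, store_hash a n g s)) (hashes (2 * S - 1) n)"
proof -
  let ?D = "Draw a (Nv ''i'') (NConst 0) (NSub (NAdd (Nv ''s'') (Nv ''s'')) (NConst 1))"
  let ?inc = "set_n ''i'' (NAdd (Nv ''i'') (NConst 1))"
  let ?W = "While (NLess (Nv ''i'') (Nv ''n'')) (Seq ?D ?inc)"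
  let ?N = "2 * S - 1"
  have loop: "ram_run (4 * m) (?W # K, store_hash a 0 (\<lambda>_. 0) s) = map_pmf (\<lambda>g. (?W # K, store_hash a m g s)) (hashes ?N m)"
    if "m \<le> n" for m
    using that
  proof (induction m)
    case 0
    show ?case by simp
  next
    case (Suc m)
    have one: "ram_run 4 (?W # K, store_hash a m g s)
      = map_pmf (\<lambda>v. (?W # K, store_hash a (Suc m) (g(m := v)) s)) (pmf_of_set {0..?N})" for g
    proof -
      have st: "nats (store_hash a m g s) ''i'' 0 0 = m" "nats (store_hash a m g s) ''n'' 0 0 = n"
        "nats (store_hash a m g s) ''s'' 0 0 = S"
        using a n S by (auto simp: store_hash_def)
      have up: "write_nat ''i'' 0 0 (Suc m) (write_nat a m 0 v (store_hash a m g s)) = store_hash a (Suc m) (g(m := v)) s" for v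
        using a by (intro ram_state_eqI) (auto simp: store_hash_def fun_eq_iff less_Suc_eq)
      have im: "nats (write_nat a m 0 v (store_hash a m g s)) ''i'' 0 0 = m" for v
        using a st by auto
      have "4 = Suc (Suc (Suc (Suc 0)))" by simp
      then have "ram_run 4 (?W # K, store_hash a m g s) = ram_run (Suc (Suc (Suc (Suc 0)))) (?W # K, store_hash a m g s)"
        by (simp only:)
      also have "\<dots> = map_pmf (\<lambda>v. (?W # K, write_nat ''i'' 0 0 (Suc m) (write_nat a m 0 v (store_hash a m g s)))) (pmf_of_set {0..S + S - 1})"
        using Suc.prems st im
        by (simp add: bind_return_pmf bind_map_pmf map_pmf_def bind_assoc_pmf)
      finally show ?thesis by (simp only: up mult_2)
    qed
    have "ram_run (4 * Suc m) (?W # K, store_hash a 0 (\<lambda>_. 0) s)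
      = bind_pmf (ram_run (4 * m) (?W # K, store_hash a 0 (\<lambda>_. 0) s)) (ram_run 4)"
      by (simp add: ram_run_add[symmetric] add.commute)
    also have "\<dots> = bind_pmf (hashes ?N m) (\<lambda>g. ram_run 4 (?W # K, store_hash a m g s))"
      using Suc by (simp add: bind_map_pmf)
    also have "\<dots> = map_pmf (\<lambda>g. (?W # K, store_hash a (Suc m) g s)) (hashes ?N (Suc m))"
      by (simp only: one hashes.simps map_bind_pmf pmf.map_comp o_def)
    finally show ?case .
  qed
  have start: "ram_run 2 (draw_com a # K, s) = return_pmf (?W # K, store_hash a 0 (\<lambda>_. 0) s)"
  proof -
    have "write_nat ''i'' 0 0 0 s = store_hash a 0 (\<lambda>_. 0) s"
      by (intro ram_state_eqI) (auto simp: store_hash_def fun_eq_iff)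
    then show ?thesis by (simp add: numeral_2_eq_2 draw_com_def For_def bind_return_pmf)
  qed
  have stop: "ram_run 1 (?W # K, store_hash a n g s) = return_pmf (K, store_hash a n g s)" for g
    using a n by (auto simp: store_hash_def bind_return_pmf)
  have "ram_run (4 * n + 3) (draw_com a # K, s)
    = bind_pmf (bind_pmf (ram_run 2 (draw_com a # K, s)) (ram_run (4 * n))) (ram_run 1)"
  proof -
    have "4 * n + 3 = (2 + 4 * n) + 1" by simp
    then show ?thesis by (simp only: ram_run_add)
  qed
  also have "\<dots> = map_pmf (\<lambda>g. (K, store_hash a n g s)) (hashes ?N n)"
    by (simp only: start bind_return_pmf loop[OF order_refl] bind_map_pmf stop map_pmf_def[symmetric])
  finally show ?thesis .
qed

section \<open>Error analysis of the sketched approximation\<close>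

lemma quadratic_form:
  "(\<Sum>c<n. \<Sum>d<n. (\<Sum>a<s. x a c * x a d) * (w c * w d)) = (\<Sum>a<s. (dot n (x a) w)\<^sup>2)"
proof -
  have "(\<Sum>a<s. (dot n (x a) w)\<^sup>2) = (\<Sum>a<s. \<Sum>c<n. \<Sum>d<n. (x a c * x a d) * (w c * w d))"
    by (simp add: dot_def power2_eq_square sum_product mult_ac)
  also have "\<dots> = (\<Sum>c<n. \<Sum>d<n. \<Sum>a<s. (x a c * x a d) * (w c * w d))" by (rule sum_swap3)
  finally show ?thesis by (simp add: sum_distrib_right)
qed

text \<open>A Frobenius-norm bound on the difference of two Gram matrices bounds the difference of
  their quadratic forms; no factor \<open>n\<close> is lost.\<close>
lemma quad_diff_le:
  fixes x y :: "nat \<Rightarrow> nat \<Rightarrow> real"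
  assumes err: "(\<Sum>c<n. \<Sum>d<n. ((\<Sum>a<s. x a c * x a d) - (\<Sum>i<m. y i c * y i d))\<^sup>2) \<le> \<rho>\<^sup>2"
    and w: "dot n w w \<le> 1" and \<rho>: "\<rho> \<ge> 0"
  shows "\<bar>(\<Sum>a<s. (dot n (x a) w)\<^sup>2) - (\<Sum>i<m. (dot n (y i) w)\<^sup>2)\<bar> \<le> \<rho>"
proof -
  define E where "E = (\<lambda>c d. (\<Sum>a<s. x a c * x a d) - (\<Sum>i<m. y i c * y i d))"
  have "(\<Sum>a<s. (dot n (x a) w)\<^sup>2) - (\<Sum>i<m. (dot n (y i) w)\<^sup>2) = (\<Sum>c<n. \<Sum>d<n. E c d * (w c * w d))"
    unfolding quadratic_form[symmetric] E_def by (simp add: left_diff_distrib sum_subtractf)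
  also have "\<dots> = (\<Sum>p\<in>{..<n} \<times> {..<n}. E (fst p) (snd p) * (w (fst p) * w (snd p)))"
    by (simp add: sum.cartesian_product case_prod_beta)
  finally have eq: "(\<Sum>a<s. (dot n (x a) w)\<^sup>2) - (\<Sum>i<m. (dot n (y i) w)\<^sup>2) = \<dots>" .
  have "(\<Sum>p\<in>{..<n} \<times> {..<n}. E (fst p) (snd p) * (w (fst p) * w (snd p)))\<^sup>2
    \<le> (\<Sum>p\<in>{..<n} \<times> {..<n}. (E (fst p) (snd p))\<^sup>2) * (\<Sum>p\<in>{..<n} \<times> {..<n}. (w (fst p) * w (snd p))\<^sup>2)"
    by (rule Cauchy_Schwarz_ineq_sum)
  also have "(\<Sum>p\<in>{..<n} \<times> {..<n}. (w (fst p) * w (snd p))\<^sup>2) = dot n w w * dot n w w"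
    unfolding dot_def sum_product by (simp add: sum.cartesian_product case_prod_beta power2_eq_square mult_ac)
  also have "(\<Sum>p\<in>{..<n} \<times> {..<n}. (E (fst p) (snd p))\<^sup>2) = (\<Sum>c<n. \<Sum>d<n. (E c d)\<^sup>2)"
    by (simp add: sum.cartesian_product case_prod_beta)
  also have "(\<Sum>c<n. \<Sum>d<n. (E c d)\<^sup>2) * (dot n w w * dot n w w) \<le> \<rho>\<^sup>2 * (1 * 1)"
    by (intro mult_mono) (use err w dot_self_nonneg[of n w] in \<open>auto simp: E_def intro!: sum_nonneg\<close>)
  finally have "((\<Sum>a<s. (dot n (x a) w)\<^sup>2) - (\<Sum>i<m. (dot n (y i) w)\<^sup>2))\<^sup>2 \<le> \<rho>\<^sup>2" by (simp add: eq)
  then show ?thesis using \<rho> abs_le_square_iff[of _ \<rho>] by simp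
qed

lemma dot_sum_squares_le:
  assumes "dot n w w \<le> 1"
  shows "(\<Sum>i<m. (dot n (B i) w)\<^sup>2) \<le> (\<Sum>i<m. dot n (B i) (B i))"
proof (rule sum_mono)
  fix i
  have "(dot n (B i) w)\<^sup>2 \<le> dot n (B i) (B i) * dot n w w" by (rule dot_Cauchy_Schwarz)
  also have "\<dots> \<le> dot n (B i) (B i) * 1" using assms dot_self_nonneg by (intro mult_left_mono)
  finally show "(dot n (B i) w)\<^sup>2 \<le> dot n (B i) (B i)" by simp
qed

text \<open>Residuals are compared through captured energy: at most that of \<open>w\<close> for the
  competitor, nearly that of \<open>F\<close> for the output. Passing from \<open>B\<close> to
  \<open>M\<close>, where the settled frame is nearly optimal, and back costs k \<rho> each
  way.\<close>

lemma sketched_svd_error: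
  fixes B F M U u v :: "nat \<Rightarrow> nat \<Rightarrow> real" and n S :: nat and \<epsilon> :: real
  defines "\<beta> \<equiv> \<Sum>i<n. dot n (B i) (B i)"
  defines "\<theta> \<equiv> (\<epsilon> / (16 * (real S)\<^sup>2))\<^sup>2 * \<beta>"
  assumes eps: "0 < \<epsilon>" "\<epsilon> \<le> 1" and k: "1 \<le> k" "k \<le> S"
    and sketch: "(\<Sum>c<n. \<Sum>d<n. ((\<Sum>a<S. M a c * M a d) - (\<Sum>i<n. B i c * B i d))\<^sup>2) \<le> (\<epsilon> / (8 * real k) * \<beta>)\<^sup>2"
    and K: "real K * \<epsilon>\<^sup>2 \<ge> 513 * real S ^ 6"
    and F: "sweep_start n S M \<theta> K F"
    and U: "(\<Sum>i<n. \<Sum>l<k. (U i l - dot n (B i) (F l))\<^sup>2) \<le> \<epsilon> / 4 * \<beta>"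
  shows "(\<Sum>i<n. \<Sum>j<n. (B i j - (\<Sum>l<k. U i l * F l j))\<^sup>2)
    \<le> (\<Sum>i<n. \<Sum>j<n. (B i j - (\<Sum>l<k. u l i * v l j))\<^sup>2) + \<epsilon> * \<beta>"
proof -
  define \<rho> where "\<rho> = \<epsilon> / (8 * real k) * \<beta>"
  define \<zeta> where "\<zeta> = \<epsilon> / (16 * (real S)\<^sup>2)"
  have S1: "real S \<ge> 1" and k1: "real k \<ge> 1" and kS: "real k \<le> real S" using k by auto
  have \<beta>0: "\<beta> \<ge> 0" unfolding \<beta>_def by (intro sum_nonneg dot_self_nonneg)
  have \<rho>0: "\<rho> \<ge> 0" using eps k1 \<beta>0 by (simp add: \<rho>_def)
  have \<rho>\<beta>: "\<rho> \<le> \<beta>"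
  proof -
    have "\<epsilon> / (8 * real k) \<le> 1" using eps k1 by (simp add: field_simps)
    from mult_right_mono[OF this \<beta>0] show ?thesis by (simp add: \<rho>_def)
  qed
  have S2: "(real S)\<^sup>2 \<ge> 1" using S1 by simp
  have \<zeta>0: "\<zeta> > 0" using eps S1 by (simp add: \<zeta>_def)
  have "\<epsilon> \<le> 16 * (real S)\<^sup>2" using eps S2 by linarith
  then have \<zeta>1: "\<zeta> \<le> 1" using S1 by (simp add: \<zeta>_def divide_le_eq)
  have \<theta>: "\<theta> = \<zeta>\<^sup>2 * \<beta>" by (simp add: \<theta>_def \<zeta>_def)
  have \<theta>0: "\<theta> \<ge> 0" using \<beta>0 by (simp add: \<theta>)
  have row: "(\<Sum>i<n. \<Sum>j<n. (B i j - y i j)\<^sup>2) = (\<Sum>i<n. dot n (\<lambda>j. B i j - y i j) (\<lambda>j. B i j - y i j))" for y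
    by (simp add: dot_def power2_eq_square)
  have frame: "contractive n S F" "\<And>a. a < S \<Longrightarrow> reproduces n S F (M a)"
    using F by (auto simp: sweep_start_def jacobi_frame_def)
  have Fk: "contractive n k F" by (rule contractive_mono[OF frame(1) k(2)])
  have lhs: "(\<Sum>i<n. \<Sum>j<n. (B i j - (\<Sum>l<k. U i l * F l j))\<^sup>2)
    \<le> \<beta> - (\<Sum>i<n. \<Sum>l<k. (dot n (B i) (F l))\<^sup>2) + (\<Sum>i<n. \<Sum>l<k. (U i l - dot n (B i) (F l))\<^sup>2)"
    unfolding row \<beta>_def sum_subtractf[symmetric] sum.distrib[symmetric]
    by (rule sum_mono) (rule contractive_residual_le[OF Fk])
  \<comment> \<open>Every row of the competitor lies in the span of the k rows \<open>v l\<close>,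
    so an orthonormalization of these rows reproduces it.\<close>
  obtain w where gs: "gs_inv n k v w" using gs_exists by blast
  have w: "contractive n k w" by (rule gs_inv_contractive[OF gs])
  have rhs: "\<beta> - (\<Sum>i<n. \<Sum>l<k. (dot n (B i) (w l))\<^sup>2) \<le> (\<Sum>i<n. \<Sum>j<n. (B i j - (\<Sum>l<k. u l i * v l j))\<^sup>2)"
    unfolding row \<beta>_def sum_subtractf[symmetric]
  proof (rule sum_mono)
    fix i
    have "reproduces n k w (\<lambda>c. \<Sum>l<k. u l i * v l c)"
      by (rule reproduces_sum) (use gs in \<open>auto simp: gs_inv_def\<close>)
    then show "dot n (B i) (B i) - (\<Sum>l<k. (dot n (B i) (w l))\<^sup>2)
        \<le> dot n (\<lambda>j. B i j - (\<Sum>l<k. u l i * v l j)) (\<lambda>j. B i j - (\<Sum>l<k. u l i * v l j))"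
      by (rule reproduces_residual_ge)
  qed
  have quad_sq: "quad n S M x x = (\<Sum>a<S. (dot n (M a) x)\<^sup>2)" for x
    by (simp add: quad_def power2_eq_square)
  have close: "\<bar>quad n S M x x - (\<Sum>i<n. (dot n (B i) x)\<^sup>2)\<bar> \<le> \<rho>" if "dot n x x \<le> 1" for x
    unfolding quad_sq by (rule quad_diff_le[OF _ that \<rho>0]) (use sketch in \<open>simp add: \<rho>_def\<close>)
  have quad_F: "quad n S M (F i) (F i) \<le> 2 * \<beta>" if "i < S" for i
  proof -
    have 1: "dot n (F i) (F i) \<le> 1" by (rule contractive_norm_le_1[OF frame(1) that])
    have "(\<Sum>j<n. (dot n (B j) (F i))\<^sup>2) \<le> \<beta>" unfolding \<beta>_def by (rule dot_sum_squares_le[OF 1])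
    then show ?thesis using close[OF 1] \<rho>\<beta> by linarith
  qed
  show ?thesis
  proof (cases "\<beta> = 0")
    \<comment> \<open>With \<beta> = 0 the tolerance is 0 too, and counting sweeps proves nothing;
      but then the left side is 0 already.\<close>
    case True
    have "(\<Sum>i<n. \<Sum>j<n. (B i j - (\<Sum>l<k. U i l * F l j))\<^sup>2) \<le> 0"
    proof -
      have "0 \<le> (\<Sum>i<n. \<Sum>l<k. (dot n (B i) (F l))\<^sup>2)" by (intro sum_nonneg) auto
      then show ?thesis using lhs U True by simp
    qed
    also have "0 \<le> (\<Sum>i<n. \<Sum>j<n. (B i j - (\<Sum>l<k. u l i * v l j))\<^sup>2) + \<epsilon> * \<beta>"
      using True by (simp add: sum_nonneg)
    finally show ?thesis .
  next
    case False
    then have \<beta>pos: "\<beta> > 0" using \<beta>0 by simp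
    \<comment> \<open>The potential is at most S^2 times 2 \<beta>. Dividing by \<theta> gives 2 S^2
      (16 S^2)^2 / \<epsilon>^2 = 512 S^6 / \<epsilon>^2 sweeps, and 513 makes the contradiction
      strict.\<close>
    have settled: "jacobi_settled n S M \<theta> F"
    proof (rule ccontr)
      assume "\<not> jacobi_settled n S M \<theta> F"
      then have "real K * \<theta> \<le> jacobi_potential n S M F" using F by (auto simp: sweep_start_def)
      also have "\<dots> \<le> (\<Sum>l<S. real S * (2 * \<beta>))"
        unfolding jacobi_potential_def
        by (intro sum_mono mult_mono) (use quad_F quad_self_nonneg in auto)
      also have "\<dots> = 2 * (real S)\<^sup>2 * \<beta>" by (simp add: power2_eq_square)
      finally have "real K * \<zeta>\<^sup>2 \<le> 2 * (real S)\<^sup>2"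
        using \<beta>pos by (simp add: \<theta> mult.assoc[symmetric])
      then have "real K * \<epsilon>\<^sup>2 / (16 * (real S)\<^sup>2)\<^sup>2 \<le> 2 * (real S)\<^sup>2"
        by (simp only: \<zeta>_def power_divide times_divide_eq_right)
      moreover have "(16 * (real S)\<^sup>2)\<^sup>2 > 0" using S1 by simp
      ultimately have "real K * \<epsilon>\<^sup>2 \<le> 2 * (real S)\<^sup>2 * (16 * (real S)\<^sup>2)\<^sup>2"
        by (simp only: pos_divide_le_eq)
      also have "\<dots> = 512 * real S ^ 6" by (simp add: power_mult_distrib flip: power_mult power_add)
      also have "\<dots> < 513 * real S ^ 6" using S1 by simp
      finally show False using K by simp
    qed
    \<comment> \<open>Since the diagonal is at most 2 \<beta> and \<theta> <= \<beta>, an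
      off-diagonal entry has square at most 4 \<theta> \<beta>, which is \<gamma>^2. The 16 S^2 in
      \<zeta> makes S^2 \<gamma> equal to \<epsilon> \<beta> / 8.\<close>
    define \<gamma> where "\<gamma> = 2 * \<zeta> * \<beta>"
    have opt: "(\<Sum>l<k. quad n S M (w l) (w l)) \<le> (\<Sum>i<k. quad n S M (F i) (F i)) + 2 * real k * \<theta> + (real S)\<^sup>2 * \<gamma>"
    proof (rule settled_near_optimal[OF settled frame w k \<theta>0])
      show "\<gamma> \<ge> 0" using \<zeta>0 \<beta>0 by (simp add: \<gamma>_def)
      fix i assume i: "i < S"
      have "\<zeta>\<^sup>2 * \<beta> \<le> 1 * \<beta>" using \<beta>0 \<zeta>0 \<zeta>1 by (intro mult_right_mono) (auto simp: power_le_one)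
      then have "\<theta> * (quad n S M (F i) (F i) + \<theta>) \<le> \<theta> * (4 * \<beta>)"
        using quad_F[OF i] \<theta>0 \<beta>0 by (intro mult_left_mono) (auto simp: \<theta>)
      also have "\<dots> = \<gamma>\<^sup>2" by (simp add: \<theta> \<gamma>_def power2_eq_square)
      finally show "\<theta> * (quad n S M (F i) (F i) + \<theta>) \<le> \<gamma>\<^sup>2" .
    qed
    have small1: "(real S)\<^sup>2 * \<gamma> = \<epsilon> / 8 * \<beta>" using S1 by (simp add: \<gamma>_def \<zeta>_def)
    have small2: "2 * real k * \<theta> \<le> \<epsilon> / 8 * \<beta>"
    proof -
      have "\<zeta> \<le> \<epsilon> / 16" unfolding \<zeta>_def by (rule divide_left_mono) (use eps S1 S2 in auto)
      have "real k * \<zeta> \<le> real S * \<zeta>" using kS \<zeta>0 by simp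
      also have "\<dots> \<le> 1"
      proof -
        have "real S * \<epsilon> \<le> real S * real S * 1" using S1 eps by (intro mult_mono) auto
        then show ?thesis using S1 by (simp add: \<zeta>_def power2_eq_square field_simps)
      qed
      finally have "2 * (real k * \<zeta>) * \<zeta> \<le> 2 * 1 * (\<epsilon> / 16)"
        using \<open>\<zeta> \<le> \<epsilon> / 16\<close> \<zeta>0 k1 by (intro mult_mono) auto
      then have "2 * real k * \<zeta>\<^sup>2 \<le> \<epsilon> / 8" by (simp add: power2_eq_square mult.assoc)
      from mult_right_mono[OF this \<beta>0] show ?thesis by (simp add: \<theta>)
    qed
    have w_close: "(\<Sum>i<n. \<Sum>l<k. (dot n (B i) (w l))\<^sup>2) \<le> (\<Sum>l<k. quad n S M (w l) (w l)) + real k * \<rho>"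
    proof -
      have "(\<Sum>l<k. \<Sum>i<n. (dot n (B i) (w l))\<^sup>2) \<le> (\<Sum>l<k. quad n S M (w l) (w l) + \<rho>)"
      proof (rule sum_mono)
        fix l assume "l \<in> {..<k}"
        then have "dot n (w l) (w l) \<le> 1" using contractive_norm_le_1[OF w] by simp
        from close[OF this] show "(\<Sum>i<n. (dot n (B i) (w l))\<^sup>2) \<le> quad n S M (w l) (w l) + \<rho>" by linarith
      qed
      then show ?thesis by (subst sum.swap) (simp add: sum.distrib)
    qed
    have F_close: "(\<Sum>l<k. quad n S M (F l) (F l)) \<le> (\<Sum>i<n. \<Sum>l<k. (dot n (B i) (F l))\<^sup>2) + real k * \<rho>"
    proof -
      have "(\<Sum>l<k. quad n S M (F l) (F l)) \<le> (\<Sum>l<k. (\<Sum>i<n. (dot n (B i) (F l))\<^sup>2) + \<rho>)"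
      proof (rule sum_mono)
        fix l assume "l \<in> {..<k}"
        then have "dot n (F l) (F l) \<le> 1" using contractive_norm_le_1[OF Fk] by simp
        from close[OF this] show "quad n S M (F l) (F l) \<le> (\<Sum>i<n. (dot n (B i) (F l))\<^sup>2) + \<rho>" by linarith
      qed
      then show ?thesis by (subst sum.swap) (simp add: sum.distrib)
    qed
    have k\<rho>: "real k * \<rho> = \<epsilon> / 8 * \<beta>" using k1 by (simp add: \<rho>_def)
    have "\<epsilon> * \<beta> \<ge> 0" using eps \<beta>0 by simp
    then show ?thesis using lhs rhs U opt small1 small2 w_close F_close k\<rho> by simp
  qed
qed

section \<open>Reading the input\<close>

lemma ram_input_simps:
  fixes n k :: nat and \<epsilon> :: real and A W :: "real mat" and es :: "(nat \<times> nat) list"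
  defines "inp \<equiv> ram_input n k \<epsilon> A es W"
  shows "nats inp ''n'' 0 0 = n" "nats inp ''rank'' 0 0 = k" "nats inp ''nnz'' 0 0 = length es"
    "e < length es \<Longrightarrow> nats inp ''row'' e 0 = fst (es ! e)" "e < length es \<Longrightarrow> nats inp ''col'' e 0 = snd (es ! e)"
    "e < length es \<Longrightarrow> reals inp ''val'' e 0 = A $$ (es ! e)"
    "i < n \<Longrightarrow> j < n \<Longrightarrow> nats inp ''W'' i j = of_bool (W $$ (i, j) = 1)"
    "nats inp ''s'' = (\<lambda>_ _. 0)" "nats inp ''K'' = (\<lambda>_ _. 0)" "nats inp ''r'' = (\<lambda>_ _. 0)"
    "reals inp ''eps'' 0 0 = \<epsilon>" "reals inp ''M'' = (\<lambda>_ _. 0)" "reals inp ''C'' = (\<lambda>_ _. 0)"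
    "reals inp ''beta'' = (\<lambda>_ _. 0)" "reals inp ''Z'' = (\<lambda>_ _. 0)"
  by (simp_all add: inp_def ram_input_def)

text \<open>The summand vanishes where \<open>A\<close> does, so the order of the list and the
  absent positions do not matter.\<close>

lemma sum_nonzeros:
  assumes es: "lists_nonzeros A es" and A: "A \<in> carrier_mat n n"
    and zero: "\<And>i j. A $$ (i, j) = 0 \<Longrightarrow> \<phi> (i, j) = 0"
  shows "(\<Sum>e<length es. \<phi> (es ! e)) = (\<Sum>i<n. \<Sum>j<n. \<phi> (i, j) :: real)"
proof -
  have "(\<Sum>e<length es. \<phi> (es ! e)) = sum_list (map \<phi> es)"
    by (simp add: sum_list_sum_nth atLeast0LessThan)
  also have "\<dots> = sum \<phi> (nz_positions A)"
    using es by (simp add: lists_nonzeros_def sum_list_distinct_conv_sum_set)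
  also have "\<dots> = sum \<phi> ({..<n} \<times> {..<n})"
    by (rule sum.mono_neutral_left) (use A zero in \<open>auto simp: nz_positions_def\<close>)
  finally show ?thesis by (simp add: sum.cartesian_product)
qed

lemma nonzero_in_range:
  assumes "lists_nonzeros A es" "A \<in> carrier_mat n n" "e < length es"
  shows "fst (es ! e) < n \<and> snd (es ! e) < n"
proof -
  have "es ! e \<in> nz_positions A" using nth_mem[OF assms(3)] assms(1) unfolding lists_nonzeros_def by simp
  then show ?thesis using assms(2) by (cases "es ! e") (simp add: nz_positions_def)
qed

definition masked :: "nat \<Rightarrow> real mat \<Rightarrow> real mat \<Rightarrow> nat \<Rightarrow> nat \<Rightarrow> real" where
  "masked n A W i j = (if i < n \<and> j < n then W $$ (i, j) * A $$ (i, j) else 0)"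

lemma masked_eq:
  assumes "binary_mat n W" "i < n" "j < n"
  shows "masked n A W i j = (if W $$ (i, j) = 1 then A $$ (i, j) else 0)"
proof -
  have "W $$ (i, j) = 0 \<or> W $$ (i, j) = 1" using assms by (auto simp: binary_mat_def)
  then show ?thesis using assms by (auto simp: masked_def)
qed

lemma sum_masked_col:
  assumes W: "binary_mat n W"
  shows "(\<Sum>i<n. \<Sum>j<n. if W $$ (i, j) = 1 \<and> g i = v \<and> j = c then A $$ (i, j) else 0)
    = (\<Sum>i<n. of_bool (g i = v) * masked n A W i c)"
proof (rule sum.cong[OF refl])
  fix i assume i: "i \<in> {..<n}"
  have "(\<Sum>j<n. if W $$ (i, j) = 1 \<and> g i = v \<and> j = c then A $$ (i, j) else 0)
    = (\<Sum>j<n. if j = c then of_bool (g i = v) * masked n A W i j else 0)"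
    by (rule sum.cong[OF refl]) (use i in \<open>auto simp: masked_eq[OF W]\<close>)
  also have "\<dots> = of_bool (g i = v) * masked n A W i c"
    by (cases "c < n") (auto simp: masked_def)
  finally show "(\<Sum>j<n. if W $$ (i, j) = 1 \<and> g i = v \<and> j = c then A $$ (i, j) else 0) = \<dots>" .
qed

lemma sum_masked_row:
  assumes W: "binary_mat n W"
  shows "(\<Sum>i'<n. \<Sum>j<n. if W $$ (i', j) = 1 \<and> i' = i \<and> h j = v then A $$ (i', j) else 0)
    = (\<Sum>j<n. of_bool (h j = v) * masked n A W i j)"
proof -
  have "(\<Sum>i'<n. \<Sum>j<n. if W $$ (i', j) = 1 \<and> i' = i \<and> h j = v then A $$ (i', j) else 0)
    = (\<Sum>j<n. \<Sum>i'<n. if i' = i then of_bool (h j = v) * masked n A W i' j else 0)"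
    by (subst sum.swap, intro sum.cong refl) (auto simp: masked_eq[OF W])
  also have "\<dots> = (\<Sum>j<n. of_bool (h j = v) * masked n A W i j)"
    by (rule sum.cong[OF refl]) (cases "i < n"; auto simp: masked_def)
  finally show ?thesis .
qed

lemma sketch_eq_diff:
  "(\<Sum>i<n. of_bool (g i = a) * x i) - (\<Sum>i<n. of_bool (g i = S + a) * x i) = sketch S n g x a"
  by (simp add: sketch_def bucket_def left_diff_distrib sum_subtractf)

definition frob_sq :: "nat \<Rightarrow> (nat \<Rightarrow> nat \<Rightarrow> real) \<Rightarrow> real" where
  "frob_sq n B = (\<Sum>i<n. dot n (B i) (B i))"

section \<open>The two phases of the algorithm\<close>

abbreviation row_exp :: nexp where "row_exp \<equiv> NCell ''row'' (Nv ''e'') (NConst 0)"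
abbreviation col_exp :: nexp where "col_exp \<equiv> NCell ''col'' (Nv ''e'') (NConst 0)"
abbreviation val_exp :: rexp where "val_exp \<equiv> RCell ''val'' (Nv ''e'') (NConst 0)"
abbreviation s_exp :: rexp where "s_exp \<equiv> ROfNat (Nv ''s'')"

definition theta_com :: com where
  "theta_com = (let z = RDiv (Rv ''eps'') (RMul (ROfNat (NConst 16)) (RMul s_exp s_exp)) in
     set_r ''theta'' (RMul (RMul z z) (Rv ''beta'')))"

definition phase1_com :: com where
  "phase1_com = Seq (read_com ''M'' (NCell ''g'' row_exp (NConst 0)) col_exp val_exp)
     (Seq (read_com ''beta'' (NConst 0) (NConst 0) (RMul val_exp val_exp))
     (Seq gs_com (Seq theta_com jacobi_com)))"

definition phase2_com :: com where
  "phase2_com = Seq (read_com ''C'' row_exp (NCell ''h'' col_exp (NConst 0)) val_exp) output_com"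

definition phase1_time :: "nat \<Rightarrow> nat \<Rightarrow> nat \<Rightarrow> nat \<Rightarrow> nat" where
  "phase1_time N n S K = 10 * N + S * (S * (8 * n + 12) + 12 * n + 20)
     + K * (S * (S * (S * (8 * n + 20) + n * 10 + 24) + 6) + 6) + 20"

text \<open>The set \<open>X2\<close> names everything written so far; all other arrays still hold
  the input or 0, on which the second phase relies. The sketch acts on the columns of
  \<open>B\<close>, that is, it hashes row indices.\<close>

lemma runs_phase1:
  fixes s :: ram_state and n k :: nat and \<epsilon> :: real and A W :: "real mat" and es :: "(nat \<times> nat) list"
  defines "X1 \<equiv> {''s'', ''K'', ''i'', ''g''}"
  defines "X2 \<equiv> {''s'', ''K'', ''i'', ''g'', ''e'', ''M'', ''beta'', ''j'', ''c'', ''q'', ''F'', ''theta'', ''t'', ''a'', ''y'', ''z'', ''A'', ''B'', ''D'', ''E''}"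
  defines "B \<equiv> masked n A W"
  assumes A: "A \<in> carrier_mat n n" and W: "binary_mat n W" and es: "lists_nonzeros A es"
    and ag: "agree X1 (ram_input n k \<epsilon> A es W) s"
    and S: "nats s ''s'' 0 0 = S" and K: "nats s ''K'' 0 0 = K" and g: "\<And>i. i < n \<Longrightarrow> nats s ''g'' i 0 = g i"
  shows "\<exists>s'. runs phase1_com (phase1_time (length es) n S K) s s' \<and> agree X2 (ram_input n k \<epsilon> A es W) s' \<and>
    nats s' ''s'' 0 0 = S \<and>
    sweep_start n S (\<lambda>a c. sketch S n g (\<lambda>i. B i c) a) ((\<epsilon> / (16 * (real S)\<^sup>2))\<^sup>2 * frob_sq n B) K (reals s' ''F'')"
proof -
  let ?inp = "ram_input n k \<epsilon> A es W"
  note inp = ram_input_simps[where n=n and k=k and \<epsilon>=\<epsilon> and A=A and es=es and W=W]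
  have pos: "fst (es ! e) < n" "snd (es ! e) < n" if "e < length es" for e
    using nonzero_in_range[OF es A that] by auto
  have st: "nats s ''n'' 0 0 = n" "nats s ''nnz'' 0 0 = length es" "reals s ''eps'' 0 0 = \<epsilon>"
    "\<And>e. e < length es \<Longrightarrow> nats s ''row'' e 0 = fst (es ! e)"
    "\<And>e. e < length es \<Longrightarrow> nats s ''col'' e 0 = snd (es ! e)"
    "\<And>e. e < length es \<Longrightarrow> reals s ''val'' e 0 = A $$ (es ! e)"
    "\<And>i j. i < n \<Longrightarrow> j < n \<Longrightarrow> nats s ''W'' i j = of_bool (W $$ (i, j) = 1)"
    "reals s ''M'' = (\<lambda>_ _. 0)" "reals s ''beta'' = (\<lambda>_ _. 0)"
    using ag inp by (simp_all add: agree_D X1_def)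
  define M where "M = (\<lambda>v c. \<Sum>e<length es. if W $$ (es ! e) = 1 \<and> g (fst (es ! e)) = v \<and> snd (es ! e) = c then A $$ (es ! e) else 0)"
  define s1 where "s1 = set_nat ''e'' (length es) (set_reals ''M'' M s)"
  have r1: "runs (read_com ''M'' (NCell ''g'' row_exp (NConst 0)) col_exp val_exp) (length es * 5 + 3) s s1"
  proof -
    have "runs (read_com ''M'' (NCell ''g'' row_exp (NConst 0)) col_exp val_exp) (length es * 5 + 3) s
      (set_nat ''e'' (length es) (set_reals ''M'' (\<lambda>i j. reals s ''M'' i j + (\<Sum>e<length es.
        if W $$ (es ! e) = 1 \<and> g (fst (es ! e)) = i \<and> snd (es ! e) = j then A $$ (es ! e) else 0)) s))"
      by (rule runs_read) (use st pos g in auto)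
    then show ?thesis by (simp add: s1_def M_def st)
  qed
  define b where "b = (\<Sum>e<length es. if W $$ (es ! e) = 1 then A $$ (es ! e) * A $$ (es ! e) else 0)"
  define s2 where "s2 = set_nat ''e'' (length es) (set_reals ''beta'' (\<lambda>i j. if i = 0 \<and> j = 0 then b else 0) s1)"
  have r2: "runs (read_com ''beta'' (NConst 0) (NConst 0) (RMul val_exp val_exp)) (length es * 5 + 3) s1 s2"
  proof -
    have "runs (read_com ''beta'' (NConst 0) (NConst 0) (RMul val_exp val_exp)) (length es * 5 + 3) s1
      (set_nat ''e'' (length es) (set_reals ''beta'' (\<lambda>i j. reals s1 ''beta'' i j + (\<Sum>e<length es.
        if W $$ (es ! e) = 1 \<and> 0 = i \<and> 0 = j then A $$ (es ! e) * A $$ (es ! e) else 0)) s1))"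
      by (rule runs_read) (use st pos in \<open>auto simp: s1_def\<close>)
    moreover have "(\<lambda>i j. reals s1 ''beta'' i j + (\<Sum>e<length es.
        if W $$ (es ! e) = 1 \<and> 0 = i \<and> 0 = j then A $$ (es ! e) * A $$ (es ! e) else 0)) = (\<lambda>i j. if i = 0 \<and> j = 0 then b else 0)"
      by (intro ext) (auto simp: s1_def st b_def)
    ultimately show ?thesis by (simp add: s2_def)
  qed
  have signed_M: "signed S M = (\<lambda>a c. sketch S n g (\<lambda>i. B i c) a)"
  proof (intro ext)
    fix a c
    have "M v c = (\<Sum>i<n. of_bool (g i = v) * B i c)" for v
    proof -
      have "M v c = (\<Sum>i<n. \<Sum>j<n. if W $$ (i, j) = 1 \<and> g i = v \<and> j = c then A $$ (i, j) else 0)"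
        unfolding M_def
        by (subst sum_nonzeros[OF es A, of "\<lambda>p. if W $$ p = 1 \<and> g (fst p) = v \<and> snd p = c then A $$ p else 0"]) auto
      then show ?thesis unfolding B_def sum_masked_col[OF W] .
    qed
    then show "signed S M a c = sketch S n g (\<lambda>i. B i c) a"
      by (simp only: signed_def sketch_eq_diff)
  qed
  have b: "b = frob_sq n B"
  proof -
    have "b = (\<Sum>i<n. \<Sum>j<n. if W $$ (i, j) = 1 then A $$ (i, j) * A $$ (i, j) else 0)"
      unfolding b_def by (subst sum_nonzeros[OF es A, of "\<lambda>p. if W $$ p = 1 then A $$ p * A $$ p else 0"]) auto
    also have "\<dots> = (\<Sum>i<n. \<Sum>j<n. B i j * B i j)"
      unfolding B_def
      by (intro sum.cong refl) (auto simp: masked_eq[OF W])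
    finally show ?thesis by (simp add: frob_sq_def dot_def)
  qed
  have st2: "nats s2 ''n'' 0 0 = n" "nats s2 ''s'' 0 0 = S" "reals s2 ''M'' = M"
    using st S by (simp_all add: s2_def s1_def)
  obtain s3 where r3: "runs gs_com (S * (S * (8 * n + 12) + 12 * n + 20) + 3) s2 s3"
    and ag3: "agree {''i'', ''j'', ''c'', ''q'', ''F''} s2 s3" and gs: "gs_inv n S (signed S M) (reals s3 ''F'')"
    using runs_gs[of s2 n S] st2 by auto
  have st3: "nats s3 ''n'' 0 0 = n" "nats s3 ''s'' 0 0 = S" "nats s3 ''K'' 0 0 = K" "reals s3 ''M'' = M" "reals s3 ''eps'' 0 0 = \<epsilon>"
    "reals s3 ''beta'' 0 0 = b"
    using ag3 st2 st K by (simp_all add: agree_D s2_def s1_def)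
  define \<theta> where "\<theta> = (\<epsilon> / (16 * (real S)\<^sup>2))\<^sup>2 * frob_sq n B"
  have \<theta>: "\<theta> \<ge> 0" by (simp add: \<theta>_def frob_sq_def sum_nonneg dot_self_nonneg)
  define s4 where "s4 = set_real ''theta'' \<theta> s3"
  have r4: "runs theta_com 1 s3 s4"
  proof -
    define z where "z = RDiv (Rv ''eps'') (RMul (ROfNat (NConst 16)) (RMul s_exp s_exp))"
    have "rval (RMul (RMul z z) (Rv ''beta'')) s3 = \<theta>"
      by (simp add: z_def st3 \<theta>_def b power2_eq_square)
    then show ?thesis
      using runs_set_r[of "''theta''" "RMul (RMul z z) (Rv ''beta'')" s3]
      by (simp only: theta_com_def Let_def s4_def z_def)
  qed
  have start: "sweep_start n S (signed S M) \<theta> 0 (reals s4 ''F'')"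
  proof -
    have "0 \<le> jacobi_potential n S (signed S M) (reals s3 ''F'')"
      unfolding jacobi_potential_def by (intro sum_nonneg mult_nonneg_nonneg quad_self_nonneg) auto
    then show ?thesis using gs gs_inv_contractive[OF gs]
      by (auto simp: sweep_start_def jacobi_frame_def s4_def gs_inv_def)
  qed
  have st4: "nats s4 ''n'' 0 0 = n" "nats s4 ''s'' 0 0 = S" "nats s4 ''K'' 0 0 = K" "reals s4 ''M'' = M" "reals s4 ''theta'' 0 0 = \<theta>"
    using st3 by (simp_all add: s4_def)
  let ?XJ = "{''t'', ''i'', ''j'', ''a'', ''c'', ''y'', ''z'', ''A'', ''B'', ''D'', ''E'', ''q'', ''F''}"
  obtain s5 where r5: "runs jacobi_com (K * (S * (S * (S * (8 * n + 20) + n * 10 + 24) + 6) + 6) + 3) s4 s5"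
    and ag5: "agree ?XJ s4 s5" and F5: "sweep_start n S (signed S M) \<theta> K (reals s5 ''F'')"
    using runs_jacobi[OF st4(1-3)] st4 \<theta> start by auto
  have run: "runs phase1_com (phase1_time (length es) n S K) s s5"
    unfolding phase1_com_def phase1_time_def
    by (rule runs_mono[OF runs_Seq[OF r1 runs_Seq[OF r2 runs_Seq[OF r3 runs_Seq[OF r4 r5]]]]]) simp
  have "agree X2 ?inp s"
    using ag by (auto simp: agree_def X1_def X2_def)
  then have "agree X2 ?inp s2" by (simp add: s2_def s1_def X2_def)
  from agree_trans[OF this ag3, of X2] have "agree X2 ?inp s3" by (simp add: X2_def)
  then have "agree X2 ?inp s4" by (simp add: s4_def X2_def)
  from agree_trans[OF this ag5, of X2] have ag5': "agree X2 ?inp s5" by (simp add: X2_def)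
  have "nats s5 ''s'' 0 0 = S" using ag5 st4 by (simp add: agree_D)
  then show ?thesis using run ag5' F5 unfolding signed_M \<theta>_def by blast
qed

definition phase2_time :: "nat \<Rightarrow> nat \<Rightarrow> nat \<Rightarrow> nat \<Rightarrow> nat" where
  "phase2_time N n S k = 5 * N + k * (n * (4 * S + 16) + 10) + 10"

text \<open>Here column indices are hashed: rows of \<open>B\<close> and frame vectors are sketched
  by the same \<open>h\<close>, so inner products of sketches estimate the coefficients of
  \<open>B\<close> in the frame.\<close>

lemma runs_phase2:
  fixes s :: ram_state and n k :: nat and \<epsilon> :: real and A W :: "real mat" and es :: "(nat \<times> nat) list"
  defines "X2 \<equiv> {''s'', ''K'', ''i'', ''g'', ''e'', ''M'', ''beta'', ''j'', ''c'', ''q'', ''F'', ''theta'', ''t'', ''a'', ''y'', ''z'', ''A'', ''B'', ''D'', ''E'', ''h''}"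
  defines "B \<equiv> masked n A W" and "F \<equiv> reals s ''F''"
  assumes A: "A \<in> carrier_mat n n" and W: "binary_mat n W" and es: "lists_nonzeros A es"
    and ag: "agree X2 (ram_input n k \<epsilon> A es W) s"
    and S: "nats s ''s'' 0 0 = S" and h: "\<And>i. i < n \<Longrightarrow> nats s ''h'' i 0 = h i"
  shows "\<exists>s'. runs phase2_com (phase2_time (length es) n S k) s s' \<and> nats s' ''r'' 0 0 = k \<and>
    (\<forall>i<n. \<forall>l<k. reals s' ''V'' i l = F l i \<and>
      reals s' ''U'' i l = (\<Sum>b<S. sketch S n h (B i) b * sketch S n h (F l) b))"
proof -
  note inp = ram_input_simps[where n=n and k=k and \<epsilon>=\<epsilon> and A=A and es=es and W=W]
  have pos: "fst (es ! e) < n" "snd (es ! e) < n" if "e < length es" for e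
    using nonzero_in_range[OF es A that] by auto
  have st: "nats s ''n'' 0 0 = n" "nats s ''nnz'' 0 0 = length es" "nats s ''rank'' 0 0 = k"
    "\<And>e. e < length es \<Longrightarrow> nats s ''row'' e 0 = fst (es ! e)"
    "\<And>e. e < length es \<Longrightarrow> nats s ''col'' e 0 = snd (es ! e)"
    "\<And>e. e < length es \<Longrightarrow> reals s ''val'' e 0 = A $$ (es ! e)"
    "\<And>i j. i < n \<Longrightarrow> j < n \<Longrightarrow> nats s ''W'' i j = of_bool (W $$ (i, j) = 1)"
    "reals s ''C'' = (\<lambda>_ _. 0)" "reals s ''Z'' = (\<lambda>_ _. 0)"
    using ag inp by (simp_all add: agree_D X2_def)
  define C where "C = (\<lambda>i v. \<Sum>e<length es. if W $$ (es ! e) = 1 \<and> fst (es ! e) = i \<and> h (snd (es ! e)) = v then A $$ (es ! e) else 0)"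
  define s1 where "s1 = set_nat ''e'' (length es) (set_reals ''C'' C s)"
  have r1: "runs (read_com ''C'' row_exp (NCell ''h'' col_exp (NConst 0)) val_exp) (length es * 5 + 3) s s1"
  proof -
    have "runs (read_com ''C'' row_exp (NCell ''h'' col_exp (NConst 0)) val_exp) (length es * 5 + 3) s
      (set_nat ''e'' (length es) (set_reals ''C'' (\<lambda>i j. reals s ''C'' i j + (\<Sum>e<length es.
        if W $$ (es ! e) = 1 \<and> fst (es ! e) = i \<and> h (snd (es ! e)) = j then A $$ (es ! e) else 0)) s))"
      by (rule runs_read) (use st pos h in auto)
    then show ?thesis by (simp add: s1_def C_def st)
  qed
  have C: "C i b - C i (S + b) = sketch S n h (B i) b" for i b
  proof -
    have "C i v = (\<Sum>j<n. of_bool (h j = v) * B i j)" for v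
    proof -
      have "C i v = (\<Sum>i'<n. \<Sum>j<n. if W $$ (i', j) = 1 \<and> i' = i \<and> h j = v then A $$ (i', j) else 0)"
        unfolding C_def
        by (subst sum_nonzeros[OF es A, of "\<lambda>p. if W $$ p = 1 \<and> fst p = i \<and> h (snd p) = v then A $$ p else 0"]) auto
      then show ?thesis unfolding B_def sum_masked_row[OF W] .
    qed
    then show ?thesis by (simp only: sketch_eq_diff)
  qed
  have st1: "nats s1 ''n'' 0 0 = n" "nats s1 ''s'' 0 0 = S" "nats s1 ''rank'' 0 0 = k" "\<And>v l. reals s1 ''Z'' v l = 0"
    "reals s1 ''F'' = F" "reals s1 ''C'' = C" "nats s1 ''h'' = nats s ''h''"
    using st S by (simp_all add: s1_def F_def)
  define z where "z = (\<lambda>l v. \<Sum>j<n. of_bool (nats s ''h'' j 0 = v) * F l j)"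
  have z: "z l b - z l (S + b) = sketch S n h (F l) b" for l b
    unfolding sketch_eq_diff[symmetric] z_def using h by simp
  obtain s2 where r2: "runs output_com (k * (n * (4 * S + 16) + 10) + 5) s1 s2" and "nats s2 ''r'' 0 0 = k"
    and "\<forall>i<n. \<forall>l<k. reals s2 ''V'' i l = F l i \<and> reals s2 ''U'' i l = (\<Sum>b<S. (C i b - C i (S + b)) * (z l b - z l (S + b)))"
    using runs_output[OF st1(1-4)] unfolding st1 z_def by blast
  moreover have "runs phase2_com (phase2_time (length es) n S k) s s2"
    unfolding phase2_com_def phase2_time_def by (rule runs_mono[OF runs_Seq[OF r1 r2]]) simp
  ultimately show ?thesis unfolding C z by blast
qed

section \<open>Halting distributions\<close>

text \<open>Demanding the same distribution at all later times allows random branches that stop at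
  different times to be averaged, as long as they share the bound \<open>T\<close>.\<close>

definition halts :: "nat \<Rightarrow> config \<Rightarrow> ram_state pmf \<Rightarrow> bool" where
  "halts T c p \<longleftrightarrow> (\<forall>T'\<ge>T. ram_run T' c = map_pmf (Pair []) p)"

lemma halts_Nil: "halts 0 ([], s) (return_pmf s)"
  by (simp add: halts_def ram_run_halted)

lemma halts_runs:
  assumes "runs c t s s'" "halts T (K, s') p" shows "halts (t + T) (c # K, s) p"
  unfolding halts_def
proof (intro allI impI)
  fix T' assume T': "t + T \<le> T'"
  obtain t' where t': "t' \<le> t" "ram_run t' (c # K, s) = return_pmf (K, s')"
    using assms(1) unfolding runs_def by blast
  have "ram_run T' (c # K, s) = ram_run (t' + (T' - t')) (c # K, s)" using t' T' by simp
  also have "\<dots> = ram_run (T' - t') (K, s')" by (simp only: ram_run_add t'(2) bind_return_pmf)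
  also have "\<dots> = map_pmf (Pair []) p" using assms(2) t'(1) T' unfolding halts_def by simp
  finally show "ram_run T' (c # K, s) = map_pmf (Pair []) p" .
qed

lemma halts_step:
  assumes "ram_step (c # K, s) = return_pmf (K', s)" "halts T (K', s) p" shows "halts (Suc T) (c # K, s) p"
  unfolding halts_def
proof (intro allI impI)
  fix T' assume "Suc T \<le> T'"
  then obtain T'' where "T' = Suc T''" "T \<le> T''" by (cases T') auto
  then show "ram_run T' (c # K, s) = map_pmf (Pair []) p"
    using assms by (simp add: halts_def bind_return_pmf)
qed

lemma halts_Seq: "halts T (c1 # c2 # K, s) p \<Longrightarrow> halts (Suc T) (Seq c1 c2 # K, s) p"
  by (rule halts_step) auto

lemma halts_If: "halts T ((if bval b s then c1 else c2) # K, s) p \<Longrightarrow> halts (Suc T) (com.If b c1 c2 # K, s) p"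
  by (rule halts_step) auto

lemma halts_draw:
  assumes n: "nats s ''n'' 0 0 = n" and S: "nats s ''s'' 0 0 = S" and a: "a \<notin> {''n'', ''s'', ''i''}"
    and cont: "\<And>g. halts T (K, store_hash a n g s) (p g)"
  shows "halts (4 * n + 3 + T) (draw_com a # K, s) (bind_pmf (hashes (2 * S - 1) n) p)"
  unfolding halts_def
proof (intro allI impI)
  fix T' assume T': "4 * n + 3 + T \<le> T'"
  have "ram_run T' (draw_com a # K, s) = ram_run ((4 * n + 3) + (T' - (4 * n + 3))) (draw_com a # K, s)"
    using T' by simp
  also have "\<dots> = bind_pmf (hashes (2 * S - 1) n) (\<lambda>g. ram_run (T' - (4 * n + 3)) (K, store_hash a n g s))"
    by (simp only: ram_run_add[of "4 * n + 3"] run_draw[OF n S a] bind_map_pmf)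
  also have "\<dots> = bind_pmf (hashes (2 * S - 1) n) (\<lambda>g. map_pmf (Pair []) (p g))"
    by (rule bind_pmf_cong[OF refl]) (use cont T' in \<open>simp add: halts_def\<close>)
  finally show "ram_run T' (draw_com a # K, s) = map_pmf (Pair []) (bind_pmf (hashes (2 * S - 1) n) p)"
    by (simp only: map_bind_pmf)
qed

section \<open>The program\<close>

definition eps2_exp :: rexp where "eps2_exp = RMul (Rv ''eps'') (Rv ''eps'')"

text \<open>The sketch size is S = 256 D k'^2 / \<epsilon>^2, rounded up. By Markov's inequality the
  Gram error needs 2 / S <= q (\<epsilon> / (8 k'))^2 with failure probability q = 1 / (2
  D).\<close>

definition size_exp :: "nat \<Rightarrow> rexp" where
  "size_exp D = RMul (ROfNat (NConst (256 * D))) (RMul (ROfNat (Nv ''rank'')) (ROfNat (Nv ''rank'')))"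

text \<open>The sixth power of S comes from the potential argument in
  \<open>sketched_svd_error\<close>.\<close>

definition sweeps_exp :: rexp where
  "sweeps_exp = RMul (ROfNat (NConst 513)) (RMul (RMul s_exp (RMul s_exp s_exp)) (RMul s_exp (RMul s_exp s_exp)))"

text \<open>The second hash function is drawn only after the frame has been computed, so that it is
  independent of the frame.\<close>
definition main_com :: "nat \<Rightarrow> com" where
  "main_com D = Seq (count_com ''s'' eps2_exp (size_exp D)) (Seq (count_com ''K'' eps2_exp sweeps_exp)
     (Seq (draw_com ''g'') (Seq phase1_com (Seq (draw_com ''h'') phase2_com))))"

text \<open>If \<open>2 * \<epsilon> \<ge> 1\<close> then the zero matrix is good enough; \<open>poly (k' / \<epsilon>)\<close> would not even pay for
  writing \<open>k'\<close> columns in this case.\<close>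
definition program :: "nat \<Rightarrow> com" where
  "program D = com.If (RLess (RAdd (Rv ''eps'') (Rv ''eps'')) (ROfNat (NConst 1))) (main_com D) (set_n ''e'' (Nv ''e''))"

definition factors :: "nat \<Rightarrow> nat \<Rightarrow> nat \<Rightarrow> (nat \<Rightarrow> nat \<Rightarrow> real) \<Rightarrow> (nat \<Rightarrow> nat \<Rightarrow> real) \<Rightarrow> (nat \<Rightarrow> nat) \<Rightarrow> ram_state \<Rightarrow> bool" where
  "factors n k S B F h s \<longleftrightarrow> nats s ''r'' 0 0 = k \<and> (\<forall>i<n. \<forall>l<k. reals s ''V'' i l = F l i \<and>
     reals s ''U'' i l = (\<Sum>b<S. sketch S n h (B i) b * sketch S n h (F l) b))"

lemma halts_main:
  fixes n k :: nat and \<epsilon> :: real and A W :: "real mat" and es :: "(nat \<times> nat) list"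
  defines "B \<equiv> masked n A W"
  assumes A: "A \<in> carrier_mat n n" and W: "binary_mat n W" and es: "lists_nonzeros A es"
    and eps: "\<epsilon> > 0"
  shows "\<exists>S K F fin. real S * \<epsilon>\<^sup>2 \<ge> 256 * real D * (real k)\<^sup>2 \<and> real S \<le> 256 * real D * (real k / \<epsilon>)\<^sup>2 + 1 \<and>
    real K * \<epsilon>\<^sup>2 \<ge> 513 * real S ^ 6 \<and> real K \<le> 513 * real S ^ 6 / \<epsilon>\<^sup>2 + 1 \<and>
    halts (2 * S + 2 * K + 8 * n + 20 + phase1_time (length es) n S K + phase2_time (length es) n S k)
      ([main_com D], ram_input n k \<epsilon> A es W)
      (bind_pmf (hashes (2 * S - 1) n) (\<lambda>g. bind_pmf (hashes (2 * S - 1) n) (\<lambda>h. return_pmf (fin g h)))) \<and>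
    (\<forall>g. sweep_start n S (\<lambda>a c. sketch S n g (\<lambda>i. B i c) a) ((\<epsilon> / (16 * (real S)\<^sup>2))\<^sup>2 * frob_sq n B) K (F g) \<and>
      (\<forall>h. factors n k S B (F g) h (fin g h)))"
proof -
  let ?inp = "ram_input n k \<epsilon> A es W"
  note inp = ram_input_simps[where n=n and k=k and \<epsilon>=\<epsilon> and A=A and es=es and W=W]
  have "\<exists>v. runs (count_com ''s'' eps2_exp (size_exp D)) (2 * v + 1) ?inp (set_nat ''s'' v ?inp) \<and>
      real v * \<epsilon>\<^sup>2 \<ge> 256 * real D * (real k)\<^sup>2 \<and> real v \<le> 256 * real D * (real k)\<^sup>2 / \<epsilon>\<^sup>2 + 1"
    by (rule runs_count)
      (use eps in \<open>simp_all add: eps2_exp_def size_exp_def inp power2_eq_square\<close>)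
  then obtain S where r1: "runs (count_com ''s'' eps2_exp (size_exp D)) (2 * S + 1) ?inp (set_nat ''s'' S ?inp)"
    and S: "real S * \<epsilon>\<^sup>2 \<ge> 256 * real D * (real k)\<^sup>2" and S': "real S \<le> 256 * real D * (real k)\<^sup>2 / \<epsilon>\<^sup>2 + 1"
    by blast
  define s1 where "s1 = set_nat ''s'' S ?inp"
  have S1: "nats s1 ''s'' 0 0 = S" "nats s1 ''K'' 0 0 = 0" by (simp_all add: s1_def inp)
  have six: "x * (x * x) * (x * (x * x)) = x ^ 6" for x :: real by (simp add: power_numeral_reduce)
  have "\<exists>v. runs (count_com ''K'' eps2_exp sweeps_exp) (2 * v + 1) s1 (set_nat ''K'' v s1) \<and>
      real v * \<epsilon>\<^sup>2 \<ge> 513 * real S ^ 6 \<and> real v \<le> 513 * real S ^ 6 / \<epsilon>\<^sup>2 + 1"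
    by (rule runs_count)
      (use eps in \<open>simp_all add: eps2_exp_def sweeps_exp_def s1_def inp power2_eq_square six[of "real S"]\<close>)
  then obtain K where r2: "runs (count_com ''K'' eps2_exp sweeps_exp) (2 * K + 1) s1 (set_nat ''K'' K s1)"
    and K: "real K * \<epsilon>\<^sup>2 \<ge> 513 * real S ^ 6" and K': "real K \<le> 513 * real S ^ 6 / \<epsilon>\<^sup>2 + 1"
    by blast
  define s2 where "s2 = set_nat ''K'' K s1"
  have st2: "nats s2 ''n'' 0 0 = n" "nats s2 ''s'' 0 0 = S" "nats s2 ''K'' 0 0 = K"
    by (simp_all add: s2_def s1_def inp)
  let ?X1 = "{''s'', ''K'', ''i'', ''g''}"
  let ?X2 = "{''s'', ''K'', ''i'', ''g'', ''e'', ''M'', ''beta'', ''j'', ''c'', ''q'', ''F'', ''theta'', ''t'', ''a'', ''y'', ''z'', ''A'', ''B'', ''D'', ''E''}"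
  let ?X3 = "{''s'', ''K'', ''i'', ''g'', ''e'', ''M'', ''beta'', ''j'', ''c'', ''q'', ''F'', ''theta'', ''t'', ''a'', ''y'', ''z'', ''A'', ''B'', ''D'', ''E'', ''h''}"
  have ag2: "agree ?X1 ?inp s2" by (simp add: s2_def s1_def agree_refl)
  let ?T1 = "phase1_time (length es) n S K" and ?T2 = "phase2_time (length es) n S k"
  let ?\<theta> = "(\<epsilon> / (16 * (real S)\<^sup>2))\<^sup>2 * frob_sq n B"
  have "\<exists>s'. runs phase1_com ?T1 (store_hash ''g'' n g s2) s' \<and> agree ?X2 ?inp s' \<and> nats s' ''s'' 0 0 = S \<and>
    sweep_start n S (\<lambda>a c. sketch S n g (\<lambda>i. B i c) a) ?\<theta> K (reals s' ''F'')" for g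
    unfolding B_def
  proof (rule runs_phase1[OF A W es])
    show "agree ?X1 ?inp (store_hash ''g'' n g s2)" using ag2 by (simp add: store_hash_def)
  qed (use st2 in \<open>auto simp: store_hash_def\<close>)
  \<comment> \<open>The choice makes the state, and with it the frame \<open>F g\<close>, a function
    of \<open>g\<close> alone. This expresses the independence of the second hash function.\<close>
  then obtain m where m: "\<And>g. runs phase1_com ?T1 (store_hash ''g'' n g s2) (m g)" "\<And>g. agree ?X2 ?inp (m g)"
    "\<And>g. nats (m g) ''s'' 0 0 = S"
    "\<And>g. sweep_start n S (\<lambda>a c. sketch S n g (\<lambda>i. B i c) a) ?\<theta> K (reals (m g) ''F'')" by metis
  define F where "F = (\<lambda>g. reals (m g) ''F'')"
  have ex2: "\<exists>s'. runs phase2_com ?T2 (store_hash ''h'' n h (m g)) s' \<and> factors n k S B (F g) h s'" for g h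
  proof -
    have F: "F g = reals (store_hash ''h'' n h (m g)) ''F''" by (simp add: F_def store_hash_def)
    have "agree ?X3 ?inp (m g)" using m(2)[of g] by (auto simp: agree_def)
    then have ag: "agree ?X3 ?inp (store_hash ''h'' n h (m g))" by (simp add: store_hash_def)
    show ?thesis unfolding B_def F factors_def
      by (rule runs_phase2[OF A W es ag]) (use m(3)[of g] in \<open>auto simp: store_hash_def\<close>)
  qed
  define fin where "fin = (\<lambda>g h. SOME s'. runs phase2_com ?T2 (store_hash ''h'' n h (m g)) s' \<and> factors n k S B (F g) h s')"
  have fin: "runs phase2_com ?T2 (store_hash ''h'' n h (m g)) (fin g h)" "factors n k S B (F g) h (fin g h)" for g h
    using someI_ex[OF ex2[of h g]] by (auto simp: fin_def)
  have h2: "halts (?T2 + 0) ([phase2_com], store_hash ''h'' n h (m g)) (return_pmf (fin g h))" for g h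
    by (rule halts_runs[OF fin(1) halts_Nil])
  have h3: "halts (4 * n + 3 + (?T2 + 0)) ([draw_com ''h'', phase2_com], m g)
      (bind_pmf (hashes (2 * S - 1) n) (\<lambda>h. return_pmf (fin g h)))" for g
  proof (rule halts_draw)
    show "nats (m g) ''n'' 0 0 = n" using m(2)[of g] by (simp add: agree_D inp)
  qed (use m(3) h2 in auto)
  have h4: "halts (Suc (?T1 + Suc (4 * n + 3 + (?T2 + 0)))) ([Seq phase1_com (Seq (draw_com ''h'') phase2_com)], store_hash ''g'' n g s2)
      (bind_pmf (hashes (2 * S - 1) n) (\<lambda>h. return_pmf (fin g h)))" for g
    by (intro halts_Seq halts_runs[OF m(1)] h3)
  let ?p = "bind_pmf (hashes (2 * S - 1) n) (\<lambda>g. bind_pmf (hashes (2 * S - 1) n) (\<lambda>h. return_pmf (fin g h)))"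
  have "halts (4 * n + 3 + Suc (?T1 + Suc (4 * n + 3 + (?T2 + 0)))) ([draw_com ''g'', Seq phase1_com (Seq (draw_com ''h'') phase2_com)], s2) ?p"
    by (rule halts_draw) (use st2 h4 in auto)
  then have "halts (Suc ((2 * S + 1) + Suc ((2 * K + 1) + Suc (4 * n + 3 + Suc (?T1 + Suc (4 * n + 3 + (?T2 + 0)))))))
    ([main_com D], ?inp) ?p"
    unfolding main_com_def
    by (intro halts_Seq halts_runs[OF r1] halts_runs[OF r2[unfolded s1_def]]) (simp add: s2_def s1_def)
  then have "halts (2 * S + 2 * K + 8 * n + 20 + ?T1 + ?T2) ([main_com D], ?inp) ?p"
    unfolding halts_def by auto
  moreover have "real S \<le> 256 * real D * (real k / \<epsilon>)\<^sup>2 + 1" using S' by (simp add: power_divide)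
  ultimately show ?thesis using S K K' m(4) fin(2)
    by (intro exI[of _ S] exI[of _ K] exI[of _ F] exI[of _ fin]) (simp add: F_def)
qed

lemma time_bound:
  fixes n S K k N :: nat
  assumes "n \<ge> 1" "S \<ge> 1" "K \<ge> 1" "k \<le> S"
  shows "2 * S + 2 * K + 8 * n + 21 + phase1_time N n S K + phase2_time N n S k \<le> 15 * N + n * (400 * K * S ^ 3)"
proof -
  \<comment> \<open>In the predecessors both sides are polynomials with nonnegative coefficients,
    and the inequality follows by comparing monomials.\<close>
  obtain n' S' K' where eq: "n = Suc n'" "S = Suc S'" "K = Suc K'"
    using assms by (metis Suc_le_D One_nat_def)
  have "k * (n * (4 * S + 16) + 10) \<le> S * (n * (4 * S + 16) + 10)" using assms(4) by (rule mult_right_mono) simp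
  then have "2 * S + 2 * K + 8 * n + 21 + phase1_time N n S K + phase2_time N n S k
    \<le> 2 * S + 2 * K + 8 * n + 21 + phase1_time N n S K + phase2_time N n S S"
    by (simp add: phase2_time_def)
  also have "\<dots> \<le> 15 * N + n * (400 * K * S ^ 3)"
    unfolding eq phase1_time_def phase2_time_def power3_eq_cube
    by (simp add: algebra_simps)
  finally show ?thesis .
qed

section \<open>From the approximation of the masked matrix to the guarantee\<close>

lemma frob_norm_square:
  assumes "M \<in> carrier_mat n n"
  shows "(frob_norm M)\<^sup>2 = (\<Sum>i<n. \<Sum>j<n. (M $$ (i, j))\<^sup>2)"
  using assms by (simp add: frob_norm_def real_sqrt_pow2 sum_nonneg)

text \<open>The premise \<open>near\<close> compares with all products of width \<open>k'\<close>,
  so one \<open>L\<close> serves every optimal matrix: each of them yields, through the protocol,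
  its own competitor.\<close>

lemma masked_solution_I:
  fixes u v :: "nat \<Rightarrow> nat \<Rightarrow> real"
  assumes n: "n = 2 ^ m" and eps: "\<epsilon> > 0" and A: "A \<in> carrier_mat n n" and W: "binary_mat n W"
    and k': "k' = k * 2 ^ rand_cc m \<epsilon> (mat_fun W)"
    and L: "L = mat n n (\<lambda>(i, j). \<Sum>l<r. u i l * v j l)" and r: "r \<le> k'"
    and near: "\<And>u' v' :: nat \<Rightarrow> nat \<Rightarrow> real. (\<Sum>i<n. \<Sum>j<n. (masked n A W i j - L $$ (i, j))\<^sup>2)
      \<le> (\<Sum>i<n. \<Sum>j<n. (masked n A W i j - (\<Sum>l<k'. u' l i * v' l j))\<^sup>2) + \<epsilon> * frob_sq n (masked n A W)"
  shows "masked_solution n k k' \<epsilon> A W L"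
proof -
  have Lc: "L \<in> carrier_mat n n" and Wc: "W \<in> carrier_mat n n" using L W by (auto simp: binary_mat_def)
  have W01: "W $$ (i, j) = of_bool (W $$ (i, j) = 1)" if "i < n" "j < n" for i j
    using W that by (auto simp: binary_mat_def)
  have rank: "vec_space.rank n L \<le> k'" unfolding L using rank_factors_le[where n=n and r=r and u=u and v=v] r by simp
  have loss: "(frob_norm (W \<circ>\<^sub>H (A - M)))\<^sup>2 = (\<Sum>i<n. \<Sum>j<n. (W $$ (i, j) * (A $$ (i, j) - M $$ (i, j)))\<^sup>2)"
    if M: "M \<in> carrier_mat n n" for M
  proof -
    have c: "W \<circ>\<^sub>H (A - M) \<in> carrier_mat n n" using Wc by (simp add: entrywise_prod_def)
    show ?thesis unfolding frob_norm_square[OF c]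
      by (intro sum.cong refl) (use A M Wc in \<open>auto simp: entrywise_prod_def\<close>)
  qed
  have AW: "(frob_norm (A \<circ>\<^sub>H W))\<^sup>2 = (\<Sum>i<n. \<Sum>j<n. (A $$ (i, j) * W $$ (i, j))\<^sup>2)"
  proof -
    have c: "A \<circ>\<^sub>H W \<in> carrier_mat n n" using A by (simp add: entrywise_prod_def)
    show ?thesis unfolding frob_norm_square[OF c]
      by (intro sum.cong refl) (use A in \<open>auto simp: entrywise_prod_def\<close>)
  qed
  have off: "(frob_norm (M \<circ>\<^sub>H one_minus_mat W))\<^sup>2 = (\<Sum>i<n. \<Sum>j<n. (M $$ (i, j) * (1 - W $$ (i, j)))\<^sup>2)"
    if M: "M \<in> carrier_mat n n" for M
  proof -
    have c: "M \<circ>\<^sub>H one_minus_mat W \<in> carrier_mat n n" using M by (simp add: entrywise_prod_def)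
    show ?thesis unfolding frob_norm_square[OF c]
      by (intro sum.cong refl) (use M Wc in \<open>auto simp: entrywise_prod_def one_minus_mat_def\<close>)
  qed
  have \<beta>: "frob_sq n (masked n A W) = (frob_norm (A \<circ>\<^sub>H W))\<^sup>2"
    unfolding AW frob_sq_def dot_def
    by (intro sum.cong refl) (auto simp: masked_def power2_eq_square)
  \<comment> \<open>Off the mask the loss ignores \<open>L\<close>, so the distance from
    \<open>L\<close> to the masked matrix can only be larger.\<close>
  have le: "(frob_norm (W \<circ>\<^sub>H (A - L)))\<^sup>2 \<le> (\<Sum>i<n. \<Sum>j<n. (masked n A W i j - L $$ (i, j))\<^sup>2)"
    unfolding loss[OF Lc]
  proof (intro sum_mono)
    fix i j assume ij: "i \<in> {..<n}" "j \<in> {..<n}"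
    then have "W $$ (i, j) = 0 \<or> W $$ (i, j) = 1" using W by (auto simp: binary_mat_def)
    then show "(W $$ (i, j) * (A $$ (i, j) - L $$ (i, j)))\<^sup>2 \<le> (masked n A W i j - L $$ (i, j))\<^sup>2"
      using ij by (auto simp: masked_def)
  qed
  have "(frob_norm (W \<circ>\<^sub>H (A - L)))\<^sup>2
      \<le> OPT n k A W + 2 * \<epsilon> * (frob_norm (A \<circ>\<^sub>H W))\<^sup>2 + \<epsilon> * (frob_norm (M \<circ>\<^sub>H one_minus_mat W))\<^sup>2"
    if "M \<in> optimal_mats n k A W" for M
  proof -
    have Mc: "M \<in> carrier_mat n n" and Mr: "vec_space.rank n M \<le> k"
      and opt: "(frob_norm (W \<circ>\<^sub>H (A - M)))\<^sup>2 = OPT n k A W"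
      using that by (auto simp: optimal_mats_def low_rank_mats_def)
    obtain a b :: "nat \<Rightarrow> nat \<Rightarrow> real" where ab: "\<forall>i<n. \<forall>j<n. M $$ (i, j) = (\<Sum>l<k. a l i * b l j)"
      using rank_le_imp_factors[OF Mc Mr] by blast
    have "\<exists>u' v' :: nat \<Rightarrow> nat \<Rightarrow> real. (\<Sum>i<n. \<Sum>j<n. (W $$ (i, j) * A $$ (i, j) - (\<Sum>l<k'. u' l i * v' l j))\<^sup>2)
      \<le> (\<Sum>i<n. \<Sum>j<n. (W $$ (i, j) * (A $$ (i, j) - M $$ (i, j)))\<^sup>2) + \<epsilon> * (\<Sum>i<n. \<Sum>j<n. (A $$ (i, j) * W $$ (i, j))\<^sup>2)
      + \<epsilon> * (\<Sum>i<n. \<Sum>j<n. (M $$ (i, j) * (1 - W $$ (i, j)))\<^sup>2)" (is "\<exists>u' v'. ?P u' v'")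
      unfolding k'
    proof (rule protocol_approximation[OF eps])
      show "\<And>i j. i < n \<Longrightarrow> j < n \<Longrightarrow> W $$ (i, j) = of_bool (W $$ (i, j) = 1)" by (rule W01)
      show "n = 2 ^ m" by (rule n)
      show "\<And>i j. i < n \<Longrightarrow> j < n \<Longrightarrow> M $$ (i, j) = (\<Sum>l<k. a l i * b l j)" using ab by blast
      show "\<And>x y. mat_fun W x y = (W $$ (index_of x, index_of y) = 1)" by (simp add: mat_fun_def)
    qed
    then obtain u' v' where uv: "?P u' v'"
      by blast
    have "(\<Sum>i<n. \<Sum>j<n. (masked n A W i j - (\<Sum>l<k'. u' l i * v' l j))\<^sup>2)
      = (\<Sum>i<n. \<Sum>j<n. (W $$ (i, j) * A $$ (i, j) - (\<Sum>l<k'. u' l i * v' l j))\<^sup>2)"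
      by (intro sum.cong refl) (simp add: masked_def)
    then show ?thesis
      using le near[of u' v'] uv unfolding loss[OF Mc, symmetric] AW[symmetric] off[OF Mc, symmetric] \<beta> opt by linarith
  qed
  then show ?thesis using Lc rank by (simp add: masked_solution_def)
qed

text \<open>The zero matrix loses exactly the squared norm of the masked matrix, which the term with
  factor 2 \<epsilon> already covers. OPT is nonnegative because the given optimal matrix attains
  it.\<close>

lemma zero_masked_solution:
  assumes eps: "2 * \<epsilon> \<ge> 1" and A: "A \<in> carrier_mat n n" and W: "binary_mat n W" and r: "nats s ''r'' 0 0 = 0"
  shows "masked_solution n k k' \<epsilon> A W (ram_output n s)"
proof -
  let ?L = "ram_output n s"
  have Lc: "?L \<in> carrier_mat n n" and Wc: "W \<in> carrier_mat n n" using W by (auto simp: binary_mat_def ram_output_def)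
  have L0: "?L $$ (i, j) = 0" if "i < n" "j < n" for i j using that r by (simp add: ram_output_def)
  have rank: "vec_space.rank n ?L \<le> k'"
    using rank_factors_le[where n=n and r=0 and u="reals s ''U''" and v="reals s ''V''"] by (simp add: ram_output_def r)
  have "W \<circ>\<^sub>H (A - ?L) = A \<circ>\<^sub>H W"
    by (rule eq_matI) (use A Lc Wc L0 in \<open>auto simp: entrywise_prod_def\<close>)
  then have "(frob_norm (W \<circ>\<^sub>H (A - ?L)))\<^sup>2 = 1 * (frob_norm (A \<circ>\<^sub>H W))\<^sup>2" by simp
  also have "\<dots> \<le> (2 * \<epsilon>) * (frob_norm (A \<circ>\<^sub>H W))\<^sup>2" using eps by (intro mult_right_mono) auto
  finally have le: "(frob_norm (W \<circ>\<^sub>H (A - ?L)))\<^sup>2 \<le> 2 * \<epsilon> * (frob_norm (A \<circ>\<^sub>H W))\<^sup>2" .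
  have "(frob_norm (W \<circ>\<^sub>H (A - ?L)))\<^sup>2
      \<le> OPT n k A W + 2 * \<epsilon> * (frob_norm (A \<circ>\<^sub>H W))\<^sup>2 + \<epsilon> * (frob_norm (M \<circ>\<^sub>H one_minus_mat W))\<^sup>2"
    if "M \<in> optimal_mats n k A W" for M
  proof -
    have "OPT n k A W = (frob_norm (W \<circ>\<^sub>H (A - M)))\<^sup>2" using that by (simp add: optimal_mats_def)
    then have "OPT n k A W \<ge> 0" by simp
    moreover have "\<epsilon> * (frob_norm (M \<circ>\<^sub>H one_minus_mat W))\<^sup>2 \<ge> 0" using eps by simp
    ultimately show ?thesis using le by linarith
  qed
  then show ?thesis using Lc rank by (simp add: masked_solution_def)
qed

text \<open>The deterministic part of the analysis: once the two sketch errors are small, the output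
  is correct whatever else the hash functions do.\<close>

lemma good_hashes:
  fixes F :: "nat \<Rightarrow> nat \<Rightarrow> real" and A W :: "real mat" and n :: nat
  defines "B \<equiv> masked n A W"
  assumes n: "n = 2 ^ m" and eps: "0 < \<epsilon>" "\<epsilon> \<le> 1" and A: "A \<in> carrier_mat n n" and W: "binary_mat n W"
    and k': "k' = k * 2 ^ rand_cc m \<epsilon> (mat_fun W)" and k1: "1 \<le> k'" "k' \<le> S"
    and K: "real K * \<epsilon>\<^sup>2 \<ge> 513 * real S ^ 6"
    and F: "sweep_start n S (\<lambda>a c. sketch S n g (\<lambda>i. B i c) a) ((\<epsilon> / (16 * (real S)\<^sup>2))\<^sup>2 * frob_sq n B) K F"
    and fac: "factors n k' S B F h s"
    and X1: "(\<Sum>c<n. \<Sum>d<n. (sketch_err S n g (\<lambda>i. B i c) (\<lambda>i. B i d))\<^sup>2) \<le> (\<epsilon> / (8 * real k') * frob_sq n B)\<^sup>2"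
    and X2: "(\<Sum>i<n. \<Sum>l<k'. (sketch_err S n h (B i) (F l))\<^sup>2) \<le> \<epsilon> / 4 * frob_sq n B"
  shows "masked_solution n k k' \<epsilon> A W (ram_output n s)"
proof (rule masked_solution_I[OF n eps(1) A W k' _ order_refl])
  show L: "ram_output n s = mat n n (\<lambda>(i, j). \<Sum>l<k'. reals s ''U'' i l * reals s ''V'' j l)"
    using fac by (simp add: ram_output_def factors_def)
  fix u' v' :: "nat \<Rightarrow> nat \<Rightarrow> real"
  define U where "U = (\<lambda>i l. \<Sum>b<S. sketch S n h (B i) b * sketch S n h (F l) b)"
  have "ram_output n s $$ (i, j) = (\<Sum>l<k'. U i l * F l j)" if "i < n" "j < n" for i j
    using that fac unfolding L by (simp add: factors_def U_def)
  then have "(\<Sum>i<n. \<Sum>j<n. (masked n A W i j - ram_output n s $$ (i, j))\<^sup>2) = (\<Sum>i<n. \<Sum>j<n. (B i j - (\<Sum>l<k'. U i l * F l j))\<^sup>2)"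
    by (simp add: B_def)
  also have "\<dots> \<le> (\<Sum>i<n. \<Sum>j<n. (B i j - (\<Sum>l<k'. u' l i * v' l j))\<^sup>2) + \<epsilon> * (\<Sum>i<n. dot n (B i) (B i))"
  proof (rule sketched_svd_error[OF eps k1 _ K])
    show "(\<Sum>c<n. \<Sum>d<n. ((\<Sum>a<S. sketch S n g (\<lambda>i. B i c) a * sketch S n g (\<lambda>i. B i d) a) - (\<Sum>i<n. B i c * B i d))\<^sup>2)
      \<le> (\<epsilon> / (8 * real k') * (\<Sum>i<n. dot n (B i) (B i)))\<^sup>2"
      using X1 by (simp only: sketch_err_def dot_def[of n "\<lambda>i. B i c" "\<lambda>i. B i d" for c d] frob_sq_def)
    show "sweep_start n S (\<lambda>a c. sketch S n g (\<lambda>i. B i c) a) ((\<epsilon> / (16 * (real S)\<^sup>2))\<^sup>2 * (\<Sum>i<n. dot n (B i) (B i))) K F"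
      using F by (simp only: frob_sq_def)
    show "(\<Sum>i<n. \<Sum>l<k'. (U i l - dot n (B i) (F l))\<^sup>2) \<le> \<epsilon> / 4 * (\<Sum>i<n. dot n (B i) (B i))"
      using X2 by (simp only: sketch_err_def U_def frob_sq_def)
  qed
  finally show "(\<Sum>i<n. \<Sum>j<n. (masked n A W i j - ram_output n s $$ (i, j))\<^sup>2)
      \<le> (\<Sum>i<n. \<Sum>j<n. (masked n A W i j - (\<Sum>l<k'. u' l i * v' l j))\<^sup>2) + \<epsilon> * frob_sq n (masked n A W)"
    by (simp add: B_def frob_sq_def)
qed

section \<open>Expected sketch errors and the success probability\<close>

lemma avg_gram_error:
  fixes B :: "nat \<Rightarrow> nat \<Rightarrow> real"
  assumes "S > 0"
  shows "avg (2 * S - 1) n (\<lambda>g. \<Sum>c<n. \<Sum>d<n. (sketch_err S n g (\<lambda>i. B i c) (\<lambda>i. B i d))\<^sup>2) \<le> 2 / S * (frob_sq n B)\<^sup>2"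
proof -
  let ?n = "\<lambda>c. dot n (\<lambda>i. B i c) (\<lambda>i. B i c)"
  have "avg (2 * S - 1) n (\<lambda>g. \<Sum>c<n. \<Sum>d<n. (sketch_err S n g (\<lambda>i. B i c) (\<lambda>i. B i d))\<^sup>2)
    \<le> (\<Sum>c<n. \<Sum>d<n. 2 / S * (?n c * ?n d))"
    unfolding avg_sum by (intro sum_mono avg_sketch_err assms)
  also have "\<dots> = 2 / S * ((\<Sum>c<n. ?n c) * (\<Sum>d<n. ?n d))"
    unfolding sum_product by (simp only: sum_distrib_left)
  \<comment> \<open>The squared column norms add up to the squared Frobenius norm, hence its square
    in the bound for all pairs of columns.\<close>
  also have "(\<Sum>c<n. ?n c) = frob_sq n B" unfolding frob_sq_def dot_def by (rule sum.swap)
  finally show ?thesis by (simp add: power2_eq_square)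
qed

lemma avg_projection_error:
  fixes B F :: "nat \<Rightarrow> nat \<Rightarrow> real"
  assumes "S > 0" and F: "\<And>l. l < k \<Longrightarrow> dot n (F l) (F l) \<le> 1"
  shows "avg (2 * S - 1) n (\<lambda>h. \<Sum>i<n. \<Sum>l<k. (sketch_err S n h (B i) (F l))\<^sup>2) \<le> 2 / S * (frob_sq n B * real k)"
proof -
  have "avg (2 * S - 1) n (\<lambda>h. \<Sum>i<n. \<Sum>l<k. (sketch_err S n h (B i) (F l))\<^sup>2)
    \<le> (\<Sum>i<n. \<Sum>l<k. 2 / S * (dot n (B i) (B i) * dot n (F l) (F l)))"
    unfolding avg_sum by (intro sum_mono avg_sketch_err assms)
  also have "\<dots> \<le> (\<Sum>i<n. \<Sum>l<k. 2 / S * (dot n (B i) (B i) * 1))"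
    by (intro sum_mono mult_left_mono F dot_self_nonneg) auto
  also have "\<dots> = 2 / S * (frob_sq n B * real k)"
    by (simp add: frob_sq_def sum_distrib_left sum_distrib_right mult_ac)
  finally show ?thesis .
qed

text \<open>For each fixed \<open>g\<close> the frame is fixed, so the bound for the second sketch
  applies conditionally. Each stage fails with probability at most q = 1 / (2 D), and (1 - q)^2 >= 1
  - 2 q.\<close>

lemma success_probability:
  fixes F :: "(nat \<Rightarrow> nat) \<Rightarrow> nat \<Rightarrow> nat \<Rightarrow> real" and A W :: "real mat" and n :: nat
  defines "B \<equiv> masked n A W"
  assumes n: "n = 2 ^ m" and eps: "0 < \<epsilon>" "\<epsilon> \<le> 1" and A: "A \<in> carrier_mat n n" and W: "binary_mat n W"
    and k': "k' = k * 2 ^ rand_cc m \<epsilon> (mat_fun W)" and k1: "1 \<le> k'" and D: "D \<ge> 1"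
    and S: "real S * \<epsilon>\<^sup>2 \<ge> 256 * real D * (real k')\<^sup>2"
    and K: "real K * \<epsilon>\<^sup>2 \<ge> 513 * real S ^ 6"
    and F: "\<And>g. sweep_start n S (\<lambda>a c. sketch S n g (\<lambda>i. B i c) a) ((\<epsilon> / (16 * (real S)\<^sup>2))\<^sup>2 * frob_sq n B) K (F g)"
    and fin: "\<And>g h. factors n k' S B (F g) h (fin g h)"
  shows "measure_pmf.prob (bind_pmf (hashes (2 * S - 1) n) (\<lambda>g. bind_pmf (hashes (2 * S - 1) n) (\<lambda>h. return_pmf (fin g h))))
    {s. masked_solution n k k' \<epsilon> A W (ram_output n s)} \<ge> 1 - 1 / real D"
proof -
  let ?N = "2 * S - 1" and ?G = "{s. masked_solution n k k' \<epsilon> A W (ram_output n s)}"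
  define \<beta> where "\<beta> = frob_sq n B"
  define q where "q = 1 / (2 * real D)"
  have \<beta>: "\<beta> \<ge> 0" by (simp add: \<beta>_def frob_sq_def sum_nonneg dot_self_nonneg)
  have q: "0 \<le> q" "q \<le> 1" using D by (auto simp: q_def field_simps)
  have kr: "real k' \<ge> 1" and Dr: "real D \<ge> 1" using k1 D by auto
  have "\<epsilon> * \<epsilon> \<le> \<epsilon> * 1" using eps by (intro mult_left_mono) auto
  then have e2: "\<epsilon>\<^sup>2 \<le> 1" "\<epsilon>\<^sup>2 \<le> \<epsilon>" unfolding power2_eq_square using eps by linarith+
  have kk: "real k' \<le> (real k')\<^sup>2" using kr by (simp add: power2_eq_square)
  have Dkk: "(real k')\<^sup>2 \<le> real D * (real k')\<^sup>2" using Dr by (simp add: mult_right_mono[of 1 "real D", simplified])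
  have "real S * \<epsilon>\<^sup>2 \<le> real S * 1" using e2 by (intro mult_left_mono) auto
  then have kS: "real k' \<le> real S" using S kk Dkk kr by linarith
  then have kS': "k' \<le> S" and S0: "S > 0" using k1 by auto
  define X1 where "X1 = (\<lambda>g. \<Sum>c<n. \<Sum>d<n. (sketch_err S n g (\<lambda>i. B i c) (\<lambda>i. B i d))\<^sup>2)"
  define X2 where "X2 = (\<lambda>g h. \<Sum>i<n. \<Sum>l<k'. (sketch_err S n h (B i) (F g l))\<^sup>2)"
  define c1 where "c1 = (\<epsilon> / (8 * real k') * \<beta>)\<^sup>2"
  define c2 where "c2 = \<epsilon> / 4 * \<beta>"
  have P1: "avg ?N n (\<lambda>g. of_bool (X1 g \<le> c1)) \<ge> 1 - q"
  proof (rule avg_Markov)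
    have "2 / real S \<le> q * (\<epsilon> / (8 * real k'))\<^sup>2"
      using S S0 kr Dr by (simp add: q_def field_simps power2_eq_square)
    from mult_right_mono[OF this zero_le_power2[of \<beta>]] have "2 / real S * \<beta>\<^sup>2 \<le> q * c1"
      by (simp only: c1_def power_mult_distrib mult.assoc)
    then show "avg ?N n X1 \<le> q * c1"
      using avg_gram_error[OF S0, of n B] unfolding X1_def \<beta>_def by linarith
  qed (auto simp: X1_def c1_def q intro!: sum_nonneg)
  have P2: "avg ?N n (\<lambda>h. of_bool (X2 g h \<le> c2)) \<ge> 1 - q" for g
  proof (rule avg_Markov)
    \<comment> \<open>The second sketch needs only S \<epsilon> >= 16 D k', far less than the size
      dictated by the Gram error.\<close>
    have "real S * \<epsilon>\<^sup>2 \<le> real S * \<epsilon>" using e2 by (intro mult_left_mono) auto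
    then have "256 * real D * (real k')\<^sup>2 \<le> real S * \<epsilon>" using S by linarith
    moreover have "real D * real k' \<le> real D * (real k')\<^sup>2" using kk Dr by (intro mult_left_mono) auto
    moreover have "0 \<le> real D * (real k')\<^sup>2" by simp
    ultimately have "16 * (real D * real k') \<le> real S * \<epsilon>" by linarith
    then have "2 / real S * real k' \<le> q * (\<epsilon> / 4)"
      using S0 Dr by (simp add: q_def field_simps)
    from mult_right_mono[OF this \<beta>] have "2 / real S * (\<beta> * real k') \<le> q * c2"
      by (simp add: c2_def mult_ac)
    moreover have "avg ?N n (X2 g) \<le> 2 / real S * (\<beta> * real k')"
      unfolding X2_def \<beta>_def
    proof (rule avg_projection_error[OF S0])
      fix l assume "l < k'"
      then show "dot n (F g l) (F g l) \<le> 1"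
        using F[of g] kS' by (intro contractive_norm_le_1[of n S]) (auto simp: sweep_start_def jacobi_frame_def)
    qed
    ultimately show "avg ?N n (X2 g) \<le> q * c2" by linarith
  qed (use \<beta> eps q in \<open>auto simp: X2_def c2_def intro!: sum_nonneg\<close>)
  have good: "fin g h \<in> ?G" if "X1 g \<le> c1" "X2 g h \<le> c2" for g h
    using good_hashes[OF n eps A W k' k1 kS' K F[unfolded B_def] fin[unfolded B_def]] that
    by (simp add: X1_def X2_def c1_def c2_def \<beta>_def B_def)
  have "measure_pmf.prob (bind_pmf (hashes ?N n) (\<lambda>g. bind_pmf (hashes ?N n) (\<lambda>h. return_pmf (fin g h)))) ?G
    = avg ?N n (\<lambda>g. avg ?N n (\<lambda>h. indicator ?G (fin g h)))"
    by (simp add: measure_bind_hashes)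
  moreover have "avg ?N n (\<lambda>g. avg ?N n (\<lambda>h. indicator ?G (fin g h))) \<ge> avg ?N n (\<lambda>g. (1 - q) * of_bool (X1 g \<le> c1))"
  proof (rule avg_mono)
    fix g
    show "(1 - q) * of_bool (X1 g \<le> c1) \<le> avg ?N n (\<lambda>h. indicator ?G (fin g h))"
    proof (cases "X1 g \<le> c1")
      case True
      have "avg ?N n (\<lambda>h. of_bool (X2 g h \<le> c2)) \<le> avg ?N n (\<lambda>h. indicator ?G (fin g h))"
        by (rule avg_mono) (use good[OF True] in \<open>auto simp: indicator_def\<close>)
      then show ?thesis using P2[of g] True by simp
    next
      case False
      have "avg ?N n (\<lambda>h. 0) \<le> avg ?N n (\<lambda>h. indicator ?G (fin g h))"
        by (rule avg_mono) auto
      then show ?thesis using False by (simp add: avg_const)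
    qed
  qed
  moreover have "avg ?N n (\<lambda>g. (1 - q) * of_bool (X1 g \<le> c1)) = (1 - q) * avg ?N n (\<lambda>g. of_bool (X1 g \<le> c1))"
    by (rule avg_cmult)
  moreover have "(1 - q) * avg ?N n (\<lambda>g. of_bool (X1 g \<le> c1)) \<ge> (1 - q) * (1 - q)"
    using P1 q by (intro mult_left_mono) auto
  moreover have "(1 - q) * (1 - q) \<ge> 1 - 2 * q" by (simp add: algebra_simps)
  moreover have "2 * q = 1 / real D" by (simp add: q_def)
  ultimately show ?thesis by linarith
qed

section \<open>Polynomial running time and assembly of the result\<close>

lemma time_real_bound:
  fixes S K n N D :: nat and z \<epsilon> :: real
  assumes S1: "S \<ge> 1" and S: "real S \<le> 256 * real D * z\<^sup>2 + 1" and K: "real K \<le> 513 * real S ^ 6 / \<epsilon>\<^sup>2 + 1"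
    and z: "1 \<le> z" "1 / \<epsilon> \<le> z" and eps: "\<epsilon> > 0"
  shows "real (n * (400 * K * S ^ 3)) \<le> real n * (205600 * (256 * real D + 1) ^ 9 * z ^ 20)"
proof -
  have S1': "real S ^ 6 \<ge> 1" using S1 by simp
  have z2: "z\<^sup>2 \<ge> 1" using z by simp
  have Sz: "real S \<le> (256 * real D + 1) * z\<^sup>2" using S z2 by (simp add: algebra_simps)
  have "1 / \<epsilon>\<^sup>2 = (1 / \<epsilon>)\<^sup>2" by (simp add: power_divide)
  also have "\<dots> \<le> z\<^sup>2" using z eps by (intro power_mono) auto
  finally have "513 * real S ^ 6 * (1 / \<epsilon>\<^sup>2) \<le> 513 * real S ^ 6 * z\<^sup>2" by (intro mult_left_mono) auto
  moreover have "1 * 1 \<le> real S ^ 6 * z\<^sup>2" using S1' z2 by (intro mult_mono) auto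
  ultimately have "real K \<le> 514 * real S ^ 6 * z\<^sup>2" using K by simp
  then have "400 * real K * real S ^ 3 \<le> 400 * (514 * real S ^ 6 * z\<^sup>2) * real S ^ 3"
    by (intro mult_right_mono mult_left_mono) auto
  \<comment> \<open>Here 205600 = 400 * 514. With S of order z^2, the nine factors S and the
    additional z^2 from 1 / \<epsilon>^2 give the exponent 20.\<close>
  also have "\<dots> = 205600 * z\<^sup>2 * real S ^ 9" by (simp flip: power_add)
  also have "\<dots> \<le> 205600 * z\<^sup>2 * ((256 * real D + 1) * z\<^sup>2) ^ 9"
    using Sz by (intro mult_left_mono power_mono) auto
  also have "\<dots> = 205600 * (256 * real D + 1) ^ 9 * z ^ 20"
    by (simp add: power_mult_distrib flip: power_mult power_add)
  finally show ?thesis by (simp add: mult_left_mono)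
qed

text \<open>The coefficient 15 counts three passes over the list at five steps per entry. The
  summand 2 pays for the branch with large \<epsilon>, which halts after two steps.\<close>

lemma program_correct:
  assumes n: "n = 2 ^ m" and k: "k \<ge> 1" and eps: "\<epsilon> > 0" and A: "A \<in> carrier_mat n n" and W: "binary_mat n W"
    and k': "k' = k * 2 ^ rand_cc m \<epsilon> (mat_fun W)" and es: "lists_nonzeros A es" and D: "D \<ge> 1"
  shows "\<exists>T. real T \<le> 15 * real (nnz A) + real n * (2 + 205600 * (256 * real D + 1) ^ 9 * (real k' / \<epsilon>) ^ 20) \<and>
    measure_pmf.prob (ram_run T ([program D], ram_input n k' \<epsilon> A es W))
      {(K, s). K = [] \<and> masked_solution n k k' \<epsilon> A W (ram_output n s)} \<ge> 1 - 1 / real D"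
proof -
  let ?inp = "ram_input n k' \<epsilon> A es W"
  let ?G = "{(K, s). K = [] \<and> masked_solution n k k' \<epsilon> A W (ram_output n s)}"
  note inp = ram_input_simps[where n=n and k=k' and \<epsilon>=\<epsilon> and A=A and es=es and W=W]
  have len: "length es = nnz A"
    using es by (simp add: lists_nonzeros_def nnz_def distinct_card[symmetric])
  have prob: "measure_pmf.prob (ram_run T c) ?G = measure_pmf.prob p {s. masked_solution n k k' \<epsilon> A W (ram_output n s)}"
    if "halts T c p" for T c p
    using that by (simp add: halts_def vimage_def)
  have guard: "bval (RLess (RAdd (Rv ''eps'') (Rv ''eps'')) (ROfNat (NConst 1))) ?inp \<longleftrightarrow> \<epsilon> + \<epsilon> < 1"
    by (simp add: inp)
  have n1: "n \<ge> 1" and k1: "k' \<ge> 1" using k by (auto simp: n k')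
  show ?thesis
  proof (cases "\<epsilon> + \<epsilon> < 1")
    case False
    have "runs (set_n ''e'' (Nv ''e'')) 1 ?inp (set_nat ''e'' (nats ?inp ''e'' 0 0) ?inp)" (is "runs _ _ _ ?s")
      using runs_set_n[of "''e''" "Nv ''e''" ?inp] by simp
    from halts_runs[OF this halts_Nil]
    have h: "halts (Suc (1 + 0)) ([program D], ?inp) (return_pmf ?s)"
      unfolding program_def by (intro halts_If) (simp only: guard False if_False)
    have "masked_solution n k k' \<epsilon> A W (ram_output n ?s)"
      by (rule zero_masked_solution) (use False A W in \<open>simp_all add: inp\<close>)
    then have "measure_pmf.prob (ram_run 2 ([program D], ?inp)) ?G = 1"
      using prob[OF h] by (simp add: numeral_2_eq_2 measure_return_pmf)
    moreover have "real 2 \<le> 15 * real (nnz A) + real n * (2 + 205600 * (256 * real D + 1) ^ 9 * (real k' / \<epsilon>) ^ 20)"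
    proof -
      have "real 2 = 1 * (2 + 0)" by simp
      also have "\<dots> \<le> real n * (2 + 205600 * (256 * real D + 1) ^ 9 * (real k' / \<epsilon>) ^ 20)"
        using n1 eps by (intro mult_mono add_left_mono) auto
      also have "\<dots> \<le> 15 * real (nnz A) + \<dots>" by simp
      finally show ?thesis .
    qed
    ultimately show ?thesis by (intro exI[of _ 2]) auto
  next
    case True
    then have eps1: "\<epsilon> \<le> 1" using eps by simp
    obtain S K F fin where S: "real S * \<epsilon>\<^sup>2 \<ge> 256 * real D * (real k')\<^sup>2"
      and S': "real S \<le> 256 * real D * (real k' / \<epsilon>)\<^sup>2 + 1"
      and K: "real K * \<epsilon>\<^sup>2 \<ge> 513 * real S ^ 6" and K': "real K \<le> 513 * real S ^ 6 / \<epsilon>\<^sup>2 + 1"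
      and h: "halts (2 * S + 2 * K + 8 * n + 20 + phase1_time (length es) n S K + phase2_time (length es) n S k')
      ([main_com D], ?inp)
      (bind_pmf (hashes (2 * S - 1) n) (\<lambda>g. bind_pmf (hashes (2 * S - 1) n) (\<lambda>h. return_pmf (fin g h))))"
      and F: "\<And>g. sweep_start n S (\<lambda>a c. sketch S n g (\<lambda>i. masked n A W i c) a)
        ((\<epsilon> / (16 * (real S)\<^sup>2))\<^sup>2 * frob_sq n (masked n A W)) K (F g)"
      and fin: "\<And>g h. factors n k' S (masked n A W) (F g) h (fin g h)"
      using halts_main[OF A W es eps, of D k'] by blast
    let ?T = "2 * S + 2 * K + 8 * n + 20 + phase1_time (length es) n S K + phase2_time (length es) n S k'"
    have "halts (Suc ?T) ([program D], ?inp)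
      (bind_pmf (hashes (2 * S - 1) n) (\<lambda>g. bind_pmf (hashes (2 * S - 1) n) (\<lambda>h. return_pmf (fin g h))))"
      unfolding program_def by (intro halts_If) (use h in \<open>simp only: guard True if_True\<close>)
    from prob[OF this]
    have P: "measure_pmf.prob (ram_run (Suc ?T) ([program D], ?inp)) ?G \<ge> 1 - 1 / real D"
      using success_probability[OF n eps eps1 A W k' k1 D S K F fin] by simp
    have kr: "real k' \<ge> 1" and Dr: "real D \<ge> 1" using k1 D by auto
    have "real S * \<epsilon>\<^sup>2 \<le> real S * 1" using eps eps1 by (intro mult_left_mono) (auto simp: power_le_one)
    moreover have "1 * real k' \<le> (256 * real D) * (real k' * real k')"
      using kr Dr by (intro mult_mono) auto
    ultimately have kS: "k' \<le> S" using S by (simp add: power2_eq_square)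
    then have S1: "S \<ge> 1" using k1 by simp
    have K1: "K \<ge> 1"
    proof (rule ccontr)
      assume "\<not> K \<ge> 1"
      then have "K = 0" by simp
      moreover have "real S ^ 6 > 0" using S1 by simp
      ultimately show False using K by simp
    qed
    have z: "1 \<le> real k' / \<epsilon>" "1 / \<epsilon> \<le> real k' / \<epsilon>" using kr eps eps1 by (auto simp: field_simps)
    have "Suc ?T \<le> 15 * nnz A + n * (400 * K * S ^ 3)"
      using time_bound[OF n1 S1 K1 kS, of "length es"] by (simp add: len)
    then have "real (Suc ?T) \<le> real (15 * nnz A + n * (400 * K * S ^ 3))" by (simp only: of_nat_le_iff)
    also have "\<dots> \<le> 15 * real (nnz A) + real n * (205600 * (256 * real D + 1) ^ 9 * (real k' / \<epsilon>) ^ 20)"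
      using time_real_bound[OF S1 S' K' z eps, of n] by simp
    also have "\<dots> \<le> 15 * real (nnz A) + real n * (2 + 205600 * (256 * real D + 1) ^ 9 * (real k' / \<epsilon>) ^ 20)"
      by (intro add_left_mono mult_left_mono) auto
    finally show ?thesis using P by blast
  qed
qed

lemma nonzeros_listable:
  assumes "A \<in> carrier_mat n n" shows "\<exists>es. lists_nonzeros A es"
proof -
  have "nz_positions A \<subseteq> {..<n} \<times> {..<n}" using assms by (auto simp: nz_positions_def)
  then have "finite (nz_positions A)" by (rule finite_subset) simp
  then show ?thesis unfolding lists_nonzeros_def using finite_distinct_list by metis
qed

theorem theorem2:
  shows
    "(\<forall>(m::nat) (n::nat) (k::nat) (k'::nat) (\<epsilon>::real) (A::real mat) (W::real mat).
        n = 2 ^ m \<and> k \<ge> 1 \<and> \<epsilon> > 0 \<and> A \<in> carrier_mat n n \<and> binary_mat n W \<and>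
        k' = k * 2 ^ rand_cc m \<epsilon> (mat_fun W) \<longrightarrow>
          (\<exists>L. masked_solution n k k' \<epsilon> A W L)) \<and>
     (\<forall>\<delta>::real. \<delta> > 0 \<longrightarrow>
       (\<exists>(prog::com) (C::real) (p::real poly).
         \<forall>(m::nat) (n::nat) (k::nat) (k'::nat) (\<epsilon>::real) (A::real mat) (W::real mat) es.
           n = 2 ^ m \<and> k \<ge> 1 \<and> \<epsilon> > 0 \<and> A \<in> carrier_mat n n \<and> binary_mat n W \<and>
           k' = k * 2 ^ rand_cc m \<epsilon> (mat_fun W) \<and> lists_nonzeros A es \<longrightarrow>
             (\<exists>T::nat. real T \<le> C * real (nnz A) + real n * poly p (real k' / \<epsilon>) \<and>
               measure_pmf.prob (ram_run T ([prog], ram_input n k' \<epsilon> A es W))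
                 {(K, s). K = [] \<and> masked_solution n k k' \<epsilon> A W (ram_output n s)} \<ge> 1 - \<delta>)))"
proof (intro conjI allI impI, elim conjE, goal_cases)
  case h: (1 m n k k' \<epsilon> A W)
  obtain es where es: "lists_nonzeros A es" using nonzeros_listable[OF h(4)] by blast
  show "\<exists>L. masked_solution n k k' \<epsilon> A W L"
  \<comment> \<open>With failure probability at most 1/2 some run succeeds, and its output is a
    witness.\<close>
  proof (rule ccontr)
    assume none: "\<not> (\<exists>L. masked_solution n k k' \<epsilon> A W L)"
    obtain T where "measure_pmf.prob (ram_run T ([program 2], ram_input n k' \<epsilon> A es W))
      {(K, s). K = [] \<and> masked_solution n k k' \<epsilon> A W (ram_output n s)} \<ge> 1 - 1 / real (2::nat)"
      using program_correct[OF h es, of 2] by auto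
    then show False using none by simp
  qed
next
  case \<delta>: (2 \<delta>)
  obtain D :: nat where D: "D \<ge> 1" "1 / real D \<le> \<delta>"
  proof -
    obtain D :: nat where "D > 0" "inverse (real D) < \<delta>" using ex_inverse_of_nat_less[OF \<delta>] by blast
    then show ?thesis by (intro that[of D]) (auto simp: field_simps)
  qed
  \<comment> \<open>The program, the constant and the polynomial depend on \<delta> through D only,
    since they are fixed before the inputs.\<close>
  show ?case
  proof (rule exI[of _ "program D"], rule exI[of _ 15],
      rule exI[of _ "monom (205600 * (256 * real D + 1) ^ 9) 20 + [:2:]"], intro allI impI, elim conjE, goal_cases)
    case h: (1 m n k k' \<epsilon> A W es)
    have p: "poly (monom (205600 * (256 * real D + 1) ^ 9) 20 + [:2:]) z = 2 + 205600 * (256 * real D + 1) ^ 9 * z ^ 20" for z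
      by (simp add: poly_monom)
    obtain T where T: "real T \<le> 15 * real (nnz A) + real n * (2 + 205600 * (256 * real D + 1) ^ 9 * (real k' / \<epsilon>) ^ 20)"
      "measure_pmf.prob (ram_run T ([program D], ram_input n k' \<epsilon> A es W))
        {(K, s). K = [] \<and> masked_solution n k k' \<epsilon> A W (ram_output n s)} \<ge> 1 - 1 / real D"
      using program_correct[OF h D(1)] by blast
    then show ?case
      using D(2) unfolding p by (intro exI[of _ T]) auto
  qed
qed

end
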